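(* For every integer $N\ge2$, the cost of the generalized Thompson group $F(N)$ is $C(F(N))=1$.
   Context: For an integer $N\ge 2$, an $N$-adic rational is a number $k/N^m$ with $k,m\in\mathbb{Z}$. The generalized Thompson group $F(N)$ is the group (under composition) of piecewise linear homeomorphisms $f:[0,1]\to[0,1]$ that are differentiable except at finitely many points, all of which are $N$-adic rationals, and whose derivatives on intervals of differentiability are (integer) powers of $N$. It is a known fact that $F(N)$ has the infinite presentation $F(N)=\langle x_0,x_1,\dots,x_i,\dots \mid x_jx_i=x_ix_{j+N-1},\ i<j\rangle$. Cost (Gaboriau). Let $(X,\lambda)$ be a standard (atomless) probability space and $R$ a measure-preserving countable Borel equivalence relation on it, i.e. $R\subset X\times X$ is Borel, almost every class is at most countable, and every automorphism $T$ of $X$ whose graph is contained in $R$ preserves $\lambda$ (an SP1 equivalence relation). A graphing of $R$ is a countable family $\Phi=(\varphi_i:A_i\to B_i)_{i\in I}$ of measure-preserving Borel partial isomorphisms between Borel subsets of $X$ such that the smallest equivalence relation $R_\Phi$ containing all pairs $(x,\varphi_i(x))$, $x\in A_i$, equals $R$ (up to null sets). Its cost is $C(\Phi)=\sum_{i}\lambda(A_i)$, and $C(R)=\inf\{C(\Phi) : \Phi \text{ a graphing of } R\}$. The cost of a countable discrete group $G$ is $$C(G)=\inf\{C(R) : R \text{ is the orbit equivalence relation of a free, measure-preserving action of } G \text{ on } (X,\lambda)\}.$$ *)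

theory Defs
  imports "HOL-Probability.Probability" "HOL-Algebra.Group_Action"
begin

section \<open>The generalized Thompson groups\<close>

definition nadic_rationals :: "nat \<Rightarrow> real set" where
  "nadic_rationals N = {real_of_int k / real N powi m | k m :: int. True}"

definition piecewise_linear_on :: "real \<Rightarrow> real \<Rightarrow> (real \<Rightarrow> real) \<Rightarrow> bool" where
  "piecewise_linear_on a b f \<longleftrightarrow>
     (\<exists>P. finite P \<and>
       (\<forall>c d. a \<le> c \<and> c < d \<and> d \<le> b \<and> {c<..<d} \<inter> P = {} \<longrightarrow>
          (\<exists>s t. \<forall>x\<in>{c<..<d}. f x = s * x + t)))"

definition nondiff_points :: "(real \<Rightarrow> real) \<Rightarrow> real set" where
  "nondiff_points f = {x \<in> {0..1}. \<not> f differentiable (at x within {0..1})}"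

text \<open>Elements are extensional functions on the unit interval (the convention of
  \<^const>\<open>BijGroup\<close>), and the product is composition.\<close>

definition thompson_carrier :: "nat \<Rightarrow> (real \<Rightarrow> real) set" where
  "thompson_carrier N =
     {f \<in> extensional {0..1}.
        (\<exists>g. homeomorphism {0..1} {0..1} f g) \<and>
        piecewise_linear_on 0 1 f \<and>
        finite (nondiff_points f) \<and>
        nondiff_points f \<subseteq> nadic_rationals N \<and>
        (\<forall>x \<in> {0..1} - nondiff_points f.
           \<exists>k::int. (f has_real_derivative (real N powi k)) (at x within {0..1}))}"

definition thompson_group :: "nat \<Rightarrow> (real \<Rightarrow> real) monoid" where
  "thompson_group N = BijGroup {0..1} \<lparr>carrier := thompson_carrier N\<rparr>"


section \<open>Standard atomless probability spaces\<close>

definition standard_borel :: "'a measure \<Rightarrow> bool" where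
  "standard_borel M \<longleftrightarrow>
     (\<exists>X. completely_metrizable_space X \<and> second_countable X \<and>
          topspace X = space M \<and> sets M = sigma_sets (space M) {U. openin X U})"

definition atomless :: "'a measure \<Rightarrow> bool" where
  "atomless M \<longleftrightarrow>
     (\<forall>A\<in>sets M. 0 < emeasure M A \<longrightarrow>
        (\<exists>B\<in>sets M. B \<subseteq> A \<and> 0 < emeasure M B \<and> emeasure M B < emeasure M A))"

definition standard_atomless_prob_space :: "'a measure \<Rightarrow> bool" where
  "standard_atomless_prob_space M \<longleftrightarrow> prob_space M \<and> standard_borel M \<and> atomless M"


section \<open>Cost of an equivalence relation\<close>

definition partial_isomorphism ::
    "'a measure \<Rightarrow> 'a set \<Rightarrow> 'a set \<Rightarrow> ('a \<Rightarrow> 'a) \<Rightarrow> bool" where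
  "partial_isomorphism M A B f \<longleftrightarrow>
     A \<in> sets M \<and> B \<in> sets M \<and> bij_betw f A B \<and>
     f \<in> measurable (restrict_space M A) (restrict_space M B) \<and>
     inv_into A f \<in> measurable (restrict_space M B) (restrict_space M A) \<and>
     (\<forall>C\<in>sets M. C \<subseteq> A \<longrightarrow> emeasure M (f ` C) = emeasure M C)"

definition automorphism :: "'a measure \<Rightarrow> ('a \<Rightarrow> 'a) \<Rightarrow> bool" where
  "automorphism M T \<longleftrightarrow>
     bij_betw T (space M) (space M) \<and> T \<in> measurable M M \<and>
     inv_into (space M) T \<in> measurable M M"

definition SP1_relation :: "'a measure \<Rightarrow> ('a \<times> 'a) set \<Rightarrow> bool" where
  "SP1_relation M R \<longleftrightarrow>
     equiv (space M) R \<and> R \<in> sets (M \<Otimes>\<^sub>M M) \<and>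
     (AE x in M. countable (R `` {x})) \<and>
     (\<forall>T. automorphism M T \<longrightarrow> (\<forall>x\<in>space M. (x, T x) \<in> R) \<longrightarrow> distr M M T = M)"

definition generated_relation ::
    "'a measure \<Rightarrow> (nat \<Rightarrow> 'a set) \<Rightarrow> (nat \<Rightarrow> 'a \<Rightarrow> 'a) \<Rightarrow> ('a \<times> 'a) set" where
  "generated_relation M A f =
     \<Inter>{E. equiv (space M) E \<and> (\<forall>i. \<forall>x\<in>A i. (x, f i x) \<in> E)}"

text \<open>Countable families are indexed by the natural numbers; finite ones are padded with
  partial isomorphisms of empty domain, which contribute neither pairs nor cost.
  Equality up to null sets means that almost every point has the same class for both relations.\<close>

definition graphing ::
    "'a measure \<Rightarrow> ('a \<times> 'a) set \<Rightarrow>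
     (nat \<Rightarrow> 'a set) \<Rightarrow> (nat \<Rightarrow> 'a set) \<Rightarrow> (nat \<Rightarrow> 'a \<Rightarrow> 'a) \<Rightarrow> bool" where
  "graphing M R A B f \<longleftrightarrow>
     (\<forall>i. partial_isomorphism M (A i) (B i) (f i)) \<and>
     (AE x in M. generated_relation M A f `` {x} = R `` {x})"

definition relation_cost :: "'a measure \<Rightarrow> ('a \<times> 'a) set \<Rightarrow> ennreal" where
  "relation_cost M R = Inf {(\<Sum>i. emeasure M (A i)) | A B f. graphing M R A B f}"


section \<open>Cost of a group\<close>

text \<open>Freeness is understood almost everywhere: almost every point has trivial stabilizer.\<close>

definition free_mp_action :: "('g, 'b) monoid_scheme \<Rightarrow> 'a measure \<Rightarrow> ('g \<Rightarrow> 'a \<Rightarrow> 'a) \<Rightarrow> bool" where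
  "free_mp_action G M \<phi> \<longleftrightarrow>
     group_action G (space M) \<phi> \<and>
     (\<forall>g\<in>carrier G. \<phi> g \<in> measurable M M \<and> distr M M (\<phi> g) = M) \<and>
     (AE x in M. stabilizer G \<phi> x = {\<one>\<^bsub>G\<^esub>})"

definition orbit_relation :: "('g, 'b) monoid_scheme \<Rightarrow> 'a measure \<Rightarrow> ('g \<Rightarrow> 'a \<Rightarrow> 'a) \<Rightarrow> ('a \<times> 'a) set" where
  "orbit_relation G M \<phi> = {(x, y). x \<in> space M \<and> y \<in> orbit G \<phi> x}"

definition group_cost :: "'a measure \<Rightarrow> ('g, 'b) monoid_scheme \<Rightarrow> ennreal" where
  "group_cost M G =
     Inf {relation_cost M (orbit_relation G M \<phi>) | \<phi>. free_mp_action G M \<phi>}"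

text \<open>Orbit relations of free measure-preserving actions of countable groups are SP1, so the
  infimum above only involves costs of SP1 relations.\<close>

lemma standard_borel_separating:
  assumes "standard_borel M"
  obtains \<B> where "countable \<B>" "\<B> \<subseteq> sets M"
    "\<And>x y. x \<in> space M \<Longrightarrow> y \<in> space M \<Longrightarrow> x \<noteq> y \<Longrightarrow> \<exists>U\<in>\<B>. x \<in> U \<and> y \<notin> U"
proof -
  obtain X where X: "completely_metrizable_space X" "second_countable X"
      "topspace X = space M" "sets M = sigma_sets (space M) {U. openin X U}"
    using assms unfolding standard_borel_def by blast
  obtain \<B> where B: "countable \<B>" "\<And>V. V \<in> \<B> \<Longrightarrow> openin X V"
      "\<And>U x. openin X U \<Longrightarrow> x \<in> U \<Longrightarrow> \<exists>V \<in> \<B>. x \<in> V \<and> V \<subseteq> U"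
    using X(2) unfolding second_countable_def by metis
  have t1: "t1_space X"
    using X(1) by (simp add: completely_metrizable_imp_metrizable_space metrizable_imp_t1_space)
  show thesis
  proof
    show "countable \<B>" by fact
    show "\<B> \<subseteq> sets M" using B(2) X(4) by auto
    fix x y assume "x \<in> space M" "y \<in> space M" "x \<noteq> y"
    then obtain U where "openin X U" "x \<in> U" "y \<notin> U"
      using t1 X(3) unfolding t1_space_def by metis
    then show "\<exists>U\<in>\<B>. x \<in> U \<and> y \<notin> U" using B(3) by blast
  qed
qed

lemma standard_borel_diagonal:
  assumes "standard_borel M"
  shows "{p \<in> space (M \<Otimes>\<^sub>M M). fst p = snd p} \<in> sets (M \<Otimes>\<^sub>M M)"
proof -
  obtain \<B> where B: "countable \<B>" "\<B> \<subseteq> sets M"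
      "\<And>x y. x \<in> space M \<Longrightarrow> y \<in> space M \<Longrightarrow> x \<noteq> y \<Longrightarrow> \<exists>U\<in>\<B>. x \<in> U \<and> y \<notin> U"
    using standard_borel_separating[OF assms] by blast
  have "{p \<in> space (M \<Otimes>\<^sub>M M). fst p = snd p} =
      space (M \<Otimes>\<^sub>M M) - (\<Union>U\<in>\<B>. U \<times> (space M - U))"
    by (auto simp: space_pair_measure) (meson B(3))
  also have "\<dots> \<in> sets (M \<Otimes>\<^sub>M M)"
    using B(1,2) by (intro sets.Diff sets.top sets.countable_UN') auto
  finally show ?thesis .
qed

lemma standard_borel_eq_sets:
  assumes "standard_borel M" "f \<in> measurable L M" "g \<in> measurable L M"
  shows "{x \<in> space L. f x = g x} \<in> sets L"
proof -
  have "(\<lambda>x. (f x, g x)) \<in> measurable L (M \<Otimes>\<^sub>M M)"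
    using assms by simp
  from measurable_sets[OF this standard_borel_diagonal[OF assms(1)]]
  have "(\<lambda>x. (f x, g x)) -` {p \<in> space (M \<Otimes>\<^sub>M M). fst p = snd p} \<inter> space L \<in> sets L" .
  also have "(\<lambda>x. (f x, g x)) -` {p \<in> space (M \<Otimes>\<^sub>M M). fst p = snd p} \<inter> space L
      = {x \<in> space L. f x = g x}"
    using assms(2,3)[THEN measurable_space] by (auto simp: space_pair_measure)
  finally show ?thesis .
qed

lemma SP1_orbit_relation:
  fixes G (structure)
  assumes std: "standard_atomless_prob_space M" and cnt: "countable (carrier G)"
    and act: "free_mp_action G M \<phi>"
  shows "SP1_relation M (orbit_relation G M \<phi>)"
proof -
  interpret group_action G "space M" \<phi>
    using act by (simp add: free_mp_action_def)
  have grp: "group G"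
    using group_hom group_hom.axioms(1) by blast
  have sb: "standard_borel M"
    using std by (simp add: standard_atomless_prob_space_def)
  have meas: "\<phi> g \<in> measurable M M" and pres: "distr M M (\<phi> g) = M" if "g \<in> carrier G" for g
    using act that by (auto simp: free_mp_action_def)
  have orb: "orbit G \<phi> x \<subseteq> space M" if "x \<in> space M" for x
    using meas that by (auto simp: orbit_def dest: measurable_space)
  have eq: "equiv (space M) (orbit_relation G M \<phi>)"
  proof (rule equivI)
    show "orbit_relation G M \<phi> \<subseteq> space M \<times> space M"
      using orb by (auto simp: orbit_relation_def)
    show "refl_on (space M) (orbit_relation G M \<phi>)"
      using orbit_refl by (auto simp: refl_on_def orbit_relation_def)
    show "sym (orbit_relation G M \<phi>)"
      using orbit_sym orb by (auto simp: sym_def orbit_relation_def)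
    show "trans (orbit_relation G M \<phi>)"
    proof (rule transI)
      fix x y z assume xy: "(x, y) \<in> orbit_relation G M \<phi>" and yz: "(y, z) \<in> orbit_relation G M \<phi>"
      then have "x \<in> space M" "y \<in> space M" "z \<in> space M" "y \<in> orbit G \<phi> x" "z \<in> orbit G \<phi> y"
        using orb by (auto simp: orbit_relation_def)
      then show "(x, z) \<in> orbit_relation G M \<phi>"
        using orbit_trans[of x y z] by (simp add: orbit_relation_def)
    qed
  qed
  have "orbit_relation G M \<phi> =
      (\<Union>g\<in>carrier G. {p \<in> space (M \<Otimes>\<^sub>M M). snd p = \<phi> g (fst p)})"
    using meas[THEN measurable_space]
    by (force simp: orbit_relation_def orbit_def space_pair_measure)
  also have "\<dots> \<in> sets (M \<Otimes>\<^sub>M M)"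
    using meas by (intro sets.countable_UN'[OF cnt] image_subsetI standard_borel_eq_sets[OF sb]) auto
  finally have borel: "orbit_relation G M \<phi> \<in> sets (M \<Otimes>\<^sub>M M)" .
  have cls: "countable (orbit_relation G M \<phi> `` {x})" for x
  proof (rule countable_subset)
    show "orbit_relation G M \<phi> `` {x} \<subseteq> (\<lambda>g. \<phi> g x) ` carrier G"
      by (auto simp: orbit_relation_def orbit_def)
    show "countable ((\<lambda>g. \<phi> g x) ` carrier G)" using cnt by simp
  qed
  have inv: "distr M M T = M"
    if T: "automorphism M T" "\<forall>x\<in>space M. (x, T x) \<in> orbit_relation G M \<phi>" for T
  proof -
    have Tm: "T \<in> measurable M M" and Tb: "bij_betw T (space M) (space M)"
      using T(1) by (auto simp: automorphism_def)
    have ne: "carrier G \<noteq> {}" using group.is_monoid[OF grp, THEN monoid.one_closed] by blast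
    define e where "e = from_nat_into (carrier G)"
    have e: "e n \<in> carrier G" for n using ne by (simp add: e_def from_nat_into)
    have ex: "\<exists>n. T x = \<phi> (e n) x" if "x \<in> space M" for x
    proof -
      obtain g where g: "g \<in> carrier G" "T x = \<phi> g x"
        using T(2) \<open>x \<in> space M\<close> by (auto simp: orbit_relation_def orbit_def)
      obtain n where "e n = g" using from_nat_into_surj[OF cnt g(1)] by (auto simp: e_def)
      then show ?thesis using g(2) by blast
    qed
    define D where "D = disjointed (\<lambda>n. {x \<in> space M. T x = \<phi> (e n) x})"
    have D: "D n \<in> sets M" for n
    proof -
      have "range (\<lambda>n. {x \<in> space M. T x = \<phi> (e n) x}) \<subseteq> sets M"
        using standard_borel_eq_sets[OF sb Tm meas[OF e]] by blast
      from sets.range_disjointed_sets[OF this] show ?thesis by (auto simp: D_def)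
    qed
    have Dd: "disjoint_family D" by (simp add: D_def disjoint_family_disjointed)
    have DU: "(\<Union>n. D n) = space M"
      unfolding D_def UN_disjointed_eq using ex by auto
    have DT: "T x = \<phi> (e n) x" if "x \<in> D n" for x n
      using that disjointed_subset[of "\<lambda>n. {x \<in> space M. T x = \<phi> (e n) x}" n]
      by (auto simp: D_def)
    show ?thesis
    proof (rule measure_eqI)
      fix A assume "A \<in> sets (distr M M T)"
      then have A: "A \<in> sets M" by simp
      define P where "P n = T -` A \<inter> D n" for n
      have DM: "D n \<subseteq> space M" for n using D sets.sets_into_space by blast
      have PM: "P n \<in> sets M" for n
      proof -
        have "P n = (T -` A \<inter> space M) \<inter> D n" using DM by (auto simp: P_def)
        then show ?thesis using measurable_sets[OF Tm A] D by simp
      qed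
      have inve: "inv (e n) \<in> carrier G" for n
        using group.inv_closed[OF grp e] .
      have im: "\<phi> (inv (e n)) -` P n \<inter> space M = T ` P n" for n
      proof -
        have eb: "\<phi> (inv (e n)) (\<phi> (e n) x) = x" "\<phi> (e n) (\<phi> (inv (e n)) x) = x"
          if "x \<in> space M" for x
          using orbit_sym_aux[OF e[of n] that refl] orbit_sym_aux[OF inve[of n] that refl]
            group.inv_inv[OF grp e[of n]] by simp_all
        show ?thesis
        proof (intro equalityI subsetI)
          fix y assume y: "y \<in> \<phi> (inv (e n)) -` P n \<inter> space M"
          then have "T (\<phi> (inv (e n)) y) = y" using DT eb(2) by (auto simp: P_def)
          then show "y \<in> T ` P n" using y by force
        next
          fix y assume "y \<in> T ` P n"
          then obtain x where x: "x \<in> P n" "y = T x" by blast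
          then have xD: "x \<in> D n" by (simp add: P_def)
          then have xM: "x \<in> space M" using DM by blast
          have "y \<in> space M" using x(2) xM measurable_space[OF Tm] by simp
          moreover have "\<phi> (inv (e n)) y = x" using x(2) DT[OF xD] eb(1)[OF xM] by simp
          ultimately show "y \<in> \<phi> (inv (e n)) -` P n \<inter> space M" using x(1) by simp
        qed
      qed
      have TP: "T ` P n \<in> sets M" for n
        using measurable_sets[OF meas[OF inve[of n]] PM[of n]] unfolding im .
      have TPe: "emeasure M (T ` P n) = emeasure M (P n)" for n
        using emeasure_distr[OF meas[OF inve[of n]] PM[of n]] unfolding pres[OF inve] im by simp
      have U1: "(\<Union>n. P n) = T -` A \<inter> space M" using DU by (auto simp: P_def)
      have Asp: "A \<subseteq> space M" using A sets.sets_into_space by blast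
      have U2: "(\<Union>n. T ` P n) = A"
      proof -
        have "(\<Union>n. T ` P n) = T ` (T -` A \<inter> space M)" using U1 by blast
        also have "\<dots> = A \<inter> T ` space M" by auto
        also have "\<dots> = A" using bij_betw_imp_surj_on[OF Tb] Asp by auto
        finally show ?thesis .
      qed
      have P1: "disjoint_family P" using Dd by (auto simp: disjoint_family_on_def P_def)
      have P2: "disjoint_family (\<lambda>n. T ` P n)"
        unfolding disjoint_family_on_def
      proof (intro ballI impI)
        fix m n :: nat assume "m \<noteq> n"
        then have "P m \<inter> P n = {}" using P1 by (auto simp: disjoint_family_on_def)
        moreover have "inj_on T (space M)" using Tb by (simp add: bij_betw_def)
        moreover have "P m \<subseteq> space M" "P n \<subseteq> space M" using DM by (auto simp: P_def)
        ultimately show "T ` P m \<inter> T ` P n = {}"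
          by (metis image_empty inj_on_image_Int)
      qed
      have "emeasure (distr M M T) A = emeasure M (\<Union>n. P n)"
        using emeasure_distr[OF Tm A] U1 by simp
      also have "\<dots> = (\<Sum>n. emeasure M (P n))"
        using PM P1 by (intro suminf_emeasure[symmetric]) auto
      also have "\<dots> = (\<Sum>n. emeasure M (T ` P n))" by (simp add: TPe)
      also have "\<dots> = emeasure M (\<Union>n. T ` P n)"
        using TP P2 by (intro suminf_emeasure) auto
      finally show "emeasure (distr M M T) A = emeasure M A" by (simp add: U2)
    qed simp
  qed
  show ?thesis
    unfolding SP1_relation_def using eq borel cls inv by auto
qed

end

theory Submission
  imports Defs
begin

text \<open>
  Lower bound: an infinite group acting freely has complete sections \<open>S\<close> of arbitrarily small measure,
  and given any graphing, each point outside \<open>S\<close> can be charged to a different edge leading towards \<open>S\<close>;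
  hence the cost of the graphing is at least \<open>1 - \<mu>(S)\<close>.

  Upper bound: let \<open>c\<^sub>n\<close> be copies of one bump homeomorphism, rescaled by \<open>N\<close>-powers so that
  their supports are disjoint and shrink to \<open>0\<close>. They commute, and since every \<open>g\<close> is linear with
  slope \<open>N\<^sup>k\<close> near \<open>0\<close>, it conjugates \<open>c\<^sub>m\<close> to \<open>c\<^sub>m\<^sub>-\<^sub>k\<close> for large \<open>m\<close>. If \<open>c\<close> and \<open>g c g\<^sup>-\<^sup>1\<close> are
  already generated, \<open>g\<close> need only be added on a small complete section of the powers of \<open>c\<close>. So
  \<open>c\<^sub>0\<close> costs \<open>1\<close>, and the other \<open>c\<^sub>n\<close> and then all remaining elements are added at total cost \<open>\<epsilon>\<close>.

  The infimum is over a nonempty set: the Bernoulli shift is free, and it is carried over to the given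
  space because all standard atomless probability spaces are isomorphic up to null sets.
\<close>

section \<open>Complete sections of small measure\<close>

text \<open>If some element of infinite order commuted with the whole group, every other element
  could be added over a small section of its powers. The bumps replace such an element:
  \<open>g c\<^sub>m = c\<^sub>n g\<close> with m and n depending on g suffices, because both bumps
  have been generated beforehand. Their sizes are powers of N so that dilations by N^k map the
  family to itself. Small sections come from disjointness: if the translates of S by a finite F are
  disjoint, then |F| \<mu>(S) \<le> 1, while maximality of S makes almost every point reach S by
  some inv b a with a, b in F. Two features of the definitions shape the details. Membership in the
  group constrains only derivatives and points of nondifferentiability, so N-adic intercepts have to
  be derived, starting from f 0 = 0. An action is a homomorphism into genuine bijections of the
  space, whereas freeness and isomorphism of probability spaces hold only almost everywhere, so
  exceptional null sets have to be repaired pointwise.\<close>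

locale free_pmp_action =
  fixes G (structure) and M :: "'a measure" and \<phi>
  assumes free_mp: "free_mp_action G M \<phi>"
    and prob: "prob_space M"
    and std: "standard_borel M"

sublocale free_pmp_action \<subseteq> group_action G "space M" \<phi>
  using free_mp by (simp add: free_mp_action_def)

sublocale free_pmp_action \<subseteq> group G
  using group_hom group_hom.axioms(1) by blast

sublocale free_pmp_action \<subseteq> prob_space M
  by (rule prob)

context free_pmp_action
begin

lemma act_measurable: "g \<in> carrier G \<Longrightarrow> \<phi> g \<in> measurable M M"
  using free_mp by (simp add: free_mp_action_def)

lemma act_space: "g \<in> carrier G \<Longrightarrow> x \<in> space M \<Longrightarrow> \<phi> g x \<in> space M"
  by (rule measurable_space[OF act_measurable])

lemma act_one: "x \<in> space M \<Longrightarrow> \<phi> \<one> x = x"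
  by (simp flip: id_eq_one)

lemma act_inv_act: "g \<in> carrier G \<Longrightarrow> x \<in> space M \<Longrightarrow> \<phi> (inv g) (\<phi> g x) = x"
  by (rule orbit_sym_aux[OF _ _ refl])

lemma act_act_inv: "g \<in> carrier G \<Longrightarrow> x \<in> space M \<Longrightarrow> \<phi> g (\<phi> (inv g) x) = x"
  using orbit_sym_aux[OF inv_closed _ refl] by simp

lemma act_mult: "g \<in> carrier G \<Longrightarrow> h \<in> carrier G \<Longrightarrow> x \<in> space M \<Longrightarrow> \<phi> (g \<otimes> h) x = \<phi> g (\<phi> h x)"
  by (rule composition_rule)

lemma act_image_eq_vimage:
  assumes "g \<in> carrier G" "A \<subseteq> space M"
  shows "\<phi> g ` A = \<phi> (inv g) -` A \<inter> space M"
proof (intro equalityI subsetI)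
  fix y assume "y \<in> \<phi> g ` A"
  then show "y \<in> \<phi> (inv g) -` A \<inter> space M"
    using assms act_inv_act act_space by auto
next
  fix y assume y: "y \<in> \<phi> (inv g) -` A \<inter> space M"
  then have "y = \<phi> g (\<phi> (inv g) y)" using act_act_inv assms by simp
  then show "y \<in> \<phi> g ` A" using y by blast
qed

lemma act_image_sets:
  assumes "g \<in> carrier G" "A \<in> sets M"
  shows "\<phi> g ` A \<in> sets M"
  unfolding act_image_eq_vimage[OF assms(1) sets.sets_into_space[OF assms(2)]]
  using assms by (intro measurable_sets[OF act_measurable]) auto

lemma emeasure_act_vimage:
  assumes "g \<in> carrier G" "A \<in> sets M"
  shows "emeasure M (\<phi> g -` A \<inter> space M) = emeasure M A"
proof -
  have "distr M M (\<phi> g) = M" using free_mp assms(1) by (simp add: free_mp_action_def)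
  then show ?thesis using emeasure_distr[OF act_measurable[OF assms(1)] assms(2)] by simp
qed

lemma emeasure_act_image:
  assumes "g \<in> carrier G" "A \<in> sets M"
  shows "emeasure M (\<phi> g ` A) = emeasure M A"
  unfolding act_image_eq_vimage[OF assms(1) sets.sets_into_space[OF assms(2)]]
  using assms by (intro emeasure_act_vimage) auto

lemma AE_act_neq:
  assumes "a \<in> carrier G" "b \<in> carrier G" "a \<noteq> b"
  shows "AE x in M. \<phi> a x \<noteq> \<phi> b x"
proof -
  have "AE x in M. stabilizer G \<phi> x = {\<one>}" using free_mp by (simp add: free_mp_action_def)
  then show ?thesis
  proof (rule AE_mp, intro AE_I2 impI)
    fix x assume x: "x \<in> space M" "stabilizer G \<phi> x = {\<one>}"
    show "\<phi> a x \<noteq> \<phi> b x"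
    proof
      assume "\<phi> a x = \<phi> b x"
      then have "\<phi> (inv b \<otimes> a) x = x" using assms x by (simp add: act_mult act_inv_act)
      then have "inv b \<otimes> a = \<one>" using x(2) assms by (auto simp: stabilizer_def)
      then show False using assms
        using inv_equality[of "inv b" a] by (metis inv_closed inv_inv)
    qed
  qed
qed

lemma partial_isomorphism_act:
  assumes g: "g \<in> carrier G" and A: "A \<in> sets M"
  shows "partial_isomorphism M A (\<phi> g ` A) (\<phi> g)"
proof -
  have AM: "A \<subseteq> space M" using A sets.sets_into_space by blast
  have B: "\<phi> g ` A \<in> sets M" using act_image_sets g A by blast
  have inj: "inj_on (\<phi> g) A"
    using act_inv_act[OF g] AM by (metis inj_on_inverseI subset_iff)
  have m1: "\<phi> g \<in> measurable (restrict_space M A) (restrict_space M (\<phi> g ` A))"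
    using act_measurable[OF g] by (intro measurable_restrict_space3) auto
  have "\<phi> (inv g) \<in> measurable (restrict_space M (\<phi> g ` A)) (restrict_space M A)"
    using act_measurable[of "inv g"] g AM act_inv_act
    by (intro measurable_restrict_space3) (auto simp: subset_iff)
  moreover have "inv_into A (\<phi> g) y = \<phi> (inv g) y" if "y \<in> space (restrict_space M (\<phi> g ` A))" for y
    using that inj act_inv_act[OF g] AM by (auto simp: space_restrict_space subset_iff)
  ultimately have m2: "inv_into A (\<phi> g) \<in> measurable (restrict_space M (\<phi> g ` A)) (restrict_space M A)"
    by (subst measurable_cong) auto
  show ?thesis
    unfolding partial_isomorphism_def
    using A B inj m1 m2 emeasure_act_image[OF g] by (auto simp: bij_betw_def)
qed

text \<open>For distinct a, b in F the points a x and b x differ almost surely, so some member of a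
  countable separating family contains a x and misses b x. Choosing a member for every pair sorts
  almost all points into countably many classes; within a class, the member chosen for (a, b)
  contains every a x and no b y.\<close>

lemma marker_cover:
  assumes F: "finite F" "F \<subseteq> carrier G"
  obtains A :: "nat \<Rightarrow> 'a set" where
    "\<And>k. A k \<in> sets M"
    "\<And>k x y a b. x \<in> A k \<Longrightarrow> y \<in> A k \<Longrightarrow> a \<in> F \<Longrightarrow> b \<in> F \<Longrightarrow> a \<noteq> b \<Longrightarrow> \<phi> a x \<noteq> \<phi> b y"
    "AE x in M. \<exists>k. x \<in> A k"
proof -
  obtain \<B> where B: "countable \<B>" "\<B> \<subseteq> sets M"
      "\<And>x y. x \<in> space M \<Longrightarrow> y \<in> space M \<Longrightarrow> x \<noteq> y \<Longrightarrow> \<exists>U\<in>\<B>. x \<in> U \<and> y \<notin> U"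
    using standard_borel_separating[OF std] by blast
  define I where "I = {(a, b). a \<in> F \<and> b \<in> F \<and> a \<noteq> b}"
  have "I \<subseteq> F \<times> F" by (auto simp: I_def)
  then have I: "finite I" using F(1) finite_subset by blast
  \<comment> \<open>Adding {} keeps \<open>\<U>\<close> nonempty when \<open>\<B>\<close> is empty,
    so that \<open>from_nat_into\<close> enumerates it; a choice that uses {} yields an empty
    class.\<close>
  define \<U> where "\<U> = (\<Pi>\<^sub>E p\<in>I. insert {} \<B>)"
  have U: "countable \<U>" "\<U> \<noteq> {}"
    using I B(1) by (auto simp: \<U>_def PiE_eq_empty_iff intro!: countable_PiE)
  define A where "A u = {x \<in> space M. \<forall>p\<in>I. \<phi> (fst p) x \<in> u p \<and> \<phi> (snd p) x \<notin> u p}" for u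
  have Am: "A u \<in> sets M" if "u \<in> \<U>" for u
  proof -
    have "{x \<in> space M. \<phi> (fst p) x \<in> u p \<and> \<phi> (snd p) x \<notin> u p} \<in> sets M" if p: "p \<in> I" for p
    proof -
      have "u p \<in> insert {} \<B>" using p \<open>u \<in> \<U>\<close> unfolding \<U>_def by (rule PiE_mem[rotated])
      then have up: "u p \<in> sets M" using B(2) by auto
      have ab: "fst p \<in> carrier G" "snd p \<in> carrier G" using p F(2) by (auto simp: I_def)
      have "{x \<in> space M. \<phi> (fst p) x \<in> u p \<and> \<phi> (snd p) x \<notin> u p} =
          (\<phi> (fst p) -` u p \<inter> space M) - (\<phi> (snd p) -` u p \<inter> space M)" by auto
      then show ?thesis
        using measurable_sets[OF act_measurable[OF ab(1)] up]
          measurable_sets[OF act_measurable[OF ab(2)] up] by auto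
    qed
    then show ?thesis unfolding A_def using I by (intro sets.sets_Collect_finite_All) auto
  qed
  show thesis
  proof (rule that[of "\<lambda>k. A (from_nat_into \<U> k)"])
    show "A (from_nat_into \<U> k) \<in> sets M" for k
      using Am from_nat_into[OF U(2)] by blast
    show "\<phi> a x \<noteq> \<phi> b y" if "x \<in> A (from_nat_into \<U> k)" "y \<in> A (from_nat_into \<U> k)"
      "a \<in> F" "b \<in> F" "a \<noteq> b" for k x y a b
    proof -
      have "(a, b) \<in> I" using that by (simp add: I_def)
      then show ?thesis using that(1,2) unfolding A_def by force
    qed
    have "AE x in M. \<forall>p\<in>I. \<phi> (fst p) x \<noteq> \<phi> (snd p) x"
      using F(2) by (intro AE_finite_allI[OF I] AE_act_neq) (auto simp: I_def)
    then show "AE x in M. \<exists>k. x \<in> A (from_nat_into \<U> k)"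
    proof (rule AE_mp, intro AE_I2 impI)
      fix x assume x: "x \<in> space M" "\<forall>p\<in>I. \<phi> (fst p) x \<noteq> \<phi> (snd p) x"
      have "\<forall>p\<in>I. \<exists>U\<in>\<B>. \<phi> (fst p) x \<in> U \<and> \<phi> (snd p) x \<notin> U"
        using x F(2) by (intro ballI B(3) act_space) (auto simp: I_def)
      then obtain u where u: "\<And>p. p \<in> I \<Longrightarrow> u p \<in> \<B> \<and> \<phi> (fst p) x \<in> u p \<and> \<phi> (snd p) x \<notin> u p"
        by metis
      then have "restrict u I \<in> \<U>" "x \<in> A (restrict u I)"
        using x(1) by (auto simp: \<U>_def A_def)
      then show "\<exists>k. x \<in> A (from_nat_into \<U> k)"
        using from_nat_into_surj[OF U(1)] by metis
    qed
  qed
qed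

text \<open>Greedy construction of a maximal set whose translates by F are pairwise disjoint.
  Disjointness bounds its measure by 1 / |F|; maximality means that a point x left out satisfies a x
  = b y for some y in the set, that is, inv b a carries x into it.\<close>

lemma exists_marker:
  assumes F: "finite F" "F \<subseteq> carrier G" "F \<noteq> {}"
  obtains S where "S \<in> sets M" "of_nat (card F) * emeasure M S \<le> 1"
    "\<And>x. x \<in> space M \<Longrightarrow> \<exists>a\<in>F. \<exists>b\<in>F. \<phi> (inv b \<otimes> a) x \<in> S"
proof -
  obtain A :: "nat \<Rightarrow> 'a set" where A: "\<And>k. A k \<in> sets M"
    "\<And>k x y a b. x \<in> A k \<Longrightarrow> y \<in> A k \<Longrightarrow> a \<in> F \<Longrightarrow> b \<in> F \<Longrightarrow> a \<noteq> b \<Longrightarrow> \<phi> a x \<noteq> \<phi> b y"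
    "AE x in M. \<exists>k. x \<in> A k"
    using marker_cover[OF F(1,2)] by blast
  have Fc: "a \<in> carrier G" if "a \<in> F" for a using F(2) that by blast
  define hits where "hits T = {x \<in> space M. \<exists>a\<in>F. \<exists>b\<in>F. \<phi> (inv b \<otimes> a) x \<in> T}" for T
  have hits: "hits T \<in> sets M" if T: "T \<in> sets M" for T
  proof -
    have "hits T = (\<Union>a\<in>F. \<Union>b\<in>F. \<phi> (inv b \<otimes> a) -` T \<inter> space M)" by (auto simp: hits_def)
    also have "\<dots> \<in> sets M"
      using Fc by (intro sets.finite_UN F(1) measurable_sets[OF act_measurable T]) auto
    finally show ?thesis .
  qed
  \<comment> \<open>All admissible points of a class can be added at once: inside \<open>A k\<close>
    no two translates collide, and collisions with earlier points are what removing
    \<open>hits\<close> prevents.\<close>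
  define S where "S = rec_nat {} (\<lambda>k T. T \<union> (A k - hits T))"
  have S0: "S 0 = {}" and SS: "\<And>k. S (Suc k) = S k \<union> (A k - hits (S k))"
    by (simp_all add: S_def)
  have Sm: "S k \<in> sets M" for k
    by (induction k) (use A(1) hits in \<open>auto simp: S0 SS\<close>)
  have SM: "S k \<subseteq> space M" for k using Sm sets.sets_into_space by blast
  have AM: "A k \<subseteq> space M" for k using A(1) sets.sets_into_space by blast
  have key: "\<phi> (inv b \<otimes> a) x = y"
    if "a \<in> F" "b \<in> F" "x \<in> space M" "y \<in> space M" "\<phi> a x = \<phi> b y" for a b x y
    using that Fc by (simp add: act_mult act_inv_act)
  have dis: "\<phi> a x \<noteq> \<phi> b y" if "x \<in> S k" "y \<in> S k" "a \<in> F" "b \<in> F" "a \<noteq> b" for k x y a b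
    using that
  proof (induction k arbitrary: x y a b)
    case 0
    then show ?case by (simp add: S0)
  next
    case (Suc k)
    show ?case
    proof
      assume eq: "\<phi> a x = \<phi> b y"
      have sp: "x \<in> space M" "y \<in> space M" using Suc.prems SM by blast+
      have "\<phi> (inv b \<otimes> a) x = y" "\<phi> (inv a \<otimes> b) y = x"
        using key[of a b x y] key[of b a y x] Suc.prems sp eq by simp_all
      then have "y \<in> S k \<Longrightarrow> x \<in> hits (S k)" "x \<in> S k \<Longrightarrow> y \<in> hits (S k)"
        using sp Suc.prems(3,4) by (force simp: hits_def)+
      then show False
        using Suc.IH[of x y a b] Suc.prems A(2)[of x k y a b] eq by (auto simp: SS)
    qed
  qed
  have inc: "incseq S" by (rule incseq_SucI) (auto simp: SS)
  define T where "T = (\<Union>k. S k)"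
  have Tm: "T \<in> sets M" using Sm by (auto simp: T_def)
  have TM: "T \<subseteq> space M" using Tm sets.sets_into_space by blast
  have disT: "\<phi> a x \<noteq> \<phi> b y" if xy: "x \<in> T" "y \<in> T" and "a \<in> F" "b \<in> F" "a \<noteq> b" for x y a b
  proof -
    obtain i j where "x \<in> S i" "y \<in> S j" using xy unfolding T_def by blast
    then have "x \<in> S (max i j)" "y \<in> S (max i j)"
      using incseqD[OF inc, of i "max i j"] incseqD[OF inc, of j "max i j"] by auto
    then show ?thesis using dis that(3-5) by blast
  qed
  have "of_nat (card F) * emeasure M T = (\<Sum>a\<in>F. emeasure M (\<phi> a ` T))"
    using emeasure_act_image Fc Tm by simp
  also have "\<dots> = emeasure M (\<Union>a\<in>F. \<phi> a ` T)"
    using act_image_sets Fc Tm disT F(1)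
    by (intro sum_emeasure) (auto simp: disjoint_family_on_def)
  also have "\<dots> \<le> 1" by (rule emeasure_le_1)
  finally have small: "of_nat (card F) * emeasure M T \<le> 1" .
  have cov: "x \<in> hits T" if "x \<in> A k" for x k
  proof (cases "x \<in> hits (S k)")
    case True
    then show ?thesis by (auto simp: hits_def T_def)
  next
    case False
    then have "x \<in> S (Suc k)" using that by (simp add: SS)
    then have xT: "x \<in> T" by (auto simp only: T_def)
    obtain a where "a \<in> F" using F(3) by blast
    then have "\<phi> (inv a \<otimes> a) x \<in> T" using xT TM Fc act_one by auto
    then show ?thesis using \<open>a \<in> F\<close> xT TM by (auto simp: hits_def)
  qed
  \<comment> \<open>The uncovered points form a null set. Adjoining it leaves the measure unchanged
    and makes the covering hold at every point, with a = b on \<open>Z\<close>.\<close>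
  define Z where "Z = space M - hits T"
  have Zm: "Z \<in> sets M" using hits Tm by (auto simp: Z_def)
  have "AE x in M. x \<notin> Z"
    using A(3) by (rule AE_mp) (use cov in \<open>auto simp: Z_def\<close>)
  then have Z0: "emeasure M Z = 0" using AE_iff_null_sets[OF Zm] by auto
  show thesis
  proof (rule that[of "T \<union> Z"])
    show "T \<union> Z \<in> sets M" using Tm Zm by simp
    have "emeasure M (T \<union> Z) = emeasure M T"
      using Z0 Zm Tm by (intro emeasure_Un_null_set) auto
    then show "of_nat (card F) * emeasure M (T \<union> Z) \<le> 1" using small by simp
    show "\<exists>a\<in>F. \<exists>b\<in>F. \<phi> (inv b \<otimes> a) x \<in> T \<union> Z" if x: "x \<in> space M" for x
    proof (cases "x \<in> Z")
      case True
      obtain a where "a \<in> F" using F(3) by blast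
      then have "\<phi> (inv a \<otimes> a) x \<in> Z" using True x Fc act_one by auto
      then show ?thesis using \<open>a \<in> F\<close> by blast
    next
      case False
      then show ?thesis using x by (auto simp: Z_def hits_def)
    qed
  qed
qed

end

section \<open>Cost bounds\<close>

lemma partial_isomorphism_vimage_sets:
  assumes f: "partial_isomorphism M A B f" and T: "T \<in> sets M"
  shows "{x \<in> A. f x \<in> T} \<in> sets M"
proof -
  have A: "A \<in> sets M" and B: "B \<in> sets M" and fAB: "f ` A = B"
    and m: "f \<in> measurable (restrict_space M A) (restrict_space M B)"
    using f by (auto simp: partial_isomorphism_def bij_betw_def)
  have sp: "space (restrict_space M A) = A"
    using sets.sets_into_space[OF A] by (auto simp: space_restrict_space)
  have "T \<inter> B \<in> sets (restrict_space M B)"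
    using T B by (auto simp: sets_restrict_space_iff)
  from measurable_sets[OF m this] have "f -` (T \<inter> B) \<inter> A \<in> sets M"
    using A by (simp add: sp sets_restrict_space_iff)
  also have "f -` (T \<inter> B) \<inter> A = {x \<in> A. f x \<in> T}" using fAB by auto
  finally show ?thesis .
qed

lemma partial_isomorphism_image_sets:
  assumes f: "partial_isomorphism M A B f" and T: "T \<in> sets M"
  shows "f ` (A \<inter> T) \<in> sets M"
proof -
  have A: "A \<in> sets M" and B: "B \<in> sets M" and bij: "bij_betw f A B"
    and m: "inv_into A f \<in> measurable (restrict_space M B) (restrict_space M A)"
    using f by (auto simp: partial_isomorphism_def)
  have sp: "space (restrict_space M B) = B"
    using sets.sets_into_space[OF B] by (auto simp: space_restrict_space)
  have "T \<inter> A \<in> sets (restrict_space M A)"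
    using T A by (auto simp: sets_restrict_space_iff)
  from measurable_sets[OF m this] have "inv_into A f -` (T \<inter> A) \<inter> B \<in> sets M"
    using B by (simp add: sp sets_restrict_space_iff)
  also have "inv_into A f -` (T \<inter> A) \<inter> B = f ` (A \<inter> T)"
  proof (intro equalityI subsetI)
    fix y assume y: "y \<in> inv_into A f -` (T \<inter> A) \<inter> B"
    then have "f (inv_into A f y) = y" using bij_betw_inv_into_right[OF bij] by auto
    then show "y \<in> f ` (A \<inter> T)" using y by (metis IntD1 IntD2 IntI image_eqI vimage_eq)
  next
    fix y assume "y \<in> f ` (A \<inter> T)"
    then show "y \<in> inv_into A f -` (T \<inter> A) \<inter> B"
      using bij by (auto simp: bij_betw_def)
  qed
  finally show ?thesis .
qed

text \<open>Levitt's argument: every point outside the complete section \<open>S\<close> selects an edge of the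
  graphing that brings it closer to \<open>S\<close>, and each edge is selected at most once.\<close>

lemma graphing_cost_ge:
  assumes M: "prob_space M" and gr: "graphing M R A B f" and S: "S \<in> sets M"
    and sec: "AE x in M. \<exists>y\<in>S. (x, y) \<in> R"
  shows "1 \<le> emeasure M S + (\<Sum>i. emeasure M (A i))"
proof -
  interpret prob_space M by fact
  have iso: "partial_isomorphism M (A i) (B i) (f i)" for i
    using gr by (simp add: graphing_def)
  have Am: "A i \<in> sets M" and bij: "bij_betw (f i) (A i) (B i)"
    and pres: "\<And>C. C \<in> sets M \<Longrightarrow> C \<subseteq> A i \<Longrightarrow> emeasure M (f i ` C) = emeasure M C" for i
    using iso[of i] by (auto simp: partial_isomorphism_def)
  have Bm: "B i \<in> sets M" for i using iso[of i] by (simp add: partial_isomorphism_def)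
  have AM: "A i \<subseteq> space M" and BM: "B i \<subseteq> space M" for i
    using Am Bm sets.sets_into_space by blast+
  define adj where "adj T = (\<Union>i. {x \<in> A i. f i x \<in> T}) \<union> (\<Union>i. f i ` (A i \<inter> T))" for T
  have adj: "adj T \<in> sets M" if "T \<in> sets M" for T
    unfolding adj_def using partial_isomorphism_vimage_sets[OF iso that]
      partial_isomorphism_image_sets[OF iso that] by auto
  \<comment> \<open>\<open>C k\<close> is the ball of radius k around S in the graph metric, edges
    being traversed in both directions; \<open>D k\<close> below is the sphere of radius k +
    1.\<close>
  define C where "C = rec_nat S (\<lambda>k T. T \<union> adj T)"
  have C0: "C 0 = S" and CS: "\<And>k. C (Suc k) = C k \<union> adj (C k)"
    by (simp_all add: C_def)
  have Cm: "C k \<in> sets M" for k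
    by (induction k) (use S adj in \<open>auto simp: C0 CS\<close>)
  have inc: "incseq C" by (rule incseq_SucI) (auto simp: CS)
  define D where "D k = C (Suc k) - C k" for k
  have Dm: "D k \<in> sets M" for k using Cm by (simp add: D_def)
  have Ddis: "j = k" if "x \<in> D j" "x \<in> D k" for x j k
  proof (rule ccontr)
    assume "j \<noteq> k"
    then consider "Suc j \<le> k" | "Suc k \<le> j" by linarith
    then show False
      using incseqD[OF inc, of "Suc j" k] incseqD[OF inc, of "Suc k" j] that
      by cases (auto simp: D_def)
  qed
  \<comment> \<open>A point of \<open>D k\<close> has an edge into \<open>C k\<close>, either as its
    source (in \<open>P i k\<close>) or as its target (with source in \<open>Q i k\<close>). The
    edge decreases the distance to S on \<open>P\<close> and increases it on \<open>Q\<close>, so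
    all these pieces of \<open>A i\<close> are disjoint and together measure at most
    \<open>A i\<close>.\<close>
  define P where "P i k = {x \<in> A i. f i x \<in> C k} \<inter> D k" for i k
  define Q where "Q i k = {x \<in> A i. f i x \<in> D k} \<inter> C k" for i k
  have Pm: "P i k \<in> sets M" and Qm: "Q i k \<in> sets M" for i k
    using partial_isomorphism_vimage_sets[OF iso] Cm Dm by (auto simp: P_def Q_def)
  have PQ: "P i j \<inter> Q i k = {}" for i j k
  proof (rule ccontr)
    assume "P i j \<inter> Q i k \<noteq> {}"
    then obtain x where "x \<in> P i j" "x \<in> Q i k" by blast
    then have x: "f i x \<in> C j" "x \<in> D j" "f i x \<in> D k" "x \<in> C k" by (auto simp: P_def Q_def)
    consider "j \<le> k" | "k \<le> j" by linarith
    then show False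
      using incseqD[OF inc, of j k] incseqD[OF inc, of k j] x by cases (auto simp: D_def)
  qed
  have Dsub: "D k \<subseteq> (\<Union>i. P i k \<union> f i ` Q i k)" for k
  proof
    fix x assume x: "x \<in> D k"
    then have "x \<in> adj (C k)" by (auto simp: D_def CS)
    then consider i where "x \<in> A i" "f i x \<in> C k" | i z where "z \<in> A i" "z \<in> C k" "x = f i z"
      by (auto simp: adj_def)
    then show "x \<in> (\<Union>i. P i k \<union> f i ` Q i k)"
    proof cases
      case (1 i)
      then have "x \<in> P i k" using x by (simp add: P_def)
      then show ?thesis by blast
    next
      case (2 i z)
      then have "z \<in> Q i k" using x by (simp add: Q_def)
      then show ?thesis using 2(3) by blast
    qed
  qed
  have fQm: "f i ` Q i k \<in> sets M" for i k
  proof -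
    have "f i ` Q i k = f i ` (A i \<inter> Q i k)" by (rule arg_cong[where f="image (f i)"]) (auto simp: Q_def)
    then show ?thesis using partial_isomorphism_image_sets[OF iso Qm] by simp
  qed
  have Dle: "emeasure M (D k) \<le> (\<Sum>i. emeasure M (P i k) + emeasure M (Q i k))" for k
  proof -
    have "emeasure M (D k) \<le> emeasure M (\<Union>i. P i k \<union> f i ` Q i k)"
      using Dsub Pm fQm by (intro emeasure_mono sets.countable_UN) auto
    also have "\<dots> \<le> (\<Sum>i. emeasure M (P i k \<union> f i ` Q i k))"
      using Pm fQm by (intro emeasure_subadditive_countably) auto
    also have "\<dots> \<le> (\<Sum>i. emeasure M (P i k) + emeasure M (f i ` Q i k))"
      using Pm fQm by (intro suminf_le emeasure_subadditive) auto
    also have "\<dots> = (\<Sum>i. emeasure M (P i k) + emeasure M (Q i k))"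
    proof -
      have "emeasure M (f i ` Q i k) = emeasure M (Q i k)" for i
        by (rule pres[OF Qm]) (auto simp: Q_def)
      then show ?thesis by simp
    qed
    finally show ?thesis .
  qed
  have col: "(\<Sum>k<K. emeasure M (P i k) + emeasure M (Q i k)) \<le> emeasure M (A i)" for i K
  proof -
    have "(\<Sum>k<K. emeasure M (P i k) + emeasure M (Q i k)) = (\<Sum>k<K. emeasure M (P i k \<union> Q i k))"
      using Pm Qm PQ by (intro sum.cong refl plus_emeasure) auto
    also have "\<dots> = emeasure M (\<Union>k<K. P i k \<union> Q i k)"
    proof (rule sum_emeasure)
      show "disjoint_family_on (\<lambda>k. P i k \<union> Q i k) {..<K}"
      proof (unfold disjoint_family_on_def, intro ballI impI)
        fix j k :: nat assume "j \<noteq> k"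
        then have "P i j \<inter> P i k = {}" "Q i j \<inter> Q i k = {}"
          using Ddis by (auto simp: P_def Q_def)
        then show "(P i j \<union> Q i j) \<inter> (P i k \<union> Q i k) = {}"
          using PQ[of i j k] PQ[of i k j] by blast
      qed
    qed (use Pm Qm in auto)
    also have "\<dots> \<le> emeasure M (A i)"
      using Am by (intro emeasure_mono) (auto simp: P_def Q_def)
    finally show ?thesis .
  qed
  have CK: "emeasure M (C K) \<le> emeasure M S + (\<Sum>k<K. emeasure M (D k))" for K
  proof (induction K)
    case (Suc K)
    have "C (Suc K) = C K \<union> D K" by (auto simp: D_def CS)
    then have "emeasure M (C (Suc K)) \<le> emeasure M (C K) + emeasure M (D K)"
      using emeasure_subadditive[OF Cm Dm] by metis
    also have "\<dots> \<le> (emeasure M S + (\<Sum>k<K. emeasure M (D k))) + emeasure M (D K)"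
      using Suc.IH by (rule add_right_mono)
    finally show ?case by (simp add: add.assoc)
  qed (simp add: C0)
  have bound: "emeasure M (C K) \<le> emeasure M S + (\<Sum>i. emeasure M (A i))" for K
  proof -
    have "(\<Sum>k<K. emeasure M (D k)) \<le> (\<Sum>k<K. \<Sum>i. emeasure M (P i k) + emeasure M (Q i k))"
      by (intro sum_mono Dle)
    also have "\<dots> = (\<Sum>i. \<Sum>k<K. emeasure M (P i k) + emeasure M (Q i k))"
      by (intro suminf_sum[symmetric]) simp
    also have "\<dots> \<le> (\<Sum>i. emeasure M (A i))"
      by (intro suminf_le col) auto
    finally show ?thesis using CK[of K] add_left_mono order_trans by blast
  qed
  \<comment> \<open>Being connected to S is invariant along edges, so E contains the generated
    relation. Hence a point whose class meets S lies in one of the balls.\<close>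
  define E where "E = {(u, v). u \<in> space M \<and> v \<in> space M \<and> (u \<in> (\<Union>k. C k) \<longleftrightarrow> v \<in> (\<Union>k. C k))}"
  have "equiv (space M) E"
    by (rule equivI) (auto simp: E_def refl_on_def sym_def trans_def)
  moreover have "(x, f i x) \<in> E" if x: "x \<in> A i" for x i
  proof -
    have "x \<in> space M" "f i x \<in> space M"
      using x AM BM[of i] bij_betwE[OF bij[of i]] by auto
    moreover have "f i x \<in> C (Suc k)" if "x \<in> C k" for k
      using x that by (auto simp: CS adj_def)
    moreover have "x \<in> C (Suc k)" if "f i x \<in> C k" for k
      using x that by (auto simp: CS adj_def)
    ultimately show ?thesis unfolding E_def by blast
  qed
  ultimately have gen: "generated_relation M A f \<subseteq> E" by (auto simp: generated_relation_def)
  have "AE x in M. generated_relation M A f `` {x} = R `` {x}"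
    using gr by (simp add: graphing_def)
  with sec have "AE x in M. x \<in> (\<Union>k. C k)"
  proof eventually_elim
    case (elim x)
    then obtain y where "y \<in> S" "(x, y) \<in> R" by blast
    then have "(x, y) \<in> E" "y \<in> C 0" using elim gen by (auto simp: C0)
    then show ?case by (auto simp: E_def)
  qed
  then have "1 = emeasure M (\<Union>k. C k)"
    using Cm by (subst emeasure_eq_1_AE) auto
  also have "\<dots> = (SUP k. emeasure M (C k))"
    using Cm inc by (intro SUP_emeasure_incseq[symmetric]) auto
  also have "\<dots> \<le> emeasure M S + (\<Sum>i. emeasure M (A i))"
    by (intro SUP_least bound)
  finally show ?thesis .
qed

context free_pmp_action
begin

text \<open>K is left arbitrary for the sake of two choices: the whole group in the lower bound, and
  the powers of one element of infinite order in the upper bound, where the moves into S must be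
  words in that element.\<close>

lemma exists_small_marker:
  assumes K: "infinite K" "K \<subseteq> carrier G" and e: "0 < (e::real)"
  obtains S where "S \<in> sets M" "emeasure M S \<le> ennreal e"
    "\<And>x. x \<in> space M \<Longrightarrow> \<exists>a\<in>K. \<exists>b\<in>K. \<phi> (inv b \<otimes> a) x \<in> S"
proof -
  obtain n :: nat where n: "0 < n" "inverse (real n) < e"
    using reals_Archimedean[OF e] by (metis zero_less_Suc)
  obtain F where F: "F \<subseteq> K" "finite F" "card F = n"
    using infinite_arbitrarily_large[OF K(1)] by metis
  have "F \<noteq> {}" "F \<subseteq> carrier G" using F n(1) K(2) by auto
  then obtain S where S: "S \<in> sets M" "of_nat n * emeasure M S \<le> 1"
    "\<And>x. x \<in> space M \<Longrightarrow> \<exists>a\<in>F. \<exists>b\<in>F. \<phi> (inv b \<otimes> a) x \<in> S"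
    using exists_marker[OF F(2)] F(3) by metis
  have "ennreal (real n * measure M S) \<le> ennreal 1"
    using S(2) by (simp add: emeasure_eq_measure ennreal_mult ennreal_of_nat_eq_real_of_nat)
  then have "real n * measure M S \<le> 1" by (subst (asm) ennreal_le_iff) auto
  then have "measure M S \<le> inverse (real n)" using n(1) by (simp add: field_simps)
  then have "emeasure M S \<le> ennreal e"
    using n(2) by (simp add: emeasure_eq_measure ennreal_leI)
  moreover have "\<exists>a\<in>K. \<exists>b\<in>K. \<phi> (inv b \<otimes> a) x \<in> S" if "x \<in> space M" for x
    using S(3)[OF that] F(1) by blast
  ultimately show thesis using that S(1) by blast
qed

lemma relation_cost_ge_1:
  assumes inf: "infinite (carrier G)"
  shows "1 \<le> relation_cost M (orbit_relation G M \<phi>)"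
  unfolding relation_cost_def
proof (rule Inf_greatest)
  fix c assume "c \<in> {(\<Sum>i. emeasure M (A i)) |A B f. graphing M (orbit_relation G M \<phi>) A B f}"
  then obtain A B f where c: "c = (\<Sum>i. emeasure M (A i))"
    and gr: "graphing M (orbit_relation G M \<phi>) A B f" by blast
  have eps: "1 \<le> c + ennreal e" if e: "0 < e" for e :: real
  proof -
    obtain S where S: "S \<in> sets M" "emeasure M S \<le> ennreal e"
      "\<And>x. x \<in> space M \<Longrightarrow> \<exists>a\<in>carrier G. \<exists>b\<in>carrier G. \<phi> (inv b \<otimes> a) x \<in> S"
      using exists_small_marker[OF inf subset_refl e] by blast
    have "\<exists>y\<in>S. (x, y) \<in> orbit_relation G M \<phi>" if x: "x \<in> space M" for x
    proof -
      obtain a b where "a \<in> carrier G" "b \<in> carrier G" "\<phi> (inv b \<otimes> a) x \<in> S"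
        using S(3)[OF x] by blast
      moreover have "inv b \<otimes> a \<in> carrier G" using calculation by simp
      ultimately show ?thesis using x unfolding orbit_relation_def orbit_def by blast
    qed
    then have "1 \<le> emeasure M S + c"
      unfolding c by (intro graphing_cost_ge[OF prob gr S(1)] AE_I2) auto
    also have "\<dots> \<le> ennreal e + c" using S(2) by (rule add_right_mono)
    finally show ?thesis by (simp add: add.commute)
  qed
  show "1 \<le> c"
    by (rule ennreal_le_epsilon) (rule eps)
qed

section \<open>Upper bound: adding group elements over small sections\<close>

lemma subgroup_acting_within:
  assumes E: "equiv (space M) E"
  shows "subgroup {h \<in> carrier G. \<forall>x\<in>space M. (x, \<phi> h x) \<in> E} G"
proof
  show "{h \<in> carrier G. \<forall>x\<in>space M. (x, \<phi> h x) \<in> E} \<subseteq> carrier G" by blast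
  show "\<one> \<in> {h \<in> carrier G. \<forall>x\<in>space M. (x, \<phi> h x) \<in> E}"
    using E by (auto simp: act_one equiv_def refl_on_def)
next
  fix g h assume gh: "g \<in> {h \<in> carrier G. \<forall>x\<in>space M. (x, \<phi> h x) \<in> E}"
    "h \<in> {h \<in> carrier G. \<forall>x\<in>space M. (x, \<phi> h x) \<in> E}"
  have "(x, \<phi> (g \<otimes> h) x) \<in> E" if x: "x \<in> space M" for x
  proof -
    have "(x, \<phi> h x) \<in> E" "(\<phi> h x, \<phi> g (\<phi> h x)) \<in> E" using gh x act_space by auto
    then show ?thesis using equivE[OF E] gh x by (metis (no_types, lifting) act_mult mem_Collect_eq transD)
  qed
  then show "g \<otimes> h \<in> {h \<in> carrier G. \<forall>x\<in>space M. (x, \<phi> h x) \<in> E}" using gh by simp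
next
  fix g assume g: "g \<in> {h \<in> carrier G. \<forall>x\<in>space M. (x, \<phi> h x) \<in> E}"
  have "(x, \<phi> (inv g) x) \<in> E" if x: "x \<in> space M" for x
  proof -
    have "(\<phi> (inv g) x, \<phi> g (\<phi> (inv g) x)) \<in> E" using g x act_space by auto
    then have "(\<phi> (inv g) x, x) \<in> E" using act_act_inv g x by simp
    then show ?thesis using equivE[OF E] by (metis symD)
  qed
  then show "inv g \<in> {h \<in> carrier G. \<forall>x\<in>space M. (x, \<phi> h x) \<in> E}" using g by simp
qed

text \<open>If the powers of \<open>c\<close> and of its conjugate \<open>d = g c g\<^sup>-\<^sup>1\<close> already move points within \<open>E\<close>-classes,
  knowing \<open>g\<close> on a complete section \<open>S\<close> of the powers of \<open>c\<close> determines it everywhere.\<close>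

lemma act_in_relation_of_section:
  assumes E: "equiv (space M) E"
    and c: "c \<in> carrier G" "\<forall>x\<in>space M. (x, \<phi> c x) \<in> E"
    and d: "d \<in> carrier G" "\<forall>x\<in>space M. (x, \<phi> d x) \<in> E"
    and g: "g \<in> carrier G" "g \<otimes> c = d \<otimes> g"
    and S: "\<forall>x\<in>space M. \<exists>a\<in>range (\<lambda>k::nat. c [^] k). \<exists>b\<in>range (\<lambda>k::nat. c [^] k). \<phi> (inv b \<otimes> a) x \<in> S"
    and gS: "\<forall>x\<in>S. (x, \<phi> g x) \<in> E"
    and x: "x \<in> space M"
  shows "(x, \<phi> g x) \<in> E"
proof -
  define H where "H = {h \<in> carrier G. \<forall>x\<in>space M. (x, \<phi> h x) \<in> E}"
  interpret H: subgroup H G unfolding H_def by (rule subgroup_acting_within[OF E])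
  have HE: "(y, \<phi> h y) \<in> E" if "h \<in> H" "y \<in> space M" for h y
    using that unfolding H_def by blast
  have pow: "c [^] k \<in> H" "d [^] k \<in> H" for k :: nat
  proof -
    have "h [^] k \<in> H" if "h \<in> H" for h
      using that by (induction k) (simp_all add: H.one_closed H.m_closed)
    moreover have "c \<in> H" "d \<in> H" unfolding H_def using c d by blast+
    ultimately show "c [^] k \<in> H" "d [^] k \<in> H" by blast+
  qed
  have conj: "g \<otimes> c [^] k = d [^] k \<otimes> g" for k :: nat
  proof (induction k)
    case (Suc k)
    have "g \<otimes> c [^] Suc k = (g \<otimes> c [^] k) \<otimes> c" using g c by (simp add: m_assoc)
    also have "\<dots> = d [^] k \<otimes> (g \<otimes> c)" using Suc g c d by (simp add: m_assoc)
    finally show ?case using g c d by (simp add: m_assoc)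
  qed (use g in simp)
  obtain i j :: nat where ij: "\<phi> (inv (c [^] j) \<otimes> c [^] i) x \<in> S" using S x by blast
  \<comment> \<open>The chain is x ~ s ~ g s ~ g x. The first link is a word in c, the last one its
    conjugate by g, a word in d; the middle link is the assumption on S.\<close>
  define s where "s = \<phi> (inv (c [^] j) \<otimes> c [^] i) x"
  have xs: "(x, s) \<in> E"
    unfolding s_def by (rule HE[OF H.m_closed[OF H.m_inv_closed[OF pow(1)] pow(1)] x])
  have sgs: "(s, \<phi> g s) \<in> E" using gS ij by (simp add: s_def)
  have "g \<otimes> inv (c [^] j) = inv (d [^] j) \<otimes> g"
  proof -
    have "d [^] j \<otimes> (g \<otimes> inv (c [^] j)) = (g \<otimes> c [^] j) \<otimes> inv (c [^] j)"
      using conj[of j] g c d by (simp add: m_assoc)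
    also have "\<dots> = g" using g c by (simp add: m_assoc)
    finally show ?thesis
      using inv_solve_left[of "g \<otimes> inv (c [^] j)" "d [^] j" g] g c d by simp
  qed
  then have "g \<otimes> (inv (c [^] j) \<otimes> c [^] i) = (inv (d [^] j) \<otimes> d [^] i) \<otimes> g"
    using conj[of i] g(1) c(1) d(1) by (metis inv_closed m_assoc nat_pow_closed)
  then have gs: "\<phi> g s = \<phi> (inv (d [^] j) \<otimes> d [^] i) (\<phi> g x)"
    unfolding s_def using x g(1) c(1) d(1) by (metis act_mult inv_closed m_closed nat_pow_closed)
  have "(\<phi> g x, \<phi> g s) \<in> E"
    unfolding gs
    by (rule HE[OF H.m_closed[OF H.m_inv_closed[OF pow(2)] pow(2)] act_space[OF g(1) x]])
  moreover have "sym E" "trans E" using E by (auto elim: equivE)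
  ultimately show ?thesis using xs sgs by (meson symD transD)
qed

text \<open>The graphing consists of c 0 on the whole space and of further elements, the i-th
  restricted to a section of measure at most e / 2^(i+1), so it costs at most 1 + e. By
  \<open>comm\<close> the other c n are added over sections for the powers of c 0; by
  \<open>conj\<close> any g is then added over a section for the powers of some c m.\<close>

lemma relation_cost_le_1:
  fixes c :: "nat \<Rightarrow> 'b"
  assumes cnt: "countable (carrier G)"
    and c: "\<And>n. c n \<in> carrier G"
    and inf: "\<And>n. infinite (range (\<lambda>k::nat. c n [^] k))"
    and comm: "\<And>n. c n \<otimes> c 0 = c 0 \<otimes> c n"
    and conj: "\<And>g. g \<in> carrier G \<Longrightarrow> \<exists>m n. g \<otimes> c m = c n \<otimes> g"
  shows "relation_cost M (orbit_relation G M \<phi>) \<le> 1"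
proof (rule ennreal_le_epsilon)
  fix e :: real assume e: "0 < e"
  have ne: "carrier G \<noteq> {}" using one_closed by blast
  define h where "h = from_nat_into (carrier G)"
  have h: "h n \<in> carrier G" for n using ne by (simp add: h_def from_nat_into)
  obtain m n where mn: "\<And>i. h i \<otimes> c (m i) = c (n i) \<otimes> h i" using conj[OF h] by metis
  \<comment> \<open>Even slots hold the elements c k, odd slots the enumeration h of the group;
    \<open>l i\<close> is the index of the bump whose powers lead into the section of slot
    i.\<close>
  define g where "g i = (if even i then c (i div 2) else h (i div 2))" for i
  define l where "l i = (if even i then 0 else m (i div 2))" for i
  have gG: "g i \<in> carrier G" for i using c h by (simp add: g_def)
  have "\<exists>S. S \<in> sets M \<and> emeasure M S \<le> ennreal (e * (1 / 2) ^ Suc i) \<and>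
      (\<forall>x\<in>space M. \<exists>a\<in>range (\<lambda>k::nat. c (l i) [^] k). \<exists>b\<in>range (\<lambda>k::nat. c (l i) [^] k). \<phi> (inv b \<otimes> a) x \<in> S)" for i
  proof -
    have "range (\<lambda>k::nat. c (l i) [^] k) \<subseteq> carrier G" using c by auto
    then show ?thesis
      using exists_small_marker[OF inf, of "l i" "e * (1 / 2) ^ Suc i"] e
      by (metis (no_types, lifting) half_gt_zero_iff mult_pos_pos zero_less_one zero_less_power)
  qed
  then obtain S where S: "\<And>i. S i \<in> sets M" "\<And>i. emeasure M (S i) \<le> ennreal (e * (1 / 2) ^ Suc i)"
    "\<And>i. \<forall>x\<in>space M. \<exists>a\<in>range (\<lambda>k::nat. c (l i) [^] k). \<exists>b\<in>range (\<lambda>k::nat. c (l i) [^] k). \<phi> (inv b \<otimes> a) x \<in> S i"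
    by metis
  define \<gamma> where "\<gamma> i = (case i of 0 \<Rightarrow> c 0 | Suc i \<Rightarrow> g i)" for i
  define A where "A i = (case i of 0 \<Rightarrow> space M | Suc i \<Rightarrow> S i)" for i
  have \<gamma>: "\<gamma> i \<in> carrier G" and A: "A i \<in> sets M" for i
    using c gG S(1) by (auto simp: \<gamma>_def A_def split: nat.split)
  have AM: "A i \<subseteq> space M" for i using A sets.sets_into_space by blast
  have eqR: "equiv (space M) (orbit_relation G M \<phi>)"
  proof (rule equivI)
    show "orbit_relation G M \<phi> \<subseteq> space M \<times> space M"
      using act_space by (auto simp: orbit_relation_def orbit_def)
    show "refl_on (space M) (orbit_relation G M \<phi>)"
      using orbit_refl by (auto simp: refl_on_def orbit_relation_def)
    show "sym (orbit_relation G M \<phi>)"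
    proof (rule symI)
      fix x y assume "(x, y) \<in> orbit_relation G M \<phi>"
      then have "x \<in> space M" "y \<in> space M" "y \<in> orbit G \<phi> x"
        using act_space by (auto simp: orbit_relation_def orbit_def)
      then show "(y, x) \<in> orbit_relation G M \<phi>"
        using orbit_sym by (simp add: orbit_relation_def)
    qed
    show "trans (orbit_relation G M \<phi>)"
      using act_mult by (auto simp: trans_def orbit_relation_def orbit_def) (metis m_closed)
  qed
  have "generated_relation M A (\<lambda>i. \<phi> (\<gamma> i)) \<subseteq> orbit_relation G M \<phi>"
    unfolding generated_relation_def
    using eqR \<gamma> AM by (intro Inter_lower) (auto simp: orbit_relation_def orbit_def)
  moreover have "orbit_relation G M \<phi> \<subseteq> E"
    if E: "equiv (space M) E" and pairs: "\<forall>i. \<forall>x\<in>A i. (x, \<phi> (\<gamma> i) x) \<in> E" for E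
  proof -
    have c0: "\<forall>x\<in>space M. (x, \<phi> (c 0) x) \<in> E"
      using pairs[rule_format, of _ 0] by (simp add: A_def \<gamma>_def)
    have gE: "\<forall>x\<in>S i. (x, \<phi> (g i) x) \<in> E" for i
      using pairs[rule_format, of _ "Suc i"] by (simp add: A_def \<gamma>_def)
    have cE: "\<forall>x\<in>space M. (x, \<phi> (c k) x) \<in> E" for k
    proof
      fix x assume x: "x \<in> space M"
      show "(x, \<phi> (c k) x) \<in> E"
        using act_in_relation_of_section[OF E c c0 c c0 c comm _ _ x, of "S (2 * k)"] S(3)[of "2 * k"] gE[of "2 * k"]
        by (simp add: l_def g_def)
    qed
    \<comment> \<open>By now every c k is known on the whole space, in particular c (m k) and its
      conjugate c (n k) under h k.\<close>
    have hE: "(x, \<phi> (h k) x) \<in> E" if x: "x \<in> space M" for x k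
      using act_in_relation_of_section[OF E c cE c cE h mn _ _ x, of k "S (Suc (2 * k))"]
        S(3)[of "Suc (2 * k)"] gE[of "Suc (2 * k)"]
      by (simp add: l_def g_def)
    show ?thesis
    proof
      fix p assume "p \<in> orbit_relation G M \<phi>"
      then obtain x u where p: "p = (x, \<phi> u x)" "x \<in> space M" "u \<in> carrier G"
        by (auto simp: orbit_relation_def orbit_def)
      obtain k where "h k = u" using from_nat_into_surj[OF cnt p(3)] by (auto simp: h_def)
      then show "p \<in> E" using hE p by auto
    qed
  qed
  ultimately have gen: "generated_relation M A (\<lambda>i. \<phi> (\<gamma> i)) = orbit_relation G M \<phi>"
    unfolding generated_relation_def by blast
  have gr: "graphing M (orbit_relation G M \<phi>) A (\<lambda>i. \<phi> (\<gamma> i) ` A i) (\<lambda>i. \<phi> (\<gamma> i))"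
    unfolding graphing_def using partial_isomorphism_act[OF \<gamma> A] gen by simp
  have "relation_cost M (orbit_relation G M \<phi>) \<le> (\<Sum>i. emeasure M (A i))"
    unfolding relation_cost_def using gr by (intro Inf_lower) blast
  also have "\<dots> = (\<Sum>i. emeasure M (A (i + 1))) + (\<Sum>i<1. emeasure M (A i))"
    by (intro suminf_offset) simp
  also have "\<dots> = (\<Sum>i. emeasure M (S i)) + 1"
    by (simp add: A_def emeasure_space_1)
  also have "(\<Sum>i. emeasure M (S i)) \<le> (\<Sum>i. ennreal (e * (1 / 2) ^ Suc i))"
    by (intro suminf_le S(2)) auto
  also have "\<dots> = ennreal e"
    using sums_mult[OF power_half_series, of e] e by (intro suminf_ennreal_eq) auto
  finally show "relation_cost M (orbit_relation G M \<phi>) \<le> 1 + ennreal e"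
    by (simp add: add.commute add_right_mono)
qed

end

section \<open>Elements of the Thompson groups as \<open>N\<close>-adic piecewise affine maps\<close>

lemma nadic_zero: "0 \<in> nadic_rationals N"
  unfolding nadic_rationals_def by (auto intro!: exI[of _ 0])

lemma nadic_one: "1 \<in> nadic_rationals N"
proof -
  have "(1::real) = real_of_int 1 / real N powi 0" by simp
  then show ?thesis unfolding nadic_rationals_def by blast
qed

lemma nadic_powi_mult:
  assumes "N > 0" "x \<in> nadic_rationals N"
  shows "real N powi k * x \<in> nadic_rationals N"
proof -
  obtain a m where x: "x = real_of_int a / real N powi m" using assms by (auto simp: nadic_rationals_def)
  have "real N powi k * x = real_of_int a / real N powi (m - k)"
    using assms by (simp add: x power_int_diff)
  then show ?thesis unfolding nadic_rationals_def by blast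
qed

lemma nadic_powi: "N > 0 \<Longrightarrow> real N powi k \<in> nadic_rationals N"
  using nadic_powi_mult[OF _ nadic_one, of N k] by simp

lemma nadic_uminus: "x \<in> nadic_rationals N \<Longrightarrow> - x \<in> nadic_rationals N"
  unfolding nadic_rationals_def by clarsimp (metis minus_divide_left of_int_minus)

lemma nadic_add:
  assumes N: "N > 0" and "x \<in> nadic_rationals N" "y \<in> nadic_rationals N"
  shows "x + y \<in> nadic_rationals N"
proof -
  obtain a m where x: "x = real_of_int a / real N powi m" using assms by (auto simp: nadic_rationals_def)
  obtain b n where y: "y = real_of_int b / real N powi n" using assms by (auto simp: nadic_rationals_def)
  define M where "M = max m n"
  have *: "real_of_int c / real N powi l = real_of_int (c * int N ^ nat (M - l)) / real N powi M"
    if "l \<le> M" for c l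
  proof -
    have "real N powi M = real N powi ((M - l) + l)" by simp
    also have "\<dots> = real N powi (M - l) * real N powi l"
      using N by (subst power_int_add) auto
    also have "real N powi (M - l) = real N ^ nat (M - l)"
      using that by (simp add: power_int_def)
    finally have M: "real N powi M = real N ^ nat (M - l) * real N powi l" .
    show ?thesis unfolding M using N by simp
  qed
  have "x + y = real_of_int (a * int N ^ nat (M - m) + b * int N ^ nat (M - n)) / real N powi M"
    unfolding x y using *[of m a] *[of n b] by (simp add: M_def add_divide_distrib)
  then show ?thesis unfolding nadic_rationals_def by blast
qed

lemma nadic_diff:
  "N > 0 \<Longrightarrow> x \<in> nadic_rationals N \<Longrightarrow> y \<in> nadic_rationals N \<Longrightarrow> x - y \<in> nadic_rationals N"
  using nadic_add[of N x "- y"] nadic_uminus by simp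

lemma countable_nadic: "countable (nadic_rationals N)"
proof -
  have "nadic_rationals N = (\<lambda>(k, m). real_of_int k / real N powi m) ` (UNIV :: (int \<times> int) set)"
    by (auto simp: nadic_rationals_def)
  then show ?thesis by simp
qed

text \<open>Recording an N-adic intercept along with the slope makes these pieces preserve and
  reflect N-adic rationals, which composition and inversion rely on.\<close>

definition nadic_affine_on :: "nat \<Rightarrow> (real \<Rightarrow> real) \<Rightarrow> real \<Rightarrow> real \<Rightarrow> bool" where
  "nadic_affine_on N f c d \<longleftrightarrow>
     (\<exists>k::int. \<exists>t\<in>nadic_rationals N. \<forall>x\<in>{c..d}. f x = real N powi k * x + t)"

text \<open>P may be larger than the set of actual breaks. This lets break sets of composites and
  inverses be assembled from unions, preimages and images, without deciding which points are true
  breaks.\<close>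

definition nadic_breaks :: "nat \<Rightarrow> (real \<Rightarrow> real) \<Rightarrow> real set \<Rightarrow> bool" where
  "nadic_breaks N f P \<longleftrightarrow> finite P \<and> P \<subseteq> nadic_rationals N \<and>
     (\<forall>c d. 0 \<le> c \<and> c < d \<and> d \<le> 1 \<and> {c<..<d} \<inter> P = {} \<longrightarrow> nadic_affine_on N f c d)"

lemma finite_gap_right:
  fixes x b :: real
  assumes "finite P" "x < b"
  obtains d where "x < d" "d \<le> b" "{x<..<d} \<inter> P = {}"
proof -
  define Q where "Q = insert b {p \<in> P. x < p}"
  have Q: "finite Q" "Q \<noteq> {}" using assms by (auto simp: Q_def)
  show thesis
  proof (rule that[of "Min Q"])
    show "x < Min Q" using Q assms by (auto simp: Q_def)
    show "Min Q \<le> b" using Q by (auto simp: Q_def)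
    show "{x<..<Min Q} \<inter> P = {}"
    proof (rule ccontr)
      assume "{x<..<Min Q} \<inter> P \<noteq> {}"
      then obtain p where "p \<in> P" "x < p" "p < Min Q" by auto
      then show False using Min_le[OF Q(1), of p] by (simp add: Q_def)
    qed
  qed
qed

lemma finite_gap_left:
  fixes x a :: real
  assumes "finite P" "a < x"
  obtains c where "a \<le> c" "c < x" "{c<..<x} \<inter> P = {}"
proof -
  obtain d where d: "- x < d" "d \<le> - a" "{- x<..<d} \<inter> uminus ` P = {}"
    using finite_gap_right[of "uminus ` P" "- x" "- a"] assms by auto
  have "p \<notin> P" if "p \<in> {- d<..<x}" for p
  proof
    assume "p \<in> P"
    then have "- p \<in> {- x<..<d} \<inter> uminus ` P" using that by auto
    then show False using d(3) by blast
  qed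
  then have "{- d<..<x} \<inter> P = {}" by blast
  then show thesis using that[of "- d"] d by auto
qed

lemma affine_on_has_derivative:
  assumes "\<forall>x\<in>{c..d}. f x = s * x + t" "x \<in> {c..d}"
  shows "(f has_real_derivative s) (at x within {c..d})"
proof -
  have "((\<lambda>x. s * x + t) has_real_derivative s) (at x within {c..d})"
    by (auto intro!: derivative_eq_intros)
  then show ?thesis
    by (rule has_field_derivative_transform_within[where d=1]) (use assms in auto)
qed

lemma nadic_breaks_derivative_right:
  assumes "nadic_breaks N f P" "0 \<le> x" "x < 1"
  obtains k where "(f has_real_derivative (real N powi k)) (at_right x)"
proof -
  obtain d where d: "x < d" "d \<le> 1" "{x<..<d} \<inter> P = {}"
    using assms finite_gap_right[of P x 1] by (auto simp: nadic_breaks_def)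
  then have "nadic_affine_on N f x d" using assms by (auto simp: nadic_breaks_def)
  then obtain k t where kt: "\<forall>y\<in>{x..d}. f y = real N powi k * y + t" by (auto simp: nadic_affine_on_def)
  have "(f has_real_derivative (real N powi k)) (at x within {x..d})"
    using affine_on_has_derivative[OF kt, of x] d by auto
  then show thesis using that d(1) by (simp add: at_within_Icc_at_right)
qed

lemma nadic_breaks_derivative_left:
  assumes "nadic_breaks N f P" "0 < x" "x \<le> 1"
  obtains k where "(f has_real_derivative (real N powi k)) (at_left x)"
proof -
  obtain c where c: "0 \<le> c" "c < x" "{c<..<x} \<inter> P = {}"
    using assms finite_gap_left[of P 0 x] by (auto simp: nadic_breaks_def)
  then have "nadic_affine_on N f c x" using assms by (auto simp: nadic_breaks_def)
  then obtain k t where kt: "\<forall>y\<in>{c..x}. f y = real N powi k * y + t" by (auto simp: nadic_affine_on_def)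
  have "(f has_real_derivative (real N powi k)) (at x within {c..x})"
    using affine_on_has_derivative[OF kt, of x] c by auto
  then show thesis using that c(2) by (simp add: at_within_Icc_at_left)
qed

lemma nadic_breaks_derivative:
  assumes "nadic_breaks N f P" "0 < x" "x < 1" "x \<notin> P"
  obtains k where "(f has_real_derivative (real N powi k)) (at x)"
proof -
  obtain c where c: "0 \<le> c" "c < x" "{c<..<x} \<inter> P = {}"
    using assms finite_gap_left[of P 0 x] by (auto simp: nadic_breaks_def)
  obtain d where d: "x < d" "d \<le> 1" "{x<..<d} \<inter> P = {}"
    using assms finite_gap_right[of P x 1] by (auto simp: nadic_breaks_def)
  have "{c<..<d} \<inter> P = {}"
  proof (rule ccontr)
    assume "{c<..<d} \<inter> P \<noteq> {}"
    then obtain p where "p \<in> P" "c < p" "p < d" by auto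
    then show False using c(3) d(3) assms(4) by (cases p x rule: linorder_cases) auto
  qed
  then have "nadic_affine_on N f c d" using assms c d by (auto simp: nadic_breaks_def)
  then obtain k t where kt: "\<forall>y\<in>{c..d}. f y = real N powi k * y + t" by (auto simp: nadic_affine_on_def)
  have "(f has_real_derivative (real N powi k)) (at x within {c..d})"
    using affine_on_has_derivative[OF kt, of x] c d by auto
  then show thesis using that c(2) d(1) by (simp add: at_within_Icc_at)
qed

lemma nadic_breaks_continuous_on:
  assumes "nadic_breaks N f P"
  shows "continuous_on {0..1} f"
proof (unfold continuous_on_eq_continuous_within, intro ballI)
  fix x :: real assume x: "x \<in> {0..1}"
  have R: "continuous (at_right x) f" if "x < 1"
    using nadic_breaks_derivative_right[OF assms, of x] x that DERIV_continuous by (metis atLeastAtMost_iff)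
  have L: "continuous (at_left x) f" if "0 < x"
    using nadic_breaks_derivative_left[OF assms, of x] x that DERIV_continuous by (metis atLeastAtMost_iff)
  consider "x = 0" | "x = 1" | "0 < x" "x < 1" using x by force
  then show "continuous (at x within {0..1}) f"
  proof cases
    case 1
    then show ?thesis using R by (simp add: at_within_Icc_at_right)
  next
    case 2
    then show ?thesis using L by (simp add: at_within_Icc_at_left)
  next
    case 3
    then show ?thesis using L R by (simp add: at_within_Icc_at continuous_at_split)
  qed
qed

section \<open>Translation between group membership and break sets\<close>

lemma thompson_carrierI:
  assumes N: "N \<ge> 2" and ext: "f \<in> extensional {0..1}" and bij: "bij_betw f {0..1} {0..1}"
    and br: "nadic_breaks N f P"
  shows "f \<in> thompson_carrier N"
proof -
  have fin: "finite P" and sub: "P \<subseteq> nadic_rationals N" using br by (auto simp: nadic_breaks_def)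
  have "\<exists>g. homeomorphism {0..1} {0..1} f g"
    using homeomorphism_compact[OF compact_Icc nadic_breaks_continuous_on[OF br], of "{0..1}"] bij
    by (auto simp: bij_betw_def)
  moreover have "piecewise_linear_on 0 1 f"
    unfolding piecewise_linear_on_def
  proof (intro exI[of _ P] conjI allI impI fin)
    fix c d :: real assume "0 \<le> c \<and> c < d \<and> d \<le> 1 \<and> {c<..<d} \<inter> P = {}"
    then have "nadic_affine_on N f c d" using br by (auto simp: nadic_breaks_def)
    then obtain k t where "\<forall>x\<in>{c..d}. f x = real N powi k * x + t" by (auto simp: nadic_affine_on_def)
    then have "\<forall>x\<in>{c<..<d}. f x = real N powi k * x + t" by auto
    then show "\<exists>s t. \<forall>x\<in>{c<..<d}. f x = s * x + t" by blast
  qed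
  moreover have nd: "nondiff_points f \<subseteq> P"
  proof
    fix x assume x: "x \<in> nondiff_points f"
    show "x \<in> P"
    proof (rule ccontr)
      assume "x \<notin> P"
      have "x \<in> {0..1}" using x by (simp add: nondiff_points_def)
      then consider "x = 0" | "x = 1" | "0 < x" "x < 1" by force
      then have "f differentiable (at x within {0..1})"
      proof cases
        case 1
        then show ?thesis
          using nadic_breaks_derivative_right[OF br, of x]
          by (auto simp: at_within_Icc_at_right real_differentiable_def)
      next
        case 2
        then show ?thesis
          using nadic_breaks_derivative_left[OF br, of x]
          by (auto simp: at_within_Icc_at_left real_differentiable_def)
      next
        case 3
        then show ?thesis
          using nadic_breaks_derivative[OF br _ _ \<open>x \<notin> P\<close>]
          by (auto simp: at_within_Icc_at real_differentiable_def)
      qed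
      then show False using x by (simp add: nondiff_points_def)
    qed
  qed
  moreover have "\<exists>k::int. (f has_real_derivative (real N powi k)) (at x within {0..1})"
    if x: "x \<in> {0..1} - nondiff_points f" for x
  proof -
    obtain D where D: "(f has_real_derivative D) (at x within {0..1})"
      using x by (auto simp: nondiff_points_def real_differentiable_def)
    show ?thesis
    \<comment> \<open>x may belong to P although f is differentiable there, so the slope is read off
      a one-sided derivative, which uniqueness identifies with the derivative; the right side serves
      everywhere except at 1.\<close>
    proof (cases "x = 1")
      case True
      then show ?thesis
        using nadic_breaks_derivative_left[OF br, of x] by (auto simp: at_within_Icc_at_left)
    next
      case False
      then have x01: "0 \<le> x" "x < 1" using x by auto
      then obtain k where k: "(f has_real_derivative (real N powi k)) (at_right x)"
        using nadic_breaks_derivative_right[OF br] by blast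
      have "(f has_real_derivative D) (at x within {x..1})"
        using D x01 by (rule_tac DERIV_subset) auto
      then have "(f has_real_derivative D) (at_right x)" using x01 by (simp add: at_within_Icc_at_right)
      then have "D = real N powi k" using k
        by (rule has_field_derivative_unique) (simp add: trivial_limit_at_right_real)
      then show ?thesis using D by blast
    qed
  qed
  ultimately show ?thesis
    unfolding thompson_carrier_def using ext fin sub finite_subset[OF nd fin] by blast
qed

text \<open>Piecewise linearity provides some break set P that is unrelated to
  \<open>nondiff_points\<close>. At a point of P where f is differentiable, the slopes on both sides
  equal the derivative. So the derivative is locally constant on {c<..<d}, hence constant by
  connectedness.\<close>

lemma thompson_carrier_affine:
  assumes f: "f \<in> thompson_carrier N"
    and cd: "0 \<le> c" "c < d" "d \<le> 1" "{c<..<d} \<inter> nondiff_points f = {}"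
  obtains k t where "\<forall>x\<in>{c..d}. f x = real N powi k * x + t"
proof -
  have cont: "continuous_on {0..1} f" using f by (auto simp: thompson_carrier_def homeomorphism_def)
  obtain P where P: "finite P" "\<And>c d. 0 \<le> c \<Longrightarrow> c < d \<Longrightarrow> d \<le> 1 \<Longrightarrow> {c<..<d} \<inter> P = {} \<Longrightarrow>
      \<exists>s t. \<forall>x\<in>{c<..<d}. f x = s * x + t"
  proof -
    have "piecewise_linear_on 0 1 f" using f by (simp add: thompson_carrier_def)
    then show ?thesis using that unfolding piecewise_linear_on_def by metis
  qed
  \<comment> \<open>Continuity extends the linear formula to the end points, which is where
    neighbouring pieces get compared.\<close>
  have lin: "\<exists>s t. \<forall>x\<in>{u..v}. f x = s * x + t" if uv: "0 \<le> u" "u < v" "v \<le> 1" "{u<..<v} \<inter> P = {}" for u v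
  proof -
    obtain s t where st: "\<forall>x\<in>{u<..<v}. f x = s * x + t" using P(2)[OF uv] by blast
    have cl: "closure {u<..<v} = {u..v}" using uv by simp
    have "continuous_on {u..v} (\<lambda>x. f x - (s * x + t))"
      using uv by (intro continuous_intros continuous_on_subset[OF cont]) auto
    then have "f x - (s * x + t) = 0" if "x \<in> {u..v}" for x
      using continuous_constant_on_closure[of "{u<..<v}" "\<lambda>x. f x - (s * x + t)" 0 x] st that
      unfolding cl by auto
    then have "\<forall>x\<in>{u..v}. f x = s * x + t" by simp
    then show ?thesis by blast
  qed
  have "\<exists>k::int. (f has_real_derivative (real N powi k)) (at x)" if x: "x \<in> {c<..<d}" for x
  proof -
    have "x \<in> {0..1} - nondiff_points f" using x cd by auto
    then obtain k :: int where "(f has_real_derivative (real N powi k)) (at x within {0..1})"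
      using f unfolding thompson_carrier_def by blast
    then show ?thesis using x cd by (auto simp: at_within_Icc_at)
  qed
  then obtain K :: "real \<Rightarrow> int" where K: "\<And>x. x \<in> {c<..<d} \<Longrightarrow> (f has_real_derivative (real N powi K x)) (at x)"
    by metis
  have side: "real N powi K x = s" if "\<forall>y\<in>{u..v}. f y = s * y + t" "u < v" "x \<in> {u..v}" "x \<in> {c<..<d}" for u v s t x
  proof -
    have "(f has_real_derivative s) (at x within {u..v})"
      using that by (intro affine_on_has_derivative) auto
    moreover have "(f has_real_derivative (real N powi K x)) (at x within {u..v})"
      using K[OF that(4)] by (rule DERIV_subset) auto
    moreover have "at x within {u..v} \<noteq> bot"
      using that(2,3) by (simp add: trivial_limit_within islimpt_Icc)
    ultimately show ?thesis using has_field_derivative_unique by blast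
  qed
  have loc: "\<forall>x\<in>{c<..<d}. eventually (\<lambda>y. real N powi K x = real N powi K y) (at x within {c<..<d})"
  proof
    fix x assume x: "x \<in> {c<..<d}"
    obtain u where u: "0 \<le> u" "u < x" "{u<..<x} \<inter> P = {}"
      using finite_gap_left[OF P(1), of 0 x] x cd by auto
    obtain v where v: "x < v" "v \<le> 1" "{x<..<v} \<inter> P = {}"
      using finite_gap_right[OF P(1), of x 1] x cd by auto
    obtain s t where st: "\<forall>y\<in>{u..x}. f y = s * y + t" using lin[of u x] u x cd by auto
    obtain s' t' where st': "\<forall>y\<in>{x..v}. f y = s' * y + t'" using lin[of x v] v x cd by auto
    have eq: "real N powi K x = real N powi K y" if "y \<in> {c<..<d}" "y \<in> {u<..<v}" for y
    proof (cases "y \<le> x")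
      case True
      then show ?thesis using side[OF st, of y] side[OF st, of x] that x u by auto
    next
      case False
      then show ?thesis using side[OF st', of y] side[OF st', of x] that x v by auto
    qed
    have "eventually (\<lambda>y. y \<in> {u<..<v}) (at x within {c<..<d})"
      using u v by (intro filter_leD[OF at_le[OF subset_UNIV] eventually_at_in_open']) auto
    moreover have "eventually (\<lambda>y. y \<in> {c<..<d}) (at x within {c<..<d})"
      by (simp add: eventually_at_filter)
    ultimately show "eventually (\<lambda>y. real N powi K x = real N powi K y) (at x within {c<..<d})"
      by eventually_elim (rule eq)
  qed
  define z where "z = (c + d) / 2"
  have z: "z \<in> {c<..<d}" using cd by (auto simp: z_def)
  have const: "real N powi K x = real N powi K z" if "x \<in> {c<..<d}" for x
    using connected_local_const[OF connected_Ioo that z loc] .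
  have "f x - real N powi K z * x = f c - real N powi K z * c" if x: "x \<in> {c..d}" for x
  proof (rule DERIV_isconst2[OF cd(2)])
    show "continuous_on {c..d} (\<lambda>x. f x - real N powi K z * x)"
      using cd by (intro continuous_intros continuous_on_subset[OF cont]) auto
    show "((\<lambda>x. f x - real N powi K z * x) has_real_derivative 0) (at y)" if "c < y" "y < d" for y
      using K[of y] const[of y] that by (auto intro!: derivative_eq_intros)
  qed (use x in auto)
  then have "\<forall>x\<in>{c..d}. f x = real N powi K z * x + (f c - real N powi K z * c)"
    by (simp add: algebra_simps)
  then show thesis by (rule that)
qed

lemma thompson_carrier_Bij:
  assumes "f \<in> thompson_carrier N"
  shows "f \<in> Bij {0..1}"
proof -
  obtain g where g: "homeomorphism {0..1} {0..1} f g" and ext: "f \<in> extensional {0..1}"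
    using assms by (auto simp: thompson_carrier_def)
  have "inj_on f {0..1}" using g by (auto simp: homeomorphism_def intro: inj_on_inverseI)
  then show ?thesis using g ext by (simp add: Bij_def bij_betw_def homeomorphism_def)
qed

text \<open>A continuous injection is monotone, and the positive slope next to 0 makes it
  increasing, so 0 and 1 are fixed. Values at break points are then N-adic by walking to the right
  from f 0 = 0, since each step adds N^k times an N-adic length; intercepts follow from the
  values.\<close>

lemma thompson_carrier_structure:
  assumes N: "N \<ge> 2" and f: "f \<in> thompson_carrier N"
  obtains P where "strict_mono_on {0..1} f" "nadic_breaks N f P" "f 0 = 0" "f 1 = 1"
    "0 \<in> P" "1 \<in> P" "P \<subseteq> {0..1}"
proof -
  have cont: "continuous_on {0..1} f" and bij: "bij_betw f {0..1} {0..1}"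
    using f thompson_carrier_Bij[OF f] by (auto simp: thompson_carrier_def homeomorphism_def Bij_def)
  define Q where "Q = insert 0 (insert 1 (nondiff_points f))"
  have Q: "finite Q" "Q \<subseteq> nadic_rationals N" "0 \<in> Q" "1 \<in> Q" "Q \<subseteq> {0..1}"
    using f nadic_zero nadic_one by (auto simp: thompson_carrier_def Q_def nondiff_points_def)
  have aff: "\<exists>k t. \<forall>x\<in>{c..d}. f x = real N powi k * x + t"
    if "0 \<le> c" "c < d" "d \<le> 1" "{c<..<d} \<inter> Q = {}" for c d
  proof -
    have "{c<..<d} \<inter> nondiff_points f = {}" using that(4) by (auto simp: Q_def)
    then show ?thesis using thompson_carrier_affine[OF f that(1-3)] by blast
  qed
  have mono: "strict_mono_on {0..1} f"
  proof -
    have "strict_mono_on {0..1} f \<or> strict_antimono_on {0..1} f"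
      using injective_eq_monotone_map[of "{0..1}" f] cont bij by (auto simp: bij_betw_def is_interval_cc)
    moreover have False if anti: "strict_antimono_on {0..1} f"
    proof -
      obtain d where d: "0 < d" "d \<le> 1" "{0<..<d} \<inter> Q = {}"
        using finite_gap_right[OF Q(1), of 0 1] by auto
      then obtain k t where "\<forall>x\<in>{0..d}. f x = real N powi k * x + t" using aff[of 0 d] by auto
      then have "f 0 < f d" using d N by auto
      moreover have "f d < f 0" using anti d by (auto simp: monotone_on_def)
      ultimately show False by simp
    qed
    ultimately show ?thesis by blast
  qed
  have le: "f x \<le> f y" if "0 \<le> x" "x \<le> y" "y \<le> 1" for x y
    using strict_mono_onD[OF mono, of x y] that by (cases "x = y") auto
  have f0: "f 0 = 0" and f1: "f 1 = 1"
  proof -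
    obtain x where x: "x \<in> {0..1}" "f x = 0" using bij by (auto simp: bij_betw_def)
      (metis atLeastAtMost_iff imageE order_refl zero_le_one)
    obtain y where y: "y \<in> {0..1}" "f y = 1" using bij by (auto simp: bij_betw_def)
      (metis atLeastAtMost_iff imageE order_refl zero_le_one)
    have "f 0 \<in> {0..1}" "f 1 \<in> {0..1}" using bij_betwE[OF bij] by auto
    then show "f 0 = 0" "f 1 = 1" using le[of 0 x] le[of y 1] x y by auto
  qed
  have vals: "f q \<in> nadic_rationals N" if "q \<in> Q" for q
  proof (rule ccontr)
    assume bad: "f q \<notin> nadic_rationals N"
    \<comment> \<open>b is the leftmost break point with a bad value; its predecessor a has a good
      value and f is affine between the two.\<close>
    define B where "B = {q \<in> Q. f q \<notin> nadic_rationals N}"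
    have B: "finite B" "B \<noteq> {}" using Q that bad by (auto simp: B_def)
    define b where "b = Min B"
    have b: "b \<in> B" using Min_in[OF B] by (simp add: b_def)
    then have "b \<noteq> 0" using f0 nadic_zero by (auto simp: B_def)
    then have b01: "0 < b" "b \<le> 1" using b Q(5) by (auto simp: B_def)
    define A where "A = {q \<in> Q. q < b}"
    have A: "finite A" "A \<noteq> {}" using Q b01 by (auto simp: A_def)
    define a where "a = Max A"
    have a: "a \<in> Q" "a < b" using Max_in[OF A] by (auto simp: a_def A_def)
    have "f a \<in> nadic_rationals N"
      using Min_le[OF B(1), of a] a by (auto simp: b_def B_def)
    have "{a<..<b} \<inter> Q = {}"
      using Max_ge[OF A(1)] by (force simp: a_def A_def)
    moreover have "0 \<le> a" using a(1) Q(5) by auto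
    ultimately obtain k t where "\<forall>x\<in>{a..b}. f x = real N powi k * x + t"
      using aff[of a b] a(2) b01 by blast
    then have "f b = f a + real N powi k * (b - a)" using a by (simp add: algebra_simps)
    moreover have "a \<in> nadic_rationals N" "b \<in> nadic_rationals N" using a b Q(2) by (auto simp: B_def)
    ultimately have "f b \<in> nadic_rationals N"
      using \<open>f a \<in> nadic_rationals N\<close> N by (auto intro!: nadic_add nadic_powi_mult nadic_diff)
    then show False using b by (simp add: B_def)
  qed
  have "nadic_breaks N f Q"
    unfolding nadic_breaks_def
  proof (intro conjI allI impI Q)
    fix c d :: real assume cd: "0 \<le> c \<and> c < d \<and> d \<le> 1 \<and> {c<..<d} \<inter> Q = {}"
    \<comment> \<open>c itself need not be N-adic. The piece is therefore prolonged to the left up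
      to the last break point a, whose N-adic value determines the intercept.\<close>
    define A where "A = {q \<in> Q. q \<le> c}"
    have A: "finite A" "A \<noteq> {}" using Q cd by (auto simp: A_def)
    define a where "a = Max A"
    have a: "a \<in> Q" "a \<le> c" using Max_in[OF A] by (auto simp: a_def A_def)
    have "{a<..<d} \<inter> Q = {}"
    proof (rule ccontr)
      assume "{a<..<d} \<inter> Q \<noteq> {}"
      then obtain q where q: "q \<in> Q" "a < q" "q < d" by auto
      show False
      proof (cases "q \<le> c")
        case True
        then show ?thesis using Max_ge[OF A(1), of q] q by (simp add: a_def A_def)
      next
        case False
        then have "q \<in> {c<..<d} \<inter> Q" using q by simp
        then show ?thesis using cd by blast
      qed
    qed
    moreover have "0 \<le> a" using a(1) Q(5) by auto
    ultimately obtain k t where kt: "\<forall>x\<in>{a..d}. f x = real N powi k * x + t"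
      using aff[of a d] a(2) cd by force
    then have "t = f a - real N powi k * a" using a cd by auto
    moreover have "a \<in> nadic_rationals N" using a(1) Q(2) by blast
    ultimately have "t \<in> nadic_rationals N"
      using vals[OF a(1)] N by (auto intro!: nadic_diff nadic_powi_mult)
    then show "nadic_affine_on N f c d"
      unfolding nadic_affine_on_def using kt a(2) by force
  qed
  then show thesis using that mono f0 f1 Q by blast
qed

lemma nadic_breaks_affine_at:
  assumes br: "nadic_breaks N f P" and x: "x \<in> {0..1}"
  obtains k t where "t \<in> nadic_rationals N" "f x = real N powi k * x + t"
proof -
  have fin: "finite P" using br by (simp add: nadic_breaks_def)
  have "\<exists>c d. 0 \<le> c \<and> c < d \<and> d \<le> 1 \<and> {c<..<d} \<inter> P = {} \<and> x \<in> {c..d}"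
  proof (cases "x < 1")
    case True
    then obtain d where "x < d" "d \<le> 1" "{x<..<d} \<inter> P = {}" using finite_gap_right[OF fin] by blast
    then show ?thesis using x by (intro exI[of _ x] exI[of _ d]) auto
  next
    case False
    then have "0 < x" using x by simp
    then obtain c where "0 \<le> c" "c < x" "{c<..<x} \<inter> P = {}" using finite_gap_left[OF fin] by blast
    then show ?thesis using x by (intro exI[of _ c] exI[of _ x]) auto
  qed
  then obtain c d where cd: "0 \<le> c \<and> c < d \<and> d \<le> 1 \<and> {c<..<d} \<inter> P = {}" "x \<in> {c..d}" by blast
  then have "nadic_affine_on N f c d" using br by (simp add: nadic_breaks_def)
  then show thesis using that cd(2) unfolding nadic_affine_on_def by blast
qed

text \<open>Around x the map has slope N^k and N-adic intercept, and so has its inverse. This keeps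
  the preimages and images used as break sets of composites and inverses N-adic, as well as the
  finite graphs that encode elements for countability.\<close>

lemma nadic_iff_image:
  assumes N: "N \<ge> 2" and br: "nadic_breaks N f P" and x: "x \<in> {0..1}"
  shows "f x \<in> nadic_rationals N \<longleftrightarrow> x \<in> nadic_rationals N"
proof -
  obtain k t where t: "t \<in> nadic_rationals N" and fx: "f x = real N powi k * x + t"
    using nadic_breaks_affine_at[OF br x] by blast
  have x': "x = real N powi (- k) * (f x - t)"
    using N by (simp add: fx power_int_minus)
  show ?thesis
  proof
    assume "f x \<in> nadic_rationals N"
    then have "real N powi (- k) * (f x - t) \<in> nadic_rationals N"
      using t N by (intro nadic_powi_mult nadic_diff) auto
    then show "x \<in> nadic_rationals N" using x' by simp
  next
    assume "x \<in> nadic_rationals N"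
    then show "f x \<in> nadic_rationals N"
      unfolding fx using t N by (intro nadic_powi_mult nadic_add) auto
  qed
qed

section \<open>Group structure and countability\<close>

lemma thompson_compose_closed:
  assumes N: "N \<ge> 2" and f: "f \<in> thompson_carrier N" and g: "g \<in> thompson_carrier N"
  shows "compose {0..1} f g \<in> thompson_carrier N"
proof -
  obtain P where P: "nadic_breaks N f P" using thompson_carrier_structure[OF N f] by blast
  obtain Q where Q: "strict_mono_on {0..1} g" "nadic_breaks N g Q"
    using thompson_carrier_structure[OF N g] by blast
  have B: "f \<in> Bij {0..1}" "g \<in> Bij {0..1}" using f g thompson_carrier_Bij by auto
  have bg: "bij_betw g {0..1} {0..1}" using B by (simp add: Bij_def)
  define R where "R = Q \<union> {x \<in> {0..1}. g x \<in> P}"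
  have "finite (g -` P \<inter> {0..1})"
    using P bg by (intro finite_vimage_IntI) (auto simp: nadic_breaks_def bij_betw_def)
  moreover have "{x \<in> {0..1}. g x \<in> P} = g -` P \<inter> {0..1}" by auto
  ultimately have fin: "finite R" using Q(2) by (simp add: R_def nadic_breaks_def)
  have sub: "R \<subseteq> nadic_rationals N"
    using P Q(2) nadic_iff_image[OF N Q(2)] by (auto simp: R_def nadic_breaks_def)
  have "nadic_breaks N (compose {0..1} f g) R"
    unfolding nadic_breaks_def
  proof (intro conjI allI impI fin sub)
    fix c d :: real assume cd: "0 \<le> c \<and> c < d \<and> d \<le> 1 \<and> {c<..<d} \<inter> R = {}"
    then have "nadic_affine_on N g c d" using Q(2) by (auto simp: nadic_breaks_def R_def)
    then obtain k t where kt: "t \<in> nadic_rationals N" "\<forall>x\<in>{c..d}. g x = real N powi k * x + t"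
      by (auto simp: nadic_affine_on_def)
    have gcd: "0 \<le> g c" "g c < g d" "g d \<le> 1"
      using bij_betwE[OF bg] strict_mono_onD[OF Q(1), of c d] cd by auto
    have mono: "g c \<le> g x \<and> g x \<le> g d" if "x \<in> {c..d}" for x
      using strict_mono_onD[OF Q(1), of c x] strict_mono_onD[OF Q(1), of x d] that cd
      by (cases "x = c"; cases "x = d") auto
    have "{g c<..<g d} \<inter> P = {}"
    proof (rule ccontr)
      assume "{g c<..<g d} \<inter> P \<noteq> {}"
      then obtain p where p: "p \<in> P" "g c < p" "p < g d" by auto
      then have "p \<in> g ` {0..1}" using gcd bg by (auto simp: bij_betw_def)
      then obtain x where x: "x \<in> {0..1}" "p = g x" by blast
      have "c < x" using strict_mono_on_less[OF Q(1), of c x] x p cd by auto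
      moreover have "x < d" using strict_mono_on_less[OF Q(1), of x d] x p cd by auto
      ultimately have "x \<in> {c<..<d} \<inter> R" using x p by (auto simp: R_def)
      then show False using cd by blast
    qed
    then have "nadic_affine_on N f (g c) (g d)" using P gcd by (auto simp: nadic_breaks_def)
    then obtain k' t' where kt': "t' \<in> nadic_rationals N"
      "\<forall>x\<in>{g c..g d}. f x = real N powi k' * x + t'"
      by (auto simp: nadic_affine_on_def)
    have "compose {0..1} f g x = real N powi (k' + k) * x + (real N powi k' * t + t')"
      if x: "x \<in> {c..d}" for x
    proof -
      have "compose {0..1} f g x = f (g x)" using x cd by (simp add: compose_def)
      also have "\<dots> = real N powi k' * (real N powi k * x + t) + t'"
        using kt kt' mono[OF x] x by auto
      finally show ?thesis using N by (simp add: power_int_add algebra_simps)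
    qed
    moreover have "real N powi k' * t + t' \<in> nadic_rationals N"
      using kt kt' N by (auto intro!: nadic_add nadic_powi_mult)
    ultimately show "nadic_affine_on N (compose {0..1} f g) c d"
      unfolding nadic_affine_on_def by blast
  qed
  then show ?thesis
    using thompson_carrierI[OF N] compose_Bij[OF B] by (auto simp: Bij_def)
qed

lemma thompson_inverse_closed:
  assumes N: "N \<ge> 2" and f: "f \<in> thompson_carrier N"
  shows "(\<lambda>x\<in>{0..1}. inv_into {0..1} f x) \<in> thompson_carrier N"
proof -
  obtain P where P: "strict_mono_on {0..1} f" "nadic_breaks N f P" "P \<subseteq> {0..1}"
    using thompson_carrier_structure[OF N f] by blast
  have B: "f \<in> Bij {0..1}" using f thompson_carrier_Bij by auto
  have bf: "bij_betw f {0..1} {0..1}" using B by (simp add: Bij_def)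
  define h where "h = (\<lambda>x\<in>{0..1}. inv_into {0..1} f x)"
  have hf: "h (f x) = x" if "x \<in> {0..1}" for x
    using that bij_betwE[OF bf] bij_betw_inv_into_left[OF bf] by (simp add: h_def)
  have h: "h y \<in> {0..1}" "f (h y) = y" if "y \<in> {0..1}" for y
    using that bij_betw_inv_into_right[OF bf, of y] bij_betwE[OF bij_betw_inv_into[OF bf]]
    by (auto simp: h_def)
  have "nadic_breaks N h (f ` P)"
    unfolding nadic_breaks_def
  proof (intro conjI allI impI)
    show "finite (f ` P)" using P(2) by (simp add: nadic_breaks_def)
    show "f ` P \<subseteq> nadic_rationals N"
      using P(2,3) nadic_iff_image[OF N P(2)] unfolding nadic_breaks_def by blast
    fix c d :: real assume cd: "0 \<le> c \<and> c < d \<and> d \<le> 1 \<and> {c<..<d} \<inter> f ` P = {}"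
    have hc: "h c \<in> {0..1}" "f (h c) = c" and hd: "h d \<in> {0..1}" "f (h d) = d"
      using h cd by auto
    have less: "h c < h d" using strict_mono_on_less[OF P(1) hc(1) hd(1)] hc hd cd by simp
    have "{h c<..<h d} \<inter> P = {}"
    proof (rule ccontr)
      assume "{h c<..<h d} \<inter> P \<noteq> {}"
      then obtain p where p: "p \<in> P" "h c < p" "p < h d" by auto
      then have "c < f p" "f p < d"
        using strict_mono_onD[OF P(1), of "h c" p] strict_mono_onD[OF P(1), of p "h d"] hc hd P(3) by auto
      then show False using cd p by auto
    qed
    then have "nadic_affine_on N f (h c) (h d)" using P(2) less hc hd by (auto simp: nadic_breaks_def)
    then obtain k t where kt: "t \<in> nadic_rationals N" "\<forall>x\<in>{h c..h d}. f x = real N powi k * x + t"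
      by (auto simp: nadic_affine_on_def)
    have "h y = real N powi (- k) * y + - (real N powi (- k) * t)" if y: "y \<in> {c..d}" for y
    proof -
      have y01: "y \<in> {0..1}" using y cd by auto
      have "h c \<le> h y" "h y \<le> h d"
        using strict_mono_on_less[OF P(1) h(1)[OF y01] hc(1)] strict_mono_on_less[OF P(1) hd(1) h(1)[OF y01]]
          hc hd h[OF y01] y by auto
      then have "y = real N powi k * h y + t" using kt h[OF y01] by auto
      then have "h y = real N powi (- k) * (y - t)" using N by (simp add: power_int_minus field_simps)
      then show ?thesis by (simp add: algebra_simps)
    qed
    moreover have "- (real N powi (- k) * t) \<in> nadic_rationals N"
      using kt N by (auto intro!: nadic_uminus nadic_powi_mult)
    ultimately show "nadic_affine_on N h c d" unfolding nadic_affine_on_def by blast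
  qed
  then show ?thesis
    using thompson_carrierI[OF N] restrict_inv_into_Bij[OF B] by (auto simp: Bij_def h_def)
qed

lemma subgroup_thompson:
  assumes N: "N \<ge> 2"
  shows "subgroup (thompson_carrier N) (BijGroup {0..1})"
proof
  show "thompson_carrier N \<subseteq> carrier (BijGroup {0..1})"
    using thompson_carrier_Bij by (auto simp: BijGroup_def)
  show "f \<otimes>\<^bsub>BijGroup {0..1}\<^esub> g \<in> thompson_carrier N"
    if "f \<in> thompson_carrier N" "g \<in> thompson_carrier N" for f g
    using that thompson_carrier_Bij thompson_compose_closed[OF N] by (simp add: BijGroup_def)
  show "inv\<^bsub>BijGroup {0..1}\<^esub> f \<in> thompson_carrier N" if "f \<in> thompson_carrier N" for f
    using inv_BijGroup[OF thompson_carrier_Bij[OF that]] thompson_inverse_closed[OF N that] by simp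
  have "nadic_breaks N (\<lambda>x\<in>{0..1}. x) {}"
    unfolding nadic_breaks_def nadic_affine_on_def
    by (auto intro!: exI[of _ 0] bexI[of _ 0] nadic_zero)
  then show "\<one>\<^bsub>BijGroup {0..1}\<^esub> \<in> thompson_carrier N"
    using thompson_carrierI[OF N, of "\<lambda>x\<in>{0..1}. x"] id_Bij[of "{0..1::real}"]
    by (auto simp: BijGroup_def Bij_def)
qed

lemma group_thompson: "N \<ge> 2 \<Longrightarrow> group (thompson_group N)"
  unfolding thompson_group_def
  by (rule group.subgroup_imp_group[OF group_BijGroup subgroup_thompson])

lemma carrier_thompson: "carrier (thompson_group N) = thompson_carrier N"
  by (simp add: thompson_group_def)

lemma mult_thompson:
  "f \<in> thompson_carrier N \<Longrightarrow> g \<in> thompson_carrier N \<Longrightarrow> f \<otimes>\<^bsub>thompson_group N\<^esub> g = compose {0..1} f g"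
  using thompson_carrier_Bij by (simp add: thompson_group_def BijGroup_def)

text \<open>An element is the piecewise linear interpolation of its finite graph over a set of breakpoints.\<close>

lemma countable_thompson:
  assumes N: "N \<ge> 2"
  shows "countable (thompson_carrier N)"
proof -
  have "\<forall>f\<in>thompson_carrier N. \<exists>P. nadic_breaks N f P \<and> 0 \<in> P \<and> 1 \<in> P \<and> P \<subseteq> {0..1}"
    using thompson_carrier_structure[OF N] by metis
  then obtain P where P: "\<And>f. f \<in> thompson_carrier N \<Longrightarrow> nadic_breaks N f (P f) \<and> 0 \<in> P f \<and> 1 \<in> P f \<and> P f \<subseteq> {0..1}"
    by metis
  define gr where "gr f = (\<lambda>p. (p, f p)) ` P f" for f
  have inj: "inj_on gr (thompson_carrier N)"
  proof (rule inj_onI)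
    fix f g assume f: "f \<in> thompson_carrier N" and g: "g \<in> thompson_carrier N" and eq: "gr f = gr g"
    have "fst ` gr h = P h" for h by (force simp: gr_def)
    then have PP: "P f = P g" using eq by metis
    have eqP: "f p = g p" if "p \<in> P f" for p
    proof -
      have "(p, f p) \<in> gr g" using that eq by (auto simp: gr_def)
      then show ?thesis by (auto simp: gr_def)
    qed
    show "f = g"
    proof (rule extensionalityI[of _ "{0..1}"])
      show "f \<in> extensional {0..1}" "g \<in> extensional {0..1}" using f g by (auto simp: thompson_carrier_def)
      fix x :: real assume x: "x \<in> {0..1}"
      show "f x = g x"
      proof (cases "x \<in> P f")
        case False
        define A where "A = {p \<in> P f. p < x}"
        define B where "B = {p \<in> P f. x < p}"
        have fin: "finite (P f)" using P[OF f] by (simp add: nadic_breaks_def)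
        have "x \<noteq> 0" "x \<noteq> 1" using P[OF f] False by auto
        then have "0 \<in> A" "1 \<in> B" using P[OF f] x by (auto simp: A_def B_def)
        then have AB: "finite A" "A \<noteq> {}" "finite B" "B \<noteq> {}"
          using fin by (auto simp: A_def B_def)
        define a where "a = Max A"
        define b where "b = Min B"
        have a: "a \<in> P f" "a < x" using Max_in[OF AB(1,2)] by (auto simp: a_def A_def)
        have b: "b \<in> P f" "x < b" using Min_in[OF AB(3,4)] by (auto simp: b_def B_def)
        have "{a<..<b} \<inter> P f = {}"
        proof (rule ccontr)
          assume "{a<..<b} \<inter> P f \<noteq> {}"
          then obtain p where p: "p \<in> P f" "a < p" "p < b" by auto
          then have "p \<noteq> x" using False by auto
          then show False
            using Max_ge[OF AB(1), of p] Min_le[OF AB(3), of p] p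
            by (cases "p < x") (auto simp: a_def b_def A_def B_def)
        qed
        moreover have ab01: "0 \<le> a" "b \<le> 1" using a b P[OF f] by auto
        ultimately have "nadic_affine_on N f a b" "nadic_affine_on N g a b"
          using P[OF f] P[OF g] PP a b by (auto simp: nadic_breaks_def)
        then obtain k t k' t' where kt: "\<forall>y\<in>{a..b}. f y = real N powi k * y + t"
          "\<forall>y\<in>{a..b}. g y = real N powi k' * y + t'"
          by (auto simp: nadic_affine_on_def)
        have eqs: "real N powi k * a + t = real N powi k' * a + t'"
          "real N powi k * b + t = real N powi k' * b + t'"
          using kt eqP[OF a(1)] eqP[OF b(1)] a b by auto
        then have "(real N powi k - real N powi k') * (b - a) = 0" by (simp add: algebra_simps)
        then have "real N powi k = real N powi k'" using a b by simp
        then show ?thesis using kt eqs a b by auto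
      qed (use eqP in blast)
    qed
  qed
  have "gr ` thompson_carrier N \<subseteq> {X. finite X \<and> X \<subseteq> nadic_rationals N \<times> nadic_rationals N}"
  proof
    fix X assume "X \<in> gr ` thompson_carrier N"
    then obtain f where f: "f \<in> thompson_carrier N" "X = gr f" by blast
    have br: "nadic_breaks N f (P f)" using P[OF f(1)] by blast
    have "f p \<in> nadic_rationals N" "p \<in> nadic_rationals N" if "p \<in> P f" for p
      using nadic_iff_image[OF N br, of p] that P[OF f(1)] br unfolding nadic_breaks_def by blast+
    then show "X \<in> {X. finite X \<and> X \<subseteq> nadic_rationals N \<times> nadic_rationals N}"
      using br f(2) by (auto simp: gr_def nadic_breaks_def)
  qed
  then have "countable (gr ` thompson_carrier N)"
    using countable_Collect_finite_subset[of "nadic_rationals N \<times> nadic_rationals N"] countable_nadic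
    by (meson countable_SIGMA countable_subset)
  then show ?thesis using countable_image_inj_on[OF _ inj] by blast
qed

section \<open>Commuting bumps near the origin\<close>

text \<open>A concave graph over \<open>[1, 2]\<close> with slopes \<open>\<nu>\<close>, \<open>1\<close>, \<open>1 / \<nu>\<close>, extended by the identity.\<close>

definition bump :: "real \<Rightarrow> real \<Rightarrow> real" where
  "bump \<nu> y = max y (min (\<nu> * (y - 1) + 1) (min (y + (1 / \<nu> - 1 / \<nu>\<^sup>2)) (2 - (2 - y) / \<nu>)))"

text \<open>The difference of two competing linear functions is a positive constant times y minus
  (or minus y plus) their crossing point, so every min and max is decided by comparing y with a
  crossing point. The shift 1 / \<nu> - 1 / \<open>\<nu>\<^sup>2\<close> is what slope \<nu> gains
  on an interval of length 1 / \<open>\<nu>\<^sup>2\<close> and what slope 1 / \<nu> gives back on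
  one of length 1 / \<nu>.\<close>

lemma bump_regions:
  assumes \<nu>: "\<nu> \<ge> 2"
  shows bump_le_1: "y \<le> 1 \<Longrightarrow> bump \<nu> y = y"
    and bump_fast: "1 \<le> y \<Longrightarrow> y \<le> 1 + 1 / \<nu>\<^sup>2 \<Longrightarrow> bump \<nu> y = \<nu> * (y - 1) + 1"
    and bump_shift: "1 + 1 / \<nu>\<^sup>2 \<le> y \<Longrightarrow> y \<le> 2 - 1 / \<nu> \<Longrightarrow> bump \<nu> y = y + (1 / \<nu> - 1 / \<nu>\<^sup>2)"
    and bump_slow: "2 - 1 / \<nu> \<le> y \<Longrightarrow> y \<le> 2 \<Longrightarrow> bump \<nu> y = 2 - (2 - y) / \<nu>"
    and bump_ge_2: "2 \<le> y \<Longrightarrow> bump \<nu> y = y"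
proof -
  define a where "a = 1 / \<nu>"
  have a: "0 < a" "a \<le> 1 / 2" "\<nu> * a = 1" "1 / \<nu>\<^sup>2 = a * a"
    using \<nu> by (auto simp: a_def power2_eq_square field_simps)
  have na: "\<nu> * (a * a) = a" using a(3) by (simp flip: mult.assoc)
  have b: "bump \<nu> y = max y (min (\<nu> * (y - 1) + 1) (min (y + (a - a * a)) (2 - (2 - y) * a)))" for y
    unfolding bump_def a(4) by (simp add: a_def)
  have aa: "0 < a * a" "a * a \<le> 1 / 4"
    using a mult_mono[of a "1/2" a "1/2"] by auto
  have aa': "a * a \<le> a / 2" using a mult_mono[of a "1/2" a a] by auto
  have A: "(\<nu> - 1) * (y - (1 + a * a)) = (\<nu> * (y - 1) + 1) - (y + (a - a * a))" for y
    using na by (simp add: algebra_simps)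
  have B: "(1 - a) * (y - (2 - a)) = (y + (a - a * a)) - (2 - (2 - y) * a)" for y
    by (simp add: algebra_simps)
  have C: "(\<nu> - 1) * (y - 1) = (\<nu> * (y - 1) + 1) - y" for y by (simp add: algebra_simps)
  have D: "(1 - a) * (2 - y) = (2 - (2 - y) * a) - y" for y by (simp add: algebra_simps)
  have sgn: "0 \<le> p * q \<longleftrightarrow> 0 \<le> q" "p * q \<le> 0 \<longleftrightarrow> q \<le> 0" if "0 < p" for p q :: real
    using that by (auto simp: zero_le_mult_iff mult_le_0_iff)
  have pos: "0 < \<nu> - 1" "0 < 1 - a" using \<nu> a by auto
  have A1: "\<nu> * (y - 1) + 1 \<le> y + (a - a * a) \<longleftrightarrow> y \<le> 1 + a * a" for y
    using sgn(2)[OF pos(1), of "y - (1 + a * a)"] unfolding A by simp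
  have A2: "y + (a - a * a) \<le> \<nu> * (y - 1) + 1 \<longleftrightarrow> 1 + a * a \<le> y" for y
    using sgn(1)[OF pos(1), of "y - (1 + a * a)"] unfolding A by simp
  have B1: "y + (a - a * a) \<le> 2 - (2 - y) * a \<longleftrightarrow> y \<le> 2 - a" for y
    using sgn(2)[OF pos(2), of "y - (2 - a)"] unfolding B by simp
  have B2: "2 - (2 - y) * a \<le> y + (a - a * a) \<longleftrightarrow> 2 - a \<le> y" for y
    using sgn(1)[OF pos(2), of "y - (2 - a)"] unfolding B by simp
  have C1: "\<nu> * (y - 1) + 1 \<le> y \<longleftrightarrow> y \<le> 1" for y
    using sgn(2)[OF pos(1), of "y - 1"] unfolding C by simp
  have C2: "y \<le> \<nu> * (y - 1) + 1 \<longleftrightarrow> 1 \<le> y" for y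
    using sgn(1)[OF pos(1), of "y - 1"] unfolding C by simp
  have D1: "2 - (2 - y) * a \<le> y \<longleftrightarrow> 2 \<le> y" for y
    using sgn(2)[OF pos(2), of "2 - y"] unfolding D by simp
  have D2: "y \<le> 2 - (2 - y) * a \<longleftrightarrow> y \<le> 2" for y
    using sgn(1)[OF pos(2), of "2 - y"] unfolding D by simp
  have q: "(2 - y) / \<nu> = (2 - y) * a" for y by (simp add: a_def)
  show "bump \<nu> y = y" if "y \<le> 1" using that C1[of y] by (simp add: b)
  show "bump \<nu> y = \<nu> * (y - 1) + 1" if "1 \<le> y" "y \<le> 1 + 1 / \<nu>\<^sup>2"
  proof -
    have "y \<le> 1 + a * a" "y \<le> 2 - a" using that a aa by auto
    then show ?thesis using A1[of y] B1[of y] C2[of y] that by (simp add: b)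
  qed
  show "bump \<nu> y = y + (1 / \<nu> - 1 / \<nu>\<^sup>2)" if "1 + 1 / \<nu>\<^sup>2 \<le> y" "y \<le> 2 - 1 / \<nu>"
  proof -
    have y: "1 + a * a \<le> y" "y \<le> 2 - a" using that a by (auto simp flip: a_def)
    have "1 / \<nu> - 1 / \<nu>\<^sup>2 = a - a * a" using a(4) by (simp add: a_def)
    then show ?thesis using A2[of y] B1[of y] y a aa' by (simp add: b)
  qed
  show "bump \<nu> y = 2 - (2 - y) / \<nu>" if "2 - 1 / \<nu> \<le> y" "y \<le> 2"
  proof -
    have y: "1 + a * a \<le> y" "2 - a \<le> y" using that a aa aa' by (auto simp flip: a_def)
    then have "2 - (2 - y) * a \<le> \<nu> * (y - 1) + 1" using B2[of y] A2[of y] by linarith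
    then show ?thesis using B2[of y] D2[of y] y that by (simp add: b q)
  qed
  show "bump \<nu> y = y" if "2 \<le> y" using that D1[of y] by (simp add: b)
qed

lemma bump_mono:
  assumes "\<nu> \<ge> 2" "x < y"
  shows "bump \<nu> x < bump \<nu> y"
proof -
  have "\<nu> * (x - 1) < \<nu> * (y - 1)" using assms by simp
  moreover have "(2 - y) / \<nu> < (2 - x) / \<nu>" using assms by (simp add: divide_strict_right_mono)
  ultimately show ?thesis using assms unfolding bump_def by linarith
qed

lemma bump_ge: "y \<le> bump \<nu> y"
  by (simp add: bump_def)

lemma bump_gt:
  assumes "\<nu> \<ge> 2" "1 < y" "y < 2"
  shows "y < bump \<nu> y"
proof -
  have "(\<nu> - 1) * (y - 1) > 0" using assms by simp
  then have "y < \<nu> * (y - 1) + 1" by (simp add: algebra_simps)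
  moreover have "1 / \<nu>\<^sup>2 < 1 / \<nu>" using assms by (simp add: power2_eq_square field_simps)
  moreover have "(2 - y) / \<nu> < 2 - y"
    using assms mult_strict_left_mono[of 1 \<nu> "2 - y"] by (simp add: divide_less_eq)
  ultimately show ?thesis unfolding bump_def by (auto simp: less_max_iff_disj)
qed

lemma bump_less_2: "\<nu> \<ge> 2 \<Longrightarrow> y < 2 \<Longrightarrow> bump \<nu> y < 2"
  using bump_mono[of \<nu> y 2] bump_ge_2[of \<nu> 2] by simp

text \<open>A bump of scale w is supported in [w, 2 w]. The exponent starts at -1 so that already
  the first support lies in [0, 1]; as N \<ge> 2, different supports share at most an end
  point.\<close>

definition bump_scale :: "nat \<Rightarrow> nat \<Rightarrow> real" where
  "bump_scale N n = real N powi (- int n - 1)"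

definition thompson_bump :: "nat \<Rightarrow> nat \<Rightarrow> real \<Rightarrow> real" where
  "thompson_bump N n = (\<lambda>x\<in>{0..1}. bump_scale N n * bump (real N) (x / bump_scale N n))"

lemma bump_scale_pos: "N \<ge> 2 \<Longrightarrow> 0 < bump_scale N n"
  by (simp add: bump_scale_def)

lemma bump_scale_le:
  assumes "N \<ge> 2" "m < n"
  shows "2 * bump_scale N n \<le> bump_scale N m"
proof -
  have "bump_scale N m = real N powi (int n - int m + (- int n - 1))" by (simp add: bump_scale_def)
  also have "\<dots> = real N powi (int n - int m) * bump_scale N n"
    unfolding bump_scale_def using assms by (subst power_int_add) auto
  finally have eq: "bump_scale N m = real N powi (int n - int m) * bump_scale N n" .
  have "real N powi 1 \<le> real N powi (int n - int m)"
    using assms by (intro power_int_increasing) auto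
  then show ?thesis unfolding eq using assms bump_scale_pos[OF assms(1), of n]
    by (intro mult_right_mono) auto
qed

lemma bump_scale_le_1:
  assumes "N \<ge> 2"
  shows "2 * bump_scale N n \<le> 1"
proof -
  have "2 * bump_scale N 0 \<le> 1" using assms by (simp add: bump_scale_def power_int_minus field_simps)
  moreover have "bump_scale N n \<le> bump_scale N 0"
    using bump_scale_le[OF assms, of 0 n] bump_scale_pos[OF assms, of n] by (cases "n = 0") auto
  ultimately show ?thesis by simp
qed

lemma thompson_bump_apply:
  "x \<in> {0..1} \<Longrightarrow> thompson_bump N n x = bump_scale N n * bump (real N) (x / bump_scale N n)"
  by (simp add: thompson_bump_def)

lemma thompson_bump_fix_low:
  assumes "N \<ge> 2" "x \<in> {0..1}" "x \<le> bump_scale N n"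
  shows "thompson_bump N n x = x"
  using assms bump_scale_pos[OF assms(1), of n] bump_le_1[of "real N" "x / bump_scale N n"]
  by (simp add: thompson_bump_apply)

lemma thompson_bump_fix_high:
  assumes "N \<ge> 2" "x \<in> {0..1}" "2 * bump_scale N n \<le> x"
  shows "thompson_bump N n x = x"
  using assms bump_scale_pos[OF assms(1), of n] bump_ge_2[of "real N" "x / bump_scale N n"]
  by (simp add: thompson_bump_apply field_simps)

lemma thompson_bump_mono:
  assumes "N \<ge> 2" "x \<in> {0..1}" "y \<in> {0..1}" "x < y"
  shows "thompson_bump N n x < thompson_bump N n y"
  using assms bump_scale_pos[OF assms(1), of n]
  by (simp add: thompson_bump_apply bump_mono divide_strict_right_mono)

lemma thompson_bump_ge:
  assumes "N \<ge> 2" "x \<in> {0..1}"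
  shows "x \<le> thompson_bump N n x"
  using assms bump_scale_pos[OF assms(1), of n] bump_ge[of "x / bump_scale N n" "real N"]
  by (simp add: thompson_bump_apply field_simps)

lemma thompson_bump_bij:
  assumes N: "N \<ge> 2"
  shows "bij_betw (thompson_bump N n) {0..1} {0..1}"
proof -
  have e: "thompson_bump N n 0 = 0" "thompson_bump N n 1 = 1"
    using thompson_bump_fix_low[OF N, of 0 n] thompson_bump_fix_high[OF N, of 1 n]
      bump_scale_pos[OF N, of n] bump_scale_le_1[OF N, of n] by auto
  have le: "thompson_bump N n x \<le> thompson_bump N n y" if "x \<in> {0..1}" "y \<in> {0..1}" "x \<le> y" for x y
    using thompson_bump_mono[OF N that(1,2)] that(3) by (cases "x = y") (auto intro: less_imp_le)
  have "inj_on (thompson_bump N n) {0..1}"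
    by (rule linorder_inj_onI') (use thompson_bump_mono[OF N] in \<open>auto dest: less_imp_neq\<close>)
  moreover have "thompson_bump N n ` {0..1} = {0..1}"
  proof
    show "thompson_bump N n ` {0..1} \<subseteq> {0..1}" using le[of 0] le[of _ 1] e by auto
    have "continuous_on {0..1} (\<lambda>x. bump_scale N n * bump (real N) (x / bump_scale N n))"
      unfolding bump_def using N bump_scale_pos[OF N, of n] by (intro continuous_intros) auto
    then have "continuous_on {0..1} (thompson_bump N n)"
      by (subst continuous_on_cong[OF refl thompson_bump_apply]) auto
    then have "\<exists>x\<ge>0. x \<le> 1 \<and> thompson_bump N n x = y" if "y \<in> {0..1}" for y
      using IVT'[of "thompson_bump N n" 0 y 1] that e by auto
    then show "{0..1} \<subseteq> thompson_bump N n ` {0..1}" by force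
  qed
  ultimately show ?thesis by (simp add: bij_betw_def)
qed

lemma thompson_bump_carrier:
  assumes N: "N \<ge> 2"
  shows "thompson_bump N n \<in> thompson_carrier N"
proof -
  define w where "w = bump_scale N n"
  define \<nu> where "\<nu> = real N"
  have w: "0 < w" using bump_scale_pos[OF N] by (simp add: w_def)
  have \<nu>: "\<nu> \<ge> 2" using N by (simp add: \<nu>_def)
  have wN: "w \<in> nadic_rationals N" using N by (simp add: w_def bump_scale_def nadic_powi)
  have wp: "\<nu> powi k * w \<in> nadic_rationals N" for k using N wN by (simp add: \<nu>_def nadic_powi_mult)
  have p1: "w / \<nu> \<in> nadic_rationals N" using wp[of "-1"] by (simp add: field_simps power_int_minus)
  have p2: "w / \<nu>\<^sup>2 \<in> nadic_rationals N" using wp[of "-2"] by (simp add: field_simps power_int_minus)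
  \<comment> \<open>Together with w and w + w these are the break points 1, 1 + 1 /
    \<open>\<nu>\<^sup>2\<close>, 2 - 1 / \<nu> and 2 of \<open>bump\<close>, scaled by w and
    written as sums and differences of N-adic rationals.\<close>
  define p q where "p = w + w / \<nu>\<^sup>2" and "q = w + w - w / \<nu>"
  have pq: "p \<in> nadic_rationals N" "q \<in> nadic_rationals N" "w + w \<in> nadic_rationals N"
    unfolding p_def q_def using p1 p2 wN N by (intro nadic_add nadic_diff; simp)+
  have pw: "p = w * (1 + 1 / \<nu>\<^sup>2)" "q = w * (2 - 1 / \<nu>)"
    by (simp_all add: p_def q_def algebra_simps)
  have "nadic_breaks N (thompson_bump N n) {w, p, q, w + w}"
    unfolding nadic_breaks_def
  proof (intro conjI allI impI)
    show "{w, p, q, w + w} \<subseteq> nadic_rationals N" using wN pq by blast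
    fix c d :: real assume cd: "0 \<le> c \<and> c < d \<and> d \<le> 1 \<and> {c<..<d} \<inter> {w, p, q, w + w} = {}"
    have split: "d \<le> u \<or> u \<le> c" if "u \<in> {w, p, q, w + w}" for u
      using cd that by (metis disjoint_iff greaterThanLessThan_iff not_le)
    have ev: "thompson_bump N n x = w * bump \<nu> (x / w)" if "x \<in> {c..d}" for x
      using that cd by (simp add: thompson_bump_apply w_def \<nu>_def)
    have scl: "x / w \<le> z \<longleftrightarrow> x \<le> w * z" "z \<le> x / w \<longleftrightarrow> w * z \<le> x" for x z
      using w by (simp_all add: field_simps)
    have affI: "nadic_affine_on N (thompson_bump N n) c d"
      if "t \<in> nadic_rationals N" "\<And>x. x \<in> {c..d} \<Longrightarrow> w * bump \<nu> (x / w) = \<nu> powi k * x + t" for k t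
      unfolding nadic_affine_on_def using that ev by (auto simp: \<nu>_def)
    consider "d \<le> w" | "w \<le> c" "d \<le> p" | "p \<le> c" "d \<le> q" | "q \<le> c" "d \<le> w + w" | "w + w \<le> c"
      using split[of w] split[of p] split[of q] split[of "w + w"] by auto
    then show "nadic_affine_on N (thompson_bump N n) c d"
    proof cases
      case 1
      have "w * bump \<nu> (x / w) = \<nu> powi 0 * x + 0" if "x \<in> {c..d}" for x
        using that 1 w bump_le_1[OF \<nu>, of "x / w"] by (simp add: scl)
      then show ?thesis using affI[OF nadic_zero] by blast
    next
      case 2
      have "w * bump \<nu> (x / w) = \<nu> powi 1 * x + (w - \<nu> powi 1 * w)" if "x \<in> {c..d}" for x
      proof -
        have x: "1 \<le> x / w" "x / w \<le> 1 + 1 / \<nu>\<^sup>2" unfolding scl using that 2 by (auto simp: pw)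
        show ?thesis unfolding bump_fast[OF \<nu> x] using w by (simp add: field_simps)
      qed
      then show ?thesis using affI[OF nadic_diff[OF _ wN wp]] N by (meson less_le_trans zero_less_numeral)
    next
      case 3
      have "w * bump \<nu> (x / w) = \<nu> powi 0 * x + (w / \<nu> - w / \<nu>\<^sup>2)" if "x \<in> {c..d}" for x
      proof -
        have x: "1 + 1 / \<nu>\<^sup>2 \<le> x / w" "x / w \<le> 2 - 1 / \<nu>" unfolding scl using that 3 by (auto simp: pw)
        show ?thesis unfolding bump_shift[OF \<nu> x] using w by (simp add: algebra_simps)
      qed
      then show ?thesis using affI[OF nadic_diff[OF _ p1 p2]] N by (meson less_le_trans zero_less_numeral)
    next
      case 4
      have "w * bump \<nu> (x / w) = \<nu> powi (-1) * x + ((w + w) - (w / \<nu> + w / \<nu>))" if "x \<in> {c..d}" for x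
      proof -
        have x: "2 - 1 / \<nu> \<le> x / w" "x / w \<le> 2" unfolding scl using that 4 by (auto simp: pw)
        show ?thesis unfolding bump_slow[OF \<nu> x] using w \<nu> by (simp add: power_int_minus field_simps)
      qed
      then show ?thesis using affI[OF nadic_diff[OF _ pq(3) nadic_add[OF _ p1 p1]]] N by (meson less_le_trans zero_less_numeral)
    next
      case 5
      have "w * bump \<nu> (x / w) = \<nu> powi 0 * x + 0" if "x \<in> {c..d}" for x
        using that 5 w bump_ge_2[OF \<nu>, of "x / w"] by (simp add: scl)
      then show ?thesis using affI[OF nadic_zero] by blast
    qed
  qed simp
  then show ?thesis
    using thompson_carrierI[OF N _ thompson_bump_bij[OF N]] by (auto simp: thompson_bump_def)
qed

text \<open>The orbit of the midpoint of the support [w, 2 w] stays inside the support and strictly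
  increases, so all powers are distinct.\<close>

lemma thompson_bump_infinite_order:
  assumes N: "N \<ge> 2"
  shows "infinite (range (\<lambda>k::nat. thompson_bump N n [^]\<^bsub>thompson_group N\<^esub> k))"
proof -
  interpret group "thompson_group N" by (rule group_thompson[OF N])
  define c where "c = thompson_bump N n"
  define w where "w = bump_scale N n"
  have w: "0 < w" "2 * w \<le> 1" using bump_scale_pos[OF N] bump_scale_le_1[OF N] by (auto simp: w_def)
  have c: "c \<in> carrier (thompson_group N)"
    using thompson_bump_carrier[OF N] by (simp add: c_def carrier_thompson)
  define r where "r k = (c [^]\<^bsub>thompson_group N\<^esub> k) (w + w / 2)" for k :: nat
  have step: "r (Suc k) = c (r k)" for k
  proof -
    have "c [^]\<^bsub>thompson_group N\<^esub> k \<in> thompson_carrier N" "c \<in> thompson_carrier N"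
      using c nat_pow_closed[OF c, of k] by (auto simp: carrier_thompson)
    moreover have "c [^]\<^bsub>thompson_group N\<^esub> Suc k = c \<otimes>\<^bsub>thompson_group N\<^esub> c [^]\<^bsub>thompson_group N\<^esub> k"
      using nat_pow_Suc2[OF c] .
    ultimately have "c [^]\<^bsub>thompson_group N\<^esub> Suc k = compose {0..1} c (c [^]\<^bsub>thompson_group N\<^esub> k)"
      using mult_thompson by metis
    moreover have "w + w / 2 \<in> {0..1}" using w by simp
    ultimately show ?thesis unfolding r_def by (simp only: compose_eq)
  qed
  have rng: "w < r k \<and> r k < 2 * w" for k
  proof (induction k)
    case 0
    have "(\<one>\<^bsub>thompson_group N\<^esub>) = (\<lambda>x\<in>{0..1}. x)" by (simp add: thompson_group_def BijGroup_def)
    then show ?case using w by (simp add: r_def)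
  next
    case (Suc k)
    then have k: "r k \<in> {0..1}" using w by auto
    have "c (r k) = w * bump (real N) (r k / w)" using k by (simp add: c_def w_def thompson_bump_apply)
    moreover have "bump (real N) (r k / w) < 2" using Suc N w by (intro bump_less_2) (auto simp: field_simps)
    ultimately have "c (r k) < 2 * w" using w by (simp add: field_simps)
    moreover have "r k \<le> c (r k)" using thompson_bump_ge[OF N k] by (simp add: c_def)
    ultimately show ?case using Suc step by simp
  qed
  have "r k < r (Suc k)" for k
  proof -
    have k: "r k \<in> {0..1}" using rng[of k] w by auto
    have "r k / w < bump (real N) (r k / w)"
      using rng[of k] N w by (intro bump_gt) (auto simp: field_simps)
    then show ?thesis
      using k w unfolding step by (simp add: c_def w_def thompson_bump_apply field_simps)
  qed
  then have "strict_mono r" by (simp add: strict_mono_Suc_iff)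
  then have "inj r" by (rule strict_mono_imp_inj_on)
  have "inj (\<lambda>k::nat. c [^]\<^bsub>thompson_group N\<^esub> k)"
  proof (rule injI)
    fix i j :: nat assume "c [^]\<^bsub>thompson_group N\<^esub> i = c [^]\<^bsub>thompson_group N\<^esub> j"
    then have "r i = r j" by (simp add: r_def)
    then show "i = j" using \<open>inj r\<close> by (simp add: inj_eq)
  qed
  then show ?thesis by (simp add: c_def range_inj_infinite)
qed

text \<open>For n > 0 the support of bump n ends before that of bump 0 begins. Bump n preserves the
  part up to 2 \<open>bump_scale N n\<close>, where bump 0 is the identity; above it bump n is the
  identity and bump 0 only moves points further up.\<close>

lemma thompson_bump_commute:
  assumes N: "N \<ge> 2"
  shows "thompson_bump N n \<otimes>\<^bsub>thompson_group N\<^esub> thompson_bump N 0 =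
    thompson_bump N 0 \<otimes>\<^bsub>thompson_group N\<^esub> thompson_bump N n"
proof (cases "n = 0")
  case False
  have le: "2 * bump_scale N n \<le> bump_scale N 0" using bump_scale_le[OF N, of 0 n] False by simp
  have rng: "thompson_bump N m x \<in> {0..1}" if "x \<in> {0..1}" for m x
    using bij_betwE[OF thompson_bump_bij[OF N]] that by blast
  have "thompson_bump N n (thompson_bump N 0 x) = thompson_bump N 0 (thompson_bump N n x)"
    if x: "x \<in> {0..1}" for x
  proof (cases "x \<le> 2 * bump_scale N n")
    case True
    have s: "2 * bump_scale N n \<in> {0..1}"
      using bump_scale_pos[OF N, of n] bump_scale_le_1[OF N, of n] by simp
    have "thompson_bump N n x \<le> thompson_bump N n (2 * bump_scale N n)"
      using thompson_bump_mono[OF N x s, of n] True by (cases "x = 2 * bump_scale N n") auto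
    also have "\<dots> = 2 * bump_scale N n" using thompson_bump_fix_high[OF N s] by simp
    finally have "thompson_bump N 0 (thompson_bump N n x) = thompson_bump N n x"
      using le by (intro thompson_bump_fix_low[OF N rng[OF x]]) simp
    moreover have "thompson_bump N 0 x = x" using True le by (intro thompson_bump_fix_low[OF N x]) simp
    ultimately show ?thesis by simp
  next
    case False
    then have "thompson_bump N n x = x" by (intro thompson_bump_fix_high[OF N x]) simp
    moreover have "thompson_bump N n (thompson_bump N 0 x) = thompson_bump N 0 x"
      using False thompson_bump_ge[OF N x, of 0] by (intro thompson_bump_fix_high[OF N rng[OF x]]) simp
    ultimately show ?thesis by simp
  qed
  then show ?thesis
    by (auto simp: mult_thompson[OF thompson_bump_carrier[OF N] thompson_bump_carrier[OF N]] compose_def)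
qed simp

text \<open>Near \<open>0\<close>, an element \<open>g\<close> is the dilation by its slope \<open>N\<^sup>k\<close> there, so it conjugates bumps
  supported close to \<open>0\<close> to bumps.\<close>

lemma thompson_bump_conj:
  assumes N: "N \<ge> 2" and g: "g \<in> thompson_carrier N"
  shows "\<exists>m n. g \<otimes>\<^bsub>thompson_group N\<^esub> thompson_bump N m = thompson_bump N n \<otimes>\<^bsub>thompson_group N\<^esub> g"
proof -
  obtain P where P: "strict_mono_on {0..1} g" "nadic_breaks N g P" "g 0 = 0"
    using thompson_carrier_structure[OF N g] by blast
  obtain d where d: "0 < d" "d \<le> 1" "{0<..<d} \<inter> P = {}"
    using finite_gap_right[of P 0 1] P(2) by (auto simp: nadic_breaks_def)
  then obtain k t where kt: "\<forall>x\<in>{0..d}. g x = real N powi k * x + t"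
    using P(2) unfolding nadic_breaks_def nadic_affine_on_def by (metis order_refl)
  have "t = 0" using kt P(3) d by auto
  then have gk: "g x = real N powi k * x" if "0 \<le> x" "x \<le> d" for x using kt that by auto
  obtain m0 :: nat where m0: "(1 / 2) ^ m0 < d" using real_arch_pow_inv[OF d(1), of "1/2"] by auto
  \<comment> \<open>m0 brings the support of bump m into [0, d], where g is linear; the extra
    \<bar>k\<bar> makes m - k a natural number.\<close>
  define m where "m = m0 + nat \<bar>k\<bar>"
  define n where "n = nat (int m - k)"
  have nk: "int n = int m - k" by (simp add: n_def m_def)
  have wn: "bump_scale N n = real N powi k * bump_scale N m"
  proof -
    have "- int n - 1 = k + (- int m - 1)" by (simp add: nk)
    then have "bump_scale N n = real N powi (k + (- int m - 1))" by (simp only: bump_scale_def)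
    then show ?thesis unfolding bump_scale_def using N by (subst (asm) power_int_add) auto
  qed
  have wm: "2 * bump_scale N m \<le> d"
  proof -
    have "bump_scale N i \<le> (1 / 2) ^ Suc i" for i
    proof (induction i)
      case 0
      then show ?case using bump_scale_le_1[OF N, of 0] by simp
    next
      case (Suc i)
      then show ?case using bump_scale_le[OF N, of i "Suc i"] by simp
    qed
    from this[of m] have "2 * bump_scale N m \<le> (1 / 2) ^ m" by simp
    also have "\<dots> \<le> (1 / 2) ^ m0" by (rule power_decreasing) (auto simp: m_def)
    finally show ?thesis using m0 by simp
  qed
  have pos: "0 < bump_scale N m" "0 < real N powi k" using bump_scale_pos[OF N] N by auto
  have grng: "g x \<in> {0..1}" if "x \<in> {0..1}" for x
    using thompson_carrier_Bij[OF g] that by (auto simp: Bij_def bij_betw_def)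
  have "g (thompson_bump N m x) = thompson_bump N n (g x)" if x: "x \<in> {0..1}" for x
  proof (cases "x \<le> d")
    case True
    have s: "d \<in> {0..1}" using d by simp
    have "thompson_bump N m x \<le> thompson_bump N m d"
      using thompson_bump_mono[OF N x s, of m] True by (cases "x = d") auto
    also have "\<dots> = d" using thompson_bump_fix_high[OF N s wm] .
    finally have "thompson_bump N m x \<le> d" .
    moreover have "0 \<le> thompson_bump N m x" using thompson_bump_ge[OF N x, of m] x by simp
    ultimately have "g (thompson_bump N m x) = real N powi k * (bump_scale N m * bump (real N) (x / bump_scale N m))"
      using gk x by (simp add: thompson_bump_apply)
    moreover have "thompson_bump N n (g x) = bump_scale N n * bump (real N) (g x / bump_scale N n)"
      using grng[OF x] by (simp add: thompson_bump_apply)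
    moreover have "g x / bump_scale N n = x / bump_scale N m"
      using gk[of x] x True pos N by (simp add: wn)
    ultimately show ?thesis by (simp add: wn mult.assoc)
  next
    \<comment> \<open>Beyond d both sides equal g x: the support of bump m ends before d, and g maps
      its upper end to that of bump n, so the latter is at most g d.\<close>
    case False
    then have "thompson_bump N m x = x" using wm by (intro thompson_bump_fix_high[OF N x]) simp
    moreover have "thompson_bump N n (g x) = g x"
    proof (rule thompson_bump_fix_high[OF N grng[OF x]])
      have "2 * bump_scale N n \<le> g d" using gk[of d] d pos wm
        by (simp add: wn mult.left_commute)
      also have "\<dots> \<le> g x" using strict_mono_onD[OF P(1), of d x] False d x by auto
      finally show "2 * bump_scale N n \<le> g x" .
    qed
    ultimately show ?thesis by simp
  qed
  then have "compose {0..1} g (thompson_bump N m) = compose {0..1} (thompson_bump N n) g"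
    by (auto simp: compose_def)
  then show ?thesis
    using mult_thompson[OF g thompson_bump_carrier[OF N]] mult_thompson[OF thompson_bump_carrier[OF N] g]
    by metis
qed

section \<open>Borel embedding of Polish spaces into the line\<close>

text \<open>In base 3 with digits 0 and 1 only, the tails are at most 1 / 2 of a unit. Unlike in
  base 2 there are no double expansions, so a floor recovers each digit.\<close>

definition ternary :: "(nat \<Rightarrow> bool) \<Rightarrow> real" where
  "ternary s = (\<Sum>n. of_bool (s n) * (1 / 3) ^ Suc n)"

definition ternary_digit :: "nat \<Rightarrow> real \<Rightarrow> bool" where
  "ternary_digit n y \<longleftrightarrow> \<lfloor>3 ^ Suc n * y\<rfloor> mod 3 = 1"

lemma ternary_summable: "summable (\<lambda>n. of_bool (s n) * (1 / 3 :: real) ^ Suc n)"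
proof (rule summable_comparison_test')
  show "summable (\<lambda>n. (1 / 3 :: real) ^ Suc n)" by (subst summable_Suc_iff) simp
qed simp

lemma ternary_bounds: "0 \<le> ternary s" "ternary s < 1"
proof -
  show "0 \<le> ternary s" unfolding ternary_def by (intro suminf_nonneg ternary_summable) simp
  have "(\<lambda>n. (1 / 3 :: real) * (1 / 3) ^ n) sums (1 / 3 * (1 / (1 - 1 / 3)))"
    by (intro sums_mult geometric_sums) simp
  then have g: "(\<lambda>n. (1 / 3 :: real) ^ Suc n) sums (1 / 2)" by simp
  have "ternary s \<le> (\<Sum>n. (1 / 3 :: real) ^ Suc n)"
    unfolding ternary_def using g by (intro suminf_le ternary_summable) (auto simp: sums_iff)
  then show "ternary s < 1" using g by (simp add: sums_iff)
qed

lemma ternary_shift: "3 * ternary s = of_bool (s 0) + ternary (\<lambda>n. s (Suc n))"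
proof -
  have "ternary s = (\<Sum>n. of_bool (s (Suc n)) * (1 / 3) ^ Suc (Suc n)) + of_bool (s 0) * (1 / 3) ^ Suc 0"
    unfolding ternary_def by (subst suminf_split_head[OF ternary_summable]) simp
  also have "(\<Sum>n. of_bool (s (Suc n)) * (1 / 3 :: real) ^ Suc (Suc n)) = (\<Sum>n. (1 / 3) * (of_bool (s (Suc n)) * (1 / 3) ^ Suc n))"
    by (simp add: mult_ac)
  also have "\<dots> = 1 / 3 * ternary (\<lambda>n. s (Suc n))"
    unfolding ternary_def by (rule suminf_mult[OF ternary_summable])
  finally show ?thesis by simp
qed

lemma ternary_digit_ternary: "ternary_digit n (ternary s) \<longleftrightarrow> s n"
proof -
  have "\<lfloor>3 ^ Suc n * ternary s\<rfloor> mod 3 = of_bool (s n)"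
  proof (induction n arbitrary: s)
    case 0
    have "\<lfloor>3 * ternary s\<rfloor> = of_bool (s 0)"
      unfolding ternary_shift using ternary_bounds[of "\<lambda>n. s (Suc n)"] by (cases "s 0") (auto simp: floor_eq_iff)
    then show ?case by simp
  next
    case (Suc n)
    have "3 ^ Suc (Suc n) * ternary s = 3 ^ Suc n * (3 * ternary s)" by simp
    also have "\<dots> = 3 ^ Suc n * ternary (\<lambda>n. s (Suc n)) + real_of_int (3 * (3 ^ n * of_bool (s 0)))"
      unfolding ternary_shift by (simp add: algebra_simps)
    finally have "\<lfloor>3 ^ Suc (Suc n) * ternary s\<rfloor> = \<lfloor>3 ^ Suc n * ternary (\<lambda>n. s (Suc n))\<rfloor> + 3 * (3 ^ n * of_bool (s 0))"
      by (simp only: floor_add_int)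
    then show ?case using Suc.IH[of "\<lambda>n. s (Suc n)"] by simp
  qed
  then show ?thesis by (simp add: ternary_digit_def)
qed

lemma ternary_digit_measurable [measurable]: "Measurable.pred borel (ternary_digit n)"
  unfolding ternary_digit_def by measurable

text \<open>A Polish space embeds into the Cantor set by recording which members of a countable base contain
  a point. A sequence of digits comes from a point iff the corresponding basic sets form a
  filter with arbitrarily small members, which is a countable condition on the digits.\<close>

lemma (in Metric_space) filter_point:
  fixes U :: "nat \<Rightarrow> 'a set"
  assumes comp: "mcomplete" and U: "\<And>n. openin mtopology (U n)"
    and small: "\<And>m::nat. \<exists>n. s n \<and> (\<forall>a\<in>U n. \<forall>b\<in>U n. d a b < 1 / Suc m)"
    and dir: "\<And>m n. s m \<Longrightarrow> s n \<Longrightarrow> \<exists>k. s k \<and> mtopology closure_of U k \<subseteq> U m \<inter> U n"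
    and up: "\<And>k n. s k \<Longrightarrow> U k \<subseteq> U n \<Longrightarrow> s n"
    and ne: "\<And>n. s n \<Longrightarrow> U n \<noteq> {}"
  obtains x where "x \<in> M" "\<And>n. x \<in> U n \<longleftrightarrow> s n"
proof -
  have UM: "U n \<subseteq> M" for n using openin_subset[OF U] by simp
  have meet: "U m \<inter> U n \<noteq> {}" if mn: "s m" "s n" for m n
  proof -
    obtain k where k: "s k" "mtopology closure_of U k \<subseteq> U m \<inter> U n" using dir[OF mn] by blast
    have "U k \<subseteq> mtopology closure_of U k" using UM by (intro closure_of_subset) simp
    then show ?thesis using k ne[OF k(1)] by blast
  qed
  \<comment> \<open>One selected set of mutual distances below 1 / (m + 1) for each m. Since any two
    selected sets meet, points chosen from them form a Cauchy sequence; its limit is the required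
    point.\<close>
  obtain i where i: "\<And>m. s (i m)" "\<And>m a b. a \<in> U (i m) \<Longrightarrow> b \<in> U (i m) \<Longrightarrow> d a b < 1 / Suc m"
    using small by metis
  have "\<exists>p. p \<in> U (i m)" for m using ne[OF i(1)] by blast
  then obtain p where p: "\<And>m. p m \<in> U (i m)" by metis
  have pM: "p m \<in> M" for m using p UM by blast
  have near: "\<exists>q\<in>U n. d (p m) q < 1 / Suc m" if "s n" for m n
    using meet[OF that i(1)[of m]] i(2)[OF p] by blast
  have dist: "d (p m) (p n) < 1 / Suc m + 1 / Suc n" for m n
  proof -
    obtain q where q: "q \<in> U (i n)" "d (p m) q < 1 / Suc m" using near[OF i(1)] by blast
    have "d q (p n) < 1 / Suc n" using i(2)[OF q(1) p] .
    moreover have "d (p m) (p n) \<le> d (p m) q + d q (p n)" using pM q(1) UM by (intro triangle) auto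
    ultimately show ?thesis using q(2) by linarith
  qed
  have "MCauchy p"
    unfolding MCauchy_def
  proof (intro conjI allI impI)
    show "range p \<subseteq> M" using pM by blast
    fix e :: real assume "0 < e"
    then obtain L where L: "inverse (real (Suc L)) < e / 2" using reals_Archimedean[of "e / 2"] by auto
    have "d (p m) (p n) < e" if "L \<le> m" "L \<le> n" for m n
    proof -
      have "1 / Suc m \<le> 1 / Suc L" "1 / Suc n \<le> 1 / Suc L" using that by (auto intro!: divide_left_mono)
      then show ?thesis using dist[of m n] L by (simp add: inverse_eq_divide)
    qed
    then show "\<exists>L. \<forall>m n. L \<le> m \<longrightarrow> L \<le> n \<longrightarrow> d (p m) (p n) < e" by blast
  qed
  then obtain x where x: "limitin mtopology p x sequentially" using comp by (auto simp: mcomplete_def)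
  then have xM: "x \<in> M" using limitin_topspace by fastforce
  have cl: "x \<in> mtopology closure_of U n" if n: "s n" for n
    unfolding metric_closure_of
  proof (intro CollectI conjI allI impI xM)
    fix r :: real assume r: "0 < r"
    have "openin mtopology (mball x (r / 2))" "x \<in> mball x (r / 2)" using r xM by auto
    then have "\<forall>\<^sub>F m in sequentially. p m \<in> mball x (r / 2)" using x unfolding limitin_def by blast
    moreover have "\<forall>\<^sub>F m in sequentially. 1 / Suc m < r / 2"
      using order_tendstoD(2)[OF LIMSEQ_inverse_real_of_nat, of "r / 2"] r by (simp add: inverse_eq_divide)
    ultimately have "\<forall>\<^sub>F m in sequentially. p m \<in> mball x (r / 2) \<and> 1 / Suc m < r / 2"
      by eventually_elim simp
    then obtain m where m: "p m \<in> mball x (r / 2)" "1 / Suc m < r / 2"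
      using eventually_happens'[OF sequentially_bot] by blast
    obtain q where q: "q \<in> U n" "d (p m) q < 1 / Suc m" using near[OF n] by blast
    have "d x q \<le> d x (p m) + d (p m) q" using xM pM q(1) UM by (intro triangle) auto
    then have "d x q < r" using m q(2) by simp
    then show "\<exists>q\<in>U n. q \<in> mball x r" using q(1) xM UM by (intro bexI[of _ q]) auto
  qed
  \<comment> \<open>So far the limit lies only in closures. Directedness, applied to U n twice,
    provides a selected set whose closure is contained in U n.\<close>
  have iff: "x \<in> U n" if n: "s n" for n
  proof -
    obtain k where "s k" "mtopology closure_of U k \<subseteq> U n \<inter> U n" using dir[OF n n] by blast
    then show ?thesis using cl by blast
  qed
  have "s n" if n: "x \<in> U n" for n
  proof -
    obtain r where r: "0 < r" "mball x r \<subseteq> U n" using U[of n] n by (auto simp: openin_mtopology)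
    obtain m where m: "inverse (real (Suc m)) < r" using reals_Archimedean[OF r(1)] by auto
    \<comment> \<open>A selected set of small diameter contains x, so it lies in the ball and thus
      in U n; upward closure then selects n.\<close>
    have "U (i m) \<subseteq> mball x r"
    proof
      fix q assume q: "q \<in> U (i m)"
      have "d x q < 1 / Suc m" using i(2)[OF iff[OF i(1)] q] .
      then show "q \<in> mball x r" using m xM UM q by (auto simp: inverse_eq_divide)
    qed
    then show ?thesis using up[OF i(1), of m n] r(2) by blast
  qed
  then show thesis using that[OF xM] iff by blast
qed

text \<open>Supplies smallness and directedness in \<open>filter_point\<close> for the family of
  basic sets containing a fixed point. A closed ball inside V absorbs the closure, and a radius of
  at most r / 2 bounds mutual distances by r.\<close>

lemma (in Metric_space) base_refine:
  assumes base: "\<And>V x. openin mtopology V \<Longrightarrow> x \<in> V \<Longrightarrow> \<exists>n. x \<in> U n \<and> U n \<subseteq> V"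
    and V: "openin mtopology V" "x \<in> V" and r: "0 < (r::real)"
  obtains n where "x \<in> U n" "mtopology closure_of U n \<subseteq> V" "\<And>a b. a \<in> U n \<Longrightarrow> b \<in> U n \<Longrightarrow> d a b < r"
proof -
  obtain e where e: "0 < e" "mcball x e \<subseteq> V" using V by (auto simp: openin_mtopology_mcball)
  define h where "h = min e (r / 2)"
  have xM: "x \<in> M" using V openin_subset by fastforce
  have h: "0 < h" "h \<le> e" "h \<le> r / 2" using e r by (auto simp: h_def)
  obtain n where n: "x \<in> U n" "U n \<subseteq> mball x h"
    using base[of "mball x h" x] h xM by auto
  show thesis
  proof (rule that[OF n(1)])
    have "U n \<subseteq> mcball x h" using n(2) mball_subset_mcball by blast
    then have "mtopology closure_of U n \<subseteq> mcball x h" by (intro closure_of_minimal) auto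
    also have "\<dots> \<subseteq> mcball x e" using h(2) by (rule mcball_subset_concentric)
    finally show "mtopology closure_of U n \<subseteq> V" using e(2) by blast
    fix a b assume "a \<in> U n" "b \<in> U n"
    then have ab: "a \<in> M" "b \<in> M" "d x a < h" "d x b < h" using n(2) by auto
    have "d a b \<le> d x a + d x b" using ab xM triangle[of a x b] commute[of a x] by simp
    then show "d a b < r" using ab h by linarith
  qed
qed

text \<open>The left inverse is Borel on the whole line because the digit sequences that come from a
  point are cut out by countably many conditions; elsewhere it takes a default value.\<close>

lemma standard_borel_embedding:
  assumes sb: "standard_borel M" and ne: "space M \<noteq> {}"
  obtains h :: "'a \<Rightarrow> real" and hi where "h \<in> borel_measurable M" "hi \<in> measurable borel M"
    "\<And>x. x \<in> space M \<Longrightarrow> hi (h x) = x"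
proof -
  obtain X where X: "completely_metrizable_space X" "second_countable X"
      "topspace X = space M" "sets M = sigma_sets (space M) {U. openin X U}"
    using sb unfolding standard_borel_def by blast
  obtain S d where Sd: "Metric_space S d" "Metric_space.mcomplete S d" "X = Metric_space.mtopology S d"
    using X(1) unfolding completely_metrizable_space_def by blast
  interpret Metric_space S d by fact
  have SM: "S = space M" using X(3) Sd(3) by simp
  obtain \<B> where B: "countable \<B>" "\<And>V. V \<in> \<B> \<Longrightarrow> openin X V"
      "\<And>U x. openin X U \<Longrightarrow> x \<in> U \<Longrightarrow> \<exists>V \<in> \<B>. x \<in> V \<and> V \<subseteq> U"
    using X(2) unfolding second_countable_def by metis
  \<comment> \<open>The added {} guarantees that there is something to enumerate; the last condition
    in \<open>Y\<close> keeps it out of every filter.\<close>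
  define U where "U = from_nat_into (insert {} \<B>)"
  have U: "openin mtopology (U n)" for n
  proof -
    have "U n \<in> insert {} \<B>" unfolding U_def by (rule from_nat_into) simp
    then show ?thesis using B(2) Sd(3) by auto
  qed
  have base: "\<exists>n. x \<in> U n \<and> U n \<subseteq> V" if V: "openin mtopology V" "x \<in> V" for V x
  proof -
    obtain W where W: "W \<in> insert {} \<B>" "x \<in> W" "W \<subseteq> V" using B(3)[of V x] V Sd(3) by blast
    have "countable (insert {} \<B>)" using B(1) by simp
    then obtain n where "U n = W" unfolding U_def using from_nat_into_surj W(1) by metis
    then show ?thesis using W by blast
  qed
  have Um: "U n \<in> sets M" for n using U[of n] X(4) Sd(3) by auto
  have gen: "sets M = sigma_sets (space M) (range U)"
    unfolding X(4)
  proof (rule sigma_sets_eqI)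
    fix V assume "V \<in> {U. openin X U}"
    then have V: "openin mtopology V" using Sd(3) by simp
    have "V = (\<Union>n. if U n \<subseteq> V then U n else {})"
      using base[OF V] by (auto split: if_splits)
    also have "\<dots> \<in> sigma_sets (space M) (range U)"
      by (intro sigma_sets.Union) (auto intro: sigma_sets.Basic sigma_sets.Empty)
    finally show "V \<in> sigma_sets (space M) (range U)" .
  next
    fix V assume "V \<in> range U"
    then show "V \<in> sigma_sets (space M) {U. openin X U}" using U Sd(3) by (auto intro: sigma_sets.Basic)
  qed
  define h where "h x = ternary (\<lambda>n. x \<in> U n)" for x
  have h: "h \<in> borel_measurable M"
    unfolding h_def ternary_def using Um by (intro borel_measurable_suminf borel_measurable_times) auto
  have dig: "ternary_digit n (h x) \<longleftrightarrow> x \<in> U n" for n x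
    by (simp add: h_def ternary_digit_ternary)
  \<comment> \<open>The hypotheses of \<open>filter_point\<close>, read on the digits of y. Only the
    digits depend on y; inclusions and diameters are fixed truth values, so Y is built from Borel
    sets by countable operations.\<close>
  define Y where "Y = {y. (\<forall>m::nat. \<exists>n. ternary_digit n y \<and> (\<forall>a\<in>U n. \<forall>b\<in>U n. d a b < 1 / Suc m)) \<and>
    (\<forall>m n. ternary_digit m y \<longrightarrow> ternary_digit n y \<longrightarrow> (\<exists>k. ternary_digit k y \<and> mtopology closure_of U k \<subseteq> U m \<inter> U n)) \<and>
    (\<forall>k n. ternary_digit k y \<longrightarrow> U k \<subseteq> U n \<longrightarrow> ternary_digit n y) \<and> (\<forall>n. ternary_digit n y \<longrightarrow> U n \<noteq> {})}"
  have Y: "Y \<in> sets borel" unfolding Y_def by measurable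
  have hY: "h x \<in> Y" if x: "x \<in> space M" for x
    unfolding Y_def mem_Collect_eq dig
  proof (intro conjI allI impI)
    fix m :: nat
    show "\<exists>n. x \<in> U n \<and> (\<forall>a\<in>U n. \<forall>b\<in>U n. d a b < 1 / Suc m)"
      using base_refine[OF base openin_topspace[of mtopology], of x "1 / Suc m"] x SM
      by (metis of_nat_0_less_iff topspace_mtopology zero_less_Suc zero_less_divide_1_iff)
  next
    fix m n assume "x \<in> U m" "x \<in> U n"
    then show "\<exists>k. x \<in> U k \<and> mtopology closure_of U k \<subseteq> U m \<inter> U n"
      using base_refine[OF base openin_Int[OF U U], of x m n 1] by (metis IntI zero_less_one)
  qed auto
  have point: "\<exists>x\<in>space M. \<forall>n. x \<in> U n \<longleftrightarrow> ternary_digit n y" if y: "y \<in> Y" for y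
  proof -
    obtain x where "x \<in> S" "\<And>n. x \<in> U n \<longleftrightarrow> ternary_digit n y"
      using y by (rule_tac filter_point[OF Sd(2) U, of "\<lambda>n. ternary_digit n y"]) (auto simp: Y_def)
    then show ?thesis using SM by blast
  qed
  then obtain P where P: "\<And>y. y \<in> Y \<Longrightarrow> P y \<in> space M" "\<And>y n. y \<in> Y \<Longrightarrow> P y \<in> U n \<longleftrightarrow> ternary_digit n y"
    by metis
  obtain x0 where x0: "x0 \<in> space M" using ne by blast
  define hi where "hi y = (if y \<in> Y then P y else x0)" for y
  have "hi \<in> measurable borel M"
  proof (rule measurable_sigma_sets[OF gen])
    show "range U \<subseteq> Pow (space M)" using Um sets.sets_into_space by blast
    show "hi \<in> space borel \<rightarrow> space M" using P(1) x0 by (auto simp: hi_def)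
    fix V assume "V \<in> range U"
    then obtain n where n: "V = U n" by blast
    have "hi -` V \<inter> space borel = (Y \<inter> {y. ternary_digit n y}) \<union> ((- Y) \<inter> {y. x0 \<in> U n})"
      using P(2) by (auto simp: hi_def n split: if_splits)
    moreover have "{y. ternary_digit n y} \<in> sets borel" by measurable
    moreover have "{y::real. x0 \<in> U n} \<in> sets borel" by (cases "x0 \<in> U n") auto
    ultimately show "hi -` V \<inter> space borel \<in> sets borel" using Y by auto
  qed
  moreover have "hi (h x) = x" if x: "x \<in> space M" for x
  proof (rule ccontr)
    assume neq: "hi (h x) \<noteq> x"
    have hi: "hi (h x) \<in> space M" "\<And>n. hi (h x) \<in> U n \<longleftrightarrow> x \<in> U n"
      using P(1)[OF hY[OF x]] P(2)[OF hY[OF x]] hY[OF x] by (auto simp: hi_def dig)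
    have "x \<in> S" "hi (h x) \<in> S" using x hi(1) by (simp_all only: SM)
    then have "x \<in> mball x (d x (hi (h x)))" "hi (h x) \<notin> mball x (d x (hi (h x)))"
      using neq mdist_pos_eq[of x "hi (h x)"] by auto
    then show False using base[OF openin_mball, of x x "d x (hi (h x))"] hi(2) by blast
  qed
  ultimately show thesis using that h by blast
qed

section \<open>Isomorphisms up to null sets\<close>

text \<open>Both maps are total and mutually inverse only almost everywhere, so no conull subspaces
  have to be carried along. That g transports the measure back is a consequence, drawn in
  \<open>mod0_iso_sym\<close>.\<close>

definition mod0_iso :: "'a measure \<Rightarrow> 'b measure \<Rightarrow> ('a \<Rightarrow> 'b) \<Rightarrow> ('b \<Rightarrow> 'a) \<Rightarrow> bool" where
  "mod0_iso M N f g \<longleftrightarrow> f \<in> measurable M N \<and> g \<in> measurable N M \<and> distr M N f = N \<and>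
     (AE x in M. g (f x) = x) \<and> (AE y in N. f (g y) = y)"

lemma mod0_iso_sym:
  assumes "mod0_iso M N f g"
  shows "mod0_iso N M g f"
proof -
  have m: "f \<in> measurable M N" "g \<in> measurable N M" and d: "distr M N f = N" and ae: "AE x in M. g (f x) = x"
    using assms by (auto simp: mod0_iso_def)
  have "distr N M g = distr (distr M N f) M g" using d by simp
  also have "\<dots> = distr M M (g \<circ> f)" using m by (rule_tac distr_distr)
  also have "\<dots> = distr M M (\<lambda>x. x)" using m ae by (intro distr_cong_AE) auto
  finally show ?thesis using assms by (simp add: mod0_iso_def distr_id)
qed

lemma AE_mod0_iso:
  assumes "mod0_iso M N f g" "AE y in N. P y"
  shows "AE x in M. P (f x)"
proof -
  have f: "f \<in> measurable M N" and d: "distr M N f = N" using assms(1) by (auto simp: mod0_iso_def)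
  show ?thesis by (rule AE_distrD[OF f]) (simp only: d assms(2))
qed

lemma mod0_iso_trans:
  assumes 1: "mod0_iso M N f g" and 2: "mod0_iso N K f' g'"
  shows "mod0_iso M K (\<lambda>x. f' (f x)) (\<lambda>z. g (g' z))"
proof -
  have m [measurable]: "f \<in> measurable M N" "g \<in> measurable N M" "f' \<in> measurable N K" "g' \<in> measurable K N"
    using 1 2 by (auto simp: mod0_iso_def)
  have "distr M K (\<lambda>x. f' (f x)) = distr (distr M N f) K f'"
    by (subst distr_distr) (auto simp: comp_def)
  also have "\<dots> = K" using 1 2 by (simp add: mod0_iso_def)
  finally have d: "distr M K (\<lambda>x. f' (f x)) = K" .
  have ae: "AE x in M. g (f x) = x" "AE y in N. f (g y) = y" "AE y in N. g' (f' y) = y" "AE z in K. f' (g' z) = z"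
    using 1 2 by (simp_all add: mod0_iso_def)
  have a: "AE x in M. g (g' (f' (f x))) = x"
    using AE_mod0_iso[OF 1 ae(3)] ae(1) by eventually_elim simp
  have b: "AE z in K. f' (f (g (g' z))) = z"
    using AE_mod0_iso[OF mod0_iso_sym[OF 2] ae(2)] ae(4) by eventually_elim simp
  show ?thesis unfolding mod0_iso_def using d a b by auto
qed

text \<open>Since N is the image of M under f, almost every y behaves like some f x, for which f (g
  y) = f x = y; \<open>eq\<close> makes this a measurable condition.\<close>

lemma mod0_isoI:
  assumes m: "f \<in> measurable M N" "g \<in> measurable N M" and d: "distr M N f = N"
    and inv: "\<And>x. x \<in> space M \<Longrightarrow> g (f x) = x"
    and eq: "{y \<in> space N. f (g y) = y} \<in> sets N"
  shows "mod0_iso M N f g"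
proof -
  have "AE y in distr M N f. f (g y) = y"
    by (subst AE_distr_iff[OF m(1) eq]) (use inv in auto)
  then have "AE y in N. f (g y) = y" by (simp only: d)
  then show ?thesis unfolding mod0_iso_def using m d inv by auto
qed

abbreviation unit_lebesgue :: "real measure" where
  "unit_lebesgue \<equiv> restrict_space lborel {0<..<1}"

text \<open>The quantile function I carries Lebesgue measure to M. Without atoms the distribution
  function C is continuous, so C (I u) = u and C inverts I.\<close>

lemma (in cdf_distribution) mod0_iso_quantile:
  assumes na: "\<And>x. measure M {x} = 0"
  obtains f g where "mod0_iso unit_lebesgue M f g"
proof -
  \<comment> \<open>C may take the values 0 and 1, which lie outside the open interval; 1 / 2 is an
    arbitrary default there.\<close>
  define F where "F x = (if 0 < C x \<and> C x < 1 then C x else 1 / 2)" for x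
  have C[measurable]: "C \<in> borel_measurable borel" by (rule measurable_C)
  have F1: "F \<in> borel_measurable borel" unfolding F_def by measurable
  have F: "F \<in> measurable M unit_lebesgue"
  proof (rule measurable_restrict_space2)
    show "F \<in> space M \<rightarrow> {0<..<1}" by (auto simp: F_def)
    show "F \<in> measurable M lborel" using F1 by (simp cong: measurable_cong_sets)
  qed
  have I: "I \<in> measurable unit_lebesgue M"
    using measurable_CI by (simp cong: measurable_cong_sets add: sets_restrict_space)
  have CI: "C (I u) = u" if u: "0 < u" "u < 1" for u
  proof (rule antisym)
    show "u \<le> C (I u)" using pseudoinverse[OF u, of "I u"] by simp
    \<comment> \<open>To the left of I u the values of C are at most u, so left continuity gives the
      bound at I u itself.\<close>
    have "isCont C (I u)" using isCont_cdf na by blast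
    then have "(C \<longlongrightarrow> C (I u)) (at_left (I u))" by (simp add: isCont_def filterlim_at_split)
    moreover have "\<forall>\<^sub>F x in at_left (I u). C x \<le> u"
    proof (rule eventually_at_leftI[of "I u - 1"])
      fix x assume "x \<in> {I u - 1<..<I u}"
      then have "\<not> I u \<le> x" by simp
      then show "C x \<le> u" using pseudoinverse[OF u, of x] by simp
    qed simp
    ultimately show "C (I u) \<le> u" by (rule tendsto_upperbound) simp
  qed
  have d: "distr unit_lebesgue M I = M"
    using distr_I_eq_M by (metis distr_cong events_eq_borel)
  have eq: "{y \<in> space M. I (F y) = y} \<in> sets M"
  proof -
    have "(\<lambda>y. I (F y)) \<in> borel_measurable M"
      using measurable_compose[OF F I] by (simp cong: measurable_cong_sets)
    moreover have "(\<lambda>y. y) \<in> borel_measurable M" by (simp cong: measurable_cong_sets)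
    ultimately show ?thesis by (rule borel_measurable_eq)
  qed
  have "mod0_iso unit_lebesgue M I F"
    by (rule mod0_isoI[OF I F d _ eq]) (use CI in \<open>auto simp: F_def space_restrict_space\<close>)
  then show thesis by (rule that)
qed

lemma mod0_iso_unit_lebesgue:
  assumes prob: "prob_space M" and sb: "standard_borel M"
    and na: "\<And>x. x \<in> space M \<Longrightarrow> emeasure M {x} = 0"
  obtains f g where "mod0_iso M unit_lebesgue f g"
proof -
  interpret prob_space M by fact
  obtain h :: "'a \<Rightarrow> real" and hi where h: "h \<in> borel_measurable M" and hi: "hi \<in> measurable borel M"
    and inv: "\<And>x. x \<in> space M \<Longrightarrow> hi (h x) = x"
    using standard_borel_embedding[OF sb not_empty] by blast
  define K where "K = distr M borel h"
  have iso1: "mod0_iso M K h hi"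
  proof (rule mod0_isoI)
    show "h \<in> measurable M K" "hi \<in> measurable K M" "distr M K h = K"
      using h hi by (auto simp: K_def cong: measurable_cong_sets distr_cong)
    have "(\<lambda>y. h (hi y)) \<in> borel_measurable borel" using measurable_compose[OF hi h] .
    then show "{y \<in> space K. h (hi y) = y} \<in> sets K"
      unfolding K_def by (auto intro!: borel_measurable_eq)
  qed (rule inv)
  interpret K: cdf_distribution K
    unfolding K_def by (intro cdf_distribution.intro real_distribution_distr h)
  have "measure K {y} = 0" for y
  proof -
    have "emeasure K {y} = emeasure M (h -` {y} \<inter> space M)"
      unfolding K_def by (rule emeasure_distr[OF h]) simp
    also have "\<dots> = 0"
    proof (cases "h -` {y} \<inter> space M = {}")
      \<comment> \<open>h is injective on the space, so a nonempty fibre is a single point and has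
        measure 0.\<close>
      case False
      then obtain x where x: "x \<in> space M" "h x = y" by auto
      then have "h -` {y} \<inter> space M = {x}" using inv by (auto, metis)
      then show ?thesis using na[OF x(1)] by simp
    qed simp
    finally show ?thesis by (simp add: measure_def)
  qed
  then obtain f g where "mod0_iso unit_lebesgue K f g" using K.mod0_iso_quantile by blast
  from mod0_iso_trans[OF iso1 mod0_iso_sym[OF this]] show thesis by (rule that)
qed

lemma standard_borel_singleton:
  assumes "standard_borel M" "x \<in> space M"
  shows "{x} \<in> sets M"
proof -
  have "{y \<in> space M. y = x} \<in> sets M"
    using assms by (intro standard_borel_eq_sets[OF assms(1)]) auto
  moreover have "{y \<in> space M. y = x} = {x}" using assms(2) by auto
  ultimately show ?thesis by simp
qed

lemma atomless_singleton:
  assumes "standard_borel M" "atomless M" "x \<in> space M"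
  shows "emeasure M {x} = 0"
proof (rule ccontr)
  assume "emeasure M {x} \<noteq> 0"
  then have "0 < emeasure M {x}" using not_gr_zero by blast
  then obtain B where B: "B \<subseteq> {x}" "0 < emeasure M B" "emeasure M B < emeasure M {x}"
    using assms(2) standard_borel_singleton[OF assms(1,3)] unfolding atomless_def by blast
  then have "B = {} \<or> B = {x}" by blast
  then show False using B by auto
qed

section \<open>Existence of free actions\<close>

text \<open>Conjugating \<alpha> by f and g is multiplicative only where the almost sure identities
  hold, whereas \<open>group_action\<close> concerns every point. The conjugated action is therefore
  used on an invariant set and the identity off it; countability of the group makes the invariant
  set conull.\<close>

lemma free_mp_action_transport:
  fixes G (structure)
  assumes grp: "group G" and cnt: "countable (carrier G)"
    and sbZ: "standard_borel Z" and sbM: "standard_borel M"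
    and iso: "mod0_iso Z M f g"
    and meas: "\<And>a. a \<in> carrier G \<Longrightarrow> \<alpha> a \<in> measurable Z Z"
    and pres: "\<And>a. a \<in> carrier G \<Longrightarrow> distr Z Z (\<alpha> a) = Z"
    and one: "\<And>z. z \<in> space Z \<Longrightarrow> \<alpha> \<one> z = z"
    and mult: "\<And>a b z. a \<in> carrier G \<Longrightarrow> b \<in> carrier G \<Longrightarrow> z \<in> space Z \<Longrightarrow> \<alpha> (a \<otimes> b) z = \<alpha> a (\<alpha> b z)"
    and free: "AE z in Z. \<forall>a\<in>carrier G. \<alpha> a z = z \<longrightarrow> a = \<one>"
  shows "\<exists>\<phi>. free_mp_action G M \<phi>"
proof -
  interpret group G by fact
  have f: "f \<in> measurable Z M" and g: "g \<in> measurable M Z" and dg: "distr M Z g = Z" and df: "distr Z M f = M"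
    and gf: "AE z in Z. g (f z) = z" and fg: "AE y in M. f (g y) = y"
    using iso mod0_iso_sym[OF iso] by (auto simp: mod0_iso_def)
  note isoM = mod0_iso_sym[OF iso]
  \<comment> \<open>Quantifying over the group turns this into a condition on the whole orbit of z,
    hence an invariant one.\<close>
  define good where "good z \<longleftrightarrow> (\<forall>a\<in>carrier G. g (f (\<alpha> a z)) = \<alpha> a z)" for z
  define M1 where "M1 = {y \<in> space M. f (g y) = y \<and> good (g y)}"
  have gsp: "g y \<in> space Z" if "y \<in> space M" for y using measurable_space[OF g that] .
  have fsp: "f z \<in> space M" if "z \<in> space Z" for z using measurable_space[OF f that] .
  have asp: "\<alpha> a z \<in> space Z" if "a \<in> carrier G" "z \<in> space Z" for a z
    using measurable_space[OF meas that(2)] that(1) .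
  have comp: "(\<lambda>y. \<alpha> a (g y)) \<in> measurable M Z" if "a \<in> carrier G" for a
    using measurable_compose[OF g meas[OF that]] .
  have compf: "(\<lambda>y. f (\<alpha> a (g y))) \<in> measurable M M" if "a \<in> carrier G" for a
    using measurable_compose[OF comp[OF that] f] .
  have M1: "M1 \<in> sets M"
  proof -
    have "M1 = {y \<in> space M. f (g y) = y} \<inter>
        (\<Inter>a\<in>carrier G. {y \<in> space M. g (f (\<alpha> a (g y))) = \<alpha> a (g y)})"
      using one_closed by (auto simp: M1_def good_def)
    also have "\<dots> \<in> sets M"
    proof (intro sets.Int sets.countable_INT'[OF cnt] image_subsetI)
      show "{y \<in> space M. f (g y) = y} \<in> sets M"
        by (intro standard_borel_eq_sets[OF sbM] measurable_compose[OF g f]) simp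
      show "{y \<in> space M. g (f (\<alpha> a (g y))) = \<alpha> a (g y)} \<in> sets M" if "a \<in> carrier G" for a
        by (intro standard_borel_eq_sets[OF sbZ] comp[OF that] measurable_compose[OF compf[OF that] g])
      show "carrier G \<noteq> {}" using one_closed by blast
    qed
    finally show ?thesis .
  qed
  have aeM1: "AE y in M. y \<in> M1"
  proof -
    have "AE y in M. \<forall>a\<in>carrier G. g (f (\<alpha> a (g y))) = \<alpha> a (g y)"
    proof (subst AE_ball_countable[OF cnt], intro ballI)
      fix a assume a: "a \<in> carrier G"
      have "AE z in distr Z Z (\<alpha> a). g (f z) = z" by (simp only: pres[OF a] gf)
      then have "AE z in Z. g (f (\<alpha> a z)) = \<alpha> a z" by (rule AE_distrD[OF meas[OF a]])
      then show "AE y in M. g (f (\<alpha> a (g y))) = \<alpha> a (g y)" by (rule AE_mod0_iso[OF isoM])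
    qed
    then show ?thesis using fg AE_space by eventually_elim (simp add: M1_def good_def)
  qed
  define \<phi> where "\<phi> a = (\<lambda>y\<in>space M. if y \<in> M1 then f (\<alpha> a (g y)) else y)" for a
  have gphi: "g (\<phi> a y) = \<alpha> a (g y)" and phiM1: "\<phi> a y \<in> M1" if a: "a \<in> carrier G" and y: "y \<in> M1" for a y
  proof -
    have yM: "y \<in> space M" and gd: "good (g y)" using y by (auto simp: M1_def)
    have ph: "\<phi> a y = f (\<alpha> a (g y))" using y yM by (simp add: \<phi>_def)
    show 1: "g (\<phi> a y) = \<alpha> a (g y)" unfolding ph using gd a by (simp add: good_def)
    have "good (\<alpha> a (g y))"
      unfolding good_def
    proof
      fix b assume b: "b \<in> carrier G"
      have "g (f (\<alpha> (b \<otimes> a) (g y))) = \<alpha> (b \<otimes> a) (g y)" using gd a b by (simp add: good_def)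
      then show "g (f (\<alpha> b (\<alpha> a (g y)))) = \<alpha> b (\<alpha> a (g y))" by (simp only: mult[OF b a gsp[OF yM]])
    qed
    moreover have "\<phi> a y \<in> space M" unfolding ph by (intro fsp asp a gsp yM)
    ultimately show "\<phi> a y \<in> M1" unfolding M1_def using 1 ph by simp
  qed
  have phiO: "\<phi> a y = y" if "y \<in> space M" "y \<notin> M1" for a y using that by (simp add: \<phi>_def)
  have phisp: "\<phi> a y \<in> space M" if "a \<in> carrier G" "y \<in> space M" for a y
    using phiM1[OF that(1), of y] phiO[OF that(2), of a] that by (cases "y \<in> M1") (auto simp: M1_def)
  have phimult: "\<phi> (a \<otimes> b) y = \<phi> a (\<phi> b y)" if a: "a \<in> carrier G" and b: "b \<in> carrier G" and y: "y \<in> space M" for a b y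
  proof (cases "y \<in> M1")
    case True
    have "\<phi> a (\<phi> b y) = f (\<alpha> a (g (\<phi> b y)))" using phiM1[OF b True] by (simp add: \<phi>_def M1_def)
    also have "\<dots> = f (\<alpha> (a \<otimes> b) (g y))" using gphi[OF b True] mult[OF a b gsp[OF y]] by simp
    finally show ?thesis using True y by (simp add: \<phi>_def)
  qed (use phiO y in simp)
  have phione: "\<phi> \<one> y = y" if y: "y \<in> space M" for y
    using y one gsp by (simp add: \<phi>_def M1_def)
  have phiBij: "\<phi> a \<in> Bij (space M)" if a: "a \<in> carrier G" for a
  proof -
    have "bij_betw (\<phi> a) (space M) (space M)"
    proof (rule bij_betw_byWitness[where f'="\<phi> (inv a)"])
      show "\<forall>y\<in>space M. \<phi> (inv a) (\<phi> a y) = y"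
        using phimult[of "inv a" a] phione a by (metis inv_closed l_inv)
      show "\<forall>y\<in>space M. \<phi> a (\<phi> (inv a) y) = y"
        using phimult[of a "inv a"] phione a by (metis inv_closed r_inv)
    qed (use phisp a in auto)
    then show ?thesis by (simp add: Bij_def \<phi>_def)
  qed
  have "group_action G (space M) \<phi>"
  proof (rule group_action.intro, rule group_hom.intro[OF grp group_BijGroup], rule group_hom_axioms.intro, rule homI)
    show "\<phi> a \<in> carrier (BijGroup (space M))" if "a \<in> carrier G" for a
      using phiBij[OF that] by (simp add: BijGroup_def)
    fix a b assume ab: "a \<in> carrier G" "b \<in> carrier G"
    have "\<phi> (a \<otimes> b) = compose (space M) (\<phi> a) (\<phi> b)"
      using phimult[OF ab] by (auto simp: compose_def \<phi>_def intro!: ext)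
    then show "\<phi> (a \<otimes> b) = \<phi> a \<otimes>\<^bsub>BijGroup (space M)\<^esub> \<phi> b"
      using phiBij ab by (simp add: BijGroup_def)
  qed
  moreover have phim: "\<phi> a \<in> measurable M M" if a: "a \<in> carrier G" for a
  proof -
    have "(\<lambda>y. if y \<in> M1 then f (\<alpha> a (g y)) else y) \<in> measurable M M"
      using M1 compf[OF a] sets.sets_into_space[OF M1]
      by (intro measurable_If) (auto simp: Int_absorb1 Int_def[symmetric])
    then show ?thesis unfolding \<phi>_def by (simp cong: measurable_cong)
  qed
  moreover have "distr M M (\<phi> a) = M" if a: "a \<in> carrier G" for a
  proof -
    have "distr M M (\<phi> a) = distr M M (\<lambda>y. f (\<alpha> a (g y)))"
    proof (intro distr_cong_AE refl phim[OF a] compf[OF a])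
      show "AE y in M. \<phi> a y = f (\<alpha> a (g y))"
        using aeM1 AE_space by eventually_elim (simp add: \<phi>_def)
    qed
    also have "\<dots> = distr (distr M Z (\<lambda>y. \<alpha> a (g y))) M f"
      using distr_distr[OF f comp[OF a]] by (simp add: comp_def)
    also have "distr M Z (\<lambda>y. \<alpha> a (g y)) = distr (distr M Z g) Z (\<alpha> a)"
      using distr_distr[OF meas[OF a] g] by (simp add: comp_def)
    finally show ?thesis by (simp only: dg pres[OF a] df)
  qed
  moreover have "AE y in M. stabilizer G \<phi> y = {\<one>}"
    using AE_mod0_iso[OF isoM free] aeM1 AE_space
  proof eventually_elim
    case (elim y)
    have "a = \<one>" if a: "a \<in> carrier G" "\<phi> a y = y" for a
      using elim gphi[OF a(1), of y] a by simp
    then show ?case using phione elim by (auto simp: stabilizer_def)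
  qed
  ultimately show ?thesis unfolding free_mp_action_def by blast
qed

section \<open>The Bernoulli shift\<close>

abbreviation unit_uniform :: "real measure" where
  "unit_uniform \<equiv> uniform_measure lborel {0..1}"

text \<open>The factors are measures on the whole line, concentrated on [0, 1], so the product lives
  on all of \<open>nat \<Rightarrow> real\<close> with the Borel sets of its Polish product
  topology.\<close>

abbreviation bernoulli_space :: "(nat \<Rightarrow> real) measure" where
  "bernoulli_space \<equiv> PiM UNIV (\<lambda>_. unit_uniform)"

lemma prob_space_unit_uniform: "prob_space unit_uniform"
  by (rule prob_space_uniform_measure) auto

lemma sets_bernoulli_space: "sets bernoulli_space = sets borel"
proof -
  have "sets bernoulli_space = sets (PiM UNIV (\<lambda>_::nat. borel :: real measure))"
    by (intro sets_PiM_cong) auto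
  then show ?thesis by (simp add: sets_PiM_equal_borel)
qed

lemma standard_borel_bernoulli_space: "standard_borel bernoulli_space"
  unfolding standard_borel_def
proof (intro exI[of _ euclidean] conjI)
  show "completely_metrizable_space (euclidean :: (nat \<Rightarrow> real) topology)"
    by (rule completely_metrizable_space_euclidean)
  obtain B :: "(nat \<Rightarrow> real) set set" where "countable B" "topological_basis B"
    using ex_countable_basis by blast
  then show "second_countable (euclidean :: (nat \<Rightarrow> real) topology)"
    unfolding second_countable_def by (metis open_openin topological_basisE topological_basis_open)
  show "topspace euclidean = space bernoulli_space" by (simp add: space_PiM)
  show "sets bernoulli_space = sigma_sets (space bernoulli_space) {U. openin euclidean U}"
    unfolding sets_bernoulli_space by (simp add: sets_borel space_PiM)
qed

text \<open>Up to a null set the diagonal is covered by m squares of side 1 / m. Each has measure 1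
  / m^2 by independence, so the total is 1 / m for every m.\<close>

lemma AE_bernoulli_space_neq:
  assumes "i \<noteq> j"
  shows "AE z in bernoulli_space. z i \<noteq> z j"
proof -
  interpret U: prob_space unit_uniform by (rule prob_space_unit_uniform)
  interpret product_prob_space "\<lambda>_::nat. unit_uniform" UNIV ..
  have comp: "(\<lambda>z. z k) \<in> borel_measurable bernoulli_space" for k
    using measurable_component_singleton[of k UNIV "\<lambda>_. unit_uniform"] by simp
  define D where "D = {z \<in> space bernoulli_space. z i = z j}"
  have D: "D \<in> sets bernoulli_space" unfolding D_def by (rule borel_measurable_eq[OF comp comp])
  define W where "W = {z \<in> space bernoulli_space. z i \<in> - {0..1}}"
  have W: "W \<in> sets bernoulli_space"
    unfolding W_def using measurable_sets[OF comp, of "- {0..1}" i] by (simp add: vimage_def Int_def conj_commute)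
  have W0: "emeasure bernoulli_space W = 0"
    unfolding W_def by (subst emeasure_PiM_Collect_single) (auto simp: emeasure_uniform_measure)
  have bound: "emeasure bernoulli_space D \<le> ennreal (1 / real m)" if m: "0 < m" for m :: nat
  proof -
    define A where "A k = {real k / real m .. (real k + 1) / real m}" for k
    define E where "E k = {z \<in> space bernoulli_space. \<forall>l\<in>{i, j}. z l \<in> A k}" for k
    have UA: "emeasure unit_uniform (A k) = ennreal (1 / real m)" if k: "k < m" for k
    proof -
      have "(real k + 1) / real m \<le> 1" "0 \<le> real k / real m" using k m by (auto simp: field_simps)
      then have "{0..1} \<inter> A k = A k" unfolding A_def by auto
      then have "emeasure unit_uniform (A k) = emeasure lborel (A k)"
        by (subst emeasure_uniform_measure) (auto simp: A_def divide_ennreal_def)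
      also have "\<dots> = ennreal (1 / real m)"
        using m by (simp add: A_def divide_right_mono add_divide_distrib)
      finally show ?thesis .
    qed
    have Ee: "emeasure bernoulli_space (E k) = ennreal (1 / real m * (1 / real m))" if "k < m" for k
    proof -
      have "emeasure bernoulli_space (E k) = (\<Prod>l\<in>{i, j}. emeasure unit_uniform (A k))"
        unfolding E_def by (rule emeasure_PiM_Collect) (auto simp: A_def)
      also have "\<dots> = ennreal (1 / real m) * ennreal (1 / real m)"
        using assms unfolding UA[OF that] by simp
      also have "\<dots> = ennreal (1 / real m * (1 / real m))" by (rule ennreal_mult[symmetric]) auto
      finally show ?thesis .
    qed
    have Em: "E k \<in> sets bernoulli_space" for k
    proof -
      have "E k = ((\<lambda>z. z i) -` A k \<inter> space bernoulli_space) \<inter> ((\<lambda>z. z j) -` A k \<inter> space bernoulli_space)"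
        by (auto simp: E_def)
      then show ?thesis using measurable_sets[OF comp, of "A k" i] measurable_sets[OF comp, of "A k" j] by (simp add: A_def)
    qed
    have "D \<subseteq> W \<union> (\<Union>k<m. E k)"
    proof
      fix z assume z: "z \<in> D"
      show "z \<in> W \<union> (\<Union>k<m. E k)"
      proof (cases "z i \<in> {0..1}")
        case True
        show ?thesis
        proof (cases "z i = 1")
          case True
          \<comment> \<open>At 1 the floor used in the other case would give the index m, one too
            many, so this point goes to the last interval.\<close>
          then have "z i \<in> A (m - 1)" using m by (auto simp: A_def of_nat_diff)
          then have "z \<in> E (m - 1)" using z by (auto simp: E_def D_def)
          then show ?thesis using m by (intro UnI2 UN_I[of "m - 1"]) auto
        next
          case False
          define k where "k = nat \<lfloor>real m * z i\<rfloor>"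
          have nn: "0 \<le> real m * z i" "real m * z i < real m" using True False m by auto
          then have "real k \<le> real m * z i" "real m * z i < real k + 1" by (auto simp: k_def)
          then have zk: "z i \<in> A k" "k < m" using m nn by (auto simp: A_def field_simps)
          then have "z \<in> E k" using z by (auto simp: E_def D_def)
          then show ?thesis using zk by blast
        qed
      next
        case False
        then show ?thesis using z by (auto simp: W_def D_def)
      qed
    qed
    then have "emeasure bernoulli_space D \<le> emeasure bernoulli_space (W \<union> (\<Union>k<m. E k))"
      using W Em by (intro emeasure_mono) auto
    also have "\<dots> = emeasure bernoulli_space (\<Union>k<m. E k)"
      using W W0 Em by (subst Un_commute, intro emeasure_Un_null_set) auto
    also have "\<dots> \<le> (\<Sum>k<m. emeasure bernoulli_space (E k))"
      using Em by (intro emeasure_subadditive_finite) auto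
    also have "\<dots> = (\<Sum>k<m. ennreal (1 / real m * (1 / real m)))" using Ee by simp
    also have "\<dots> = ennreal (1 / real m)"
      using m by (simp add: ennreal_of_nat_eq_real_of_nat flip: ennreal_mult)
    finally show ?thesis .
  qed
  have "emeasure bernoulli_space D \<le> 0"
  proof (rule ennreal_le_epsilon)
    fix e :: real assume e: "0 < e"
    obtain n :: nat where n: "inverse (real (Suc n)) < e" using reals_Archimedean[OF e] by blast
    have "emeasure bernoulli_space D \<le> ennreal (1 / real (Suc n))" by (rule bound) simp
    also have "\<dots> \<le> ennreal e" using n by (intro ennreal_leI) (simp add: inverse_eq_divide)
    finally show "emeasure bernoulli_space D \<le> 0 + ennreal e" by simp
  qed
  then have "D \<in> null_sets bernoulli_space" using D by (auto simp: null_sets_def)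
  then have "AE z in bernoulli_space. z \<notin> D" by (rule AE_not_in)
  then show ?thesis using AE_space by eventually_elim (simp add: D_def)
qed

lemma bernoulli_space_singleton: "emeasure bernoulli_space {z} = 0"
proof -
  interpret U: prob_space unit_uniform by (rule prob_space_unit_uniform)
  interpret product_prob_space "\<lambda>_::nat. unit_uniform" UNIV ..
  have "emeasure bernoulli_space {z} \<le> emeasure bernoulli_space {y \<in> space bernoulli_space. y 0 \<in> {z 0}}"
  proof (rule emeasure_mono)
    have "(\<lambda>y. y 0) \<in> borel_measurable bernoulli_space"
      using measurable_component_singleton[of 0 UNIV "\<lambda>_. unit_uniform"] by simp
    from measurable_sets[OF this, of "{z 0}"]
    show "{y \<in> space bernoulli_space. y 0 \<in> {z 0}} \<in> sets bernoulli_space"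
      by (simp add: vimage_def Int_def conj_commute)
  qed (auto simp: space_PiM)
  also have "\<dots> = emeasure unit_uniform {z 0}" by (rule emeasure_PiM_Collect_single) auto
  also have "\<dots> = 0" by (subst emeasure_uniform_measure) (auto intro: emeasure_lborel_countable countable_subset)
  finally show ?thesis by simp
qed

text \<open>An enumeration of the group turns translation into a permutation of the coordinates,
  which preserves a product of equal factors. A nontrivial element moves the coordinate 0, and two
  different coordinates almost never agree.\<close>

lemma exists_free_mp_action:
  fixes G (structure)
  assumes grp: "group G" and cnt: "countable (carrier G)" and inf: "infinite (carrier G)"
    and M: "standard_atomless_prob_space M"
  shows "\<exists>\<phi>. free_mp_action G M \<phi>"
proof -
  interpret group G by fact
  interpret U: prob_space unit_uniform by (rule prob_space_unit_uniform)
  have Mp: "prob_space M" "standard_borel M" "atomless M"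
    using M by (auto simp: standard_atomless_prob_space_def)
  have Zp: "prob_space bernoulli_space" by (intro prob_space_PiM prob_space_unit_uniform)
  obtain f g where fg: "mod0_iso M unit_lebesgue f g"
    using mod0_iso_unit_lebesgue[OF Mp(1,2) atomless_singleton[OF Mp(2,3)]] by blast
  obtain f' g' where fg': "mod0_iso bernoulli_space unit_lebesgue f' g'"
    using mod0_iso_unit_lebesgue[OF Zp standard_borel_bernoulli_space bernoulli_space_singleton] by blast
  define e where "e = from_nat_into (carrier G)"
  define \<tau> where "\<tau> = to_nat_on (carrier G)"
  have e: "e n \<in> carrier G" for n using inf by (metis e_def finite.emptyI from_nat_into)
  have \<tau>e: "\<tau> (e n) = n" for n unfolding \<tau>_def e_def by (rule to_nat_on_from_nat_into_infinite[OF cnt inf])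
  have e\<tau>: "e (\<tau> a) = a" if "a \<in> carrier G" for a
    unfolding \<tau>_def e_def using from_nat_into_to_nat_on[OF cnt that] .
  \<comment> \<open>Passing to coordinates reverses products; the inverse compensates for this, so
    that \<alpha> is a left action.\<close>
  define \<sigma> where "\<sigma> a n = \<tau> (inv a \<otimes> e n)" for a n
  have e\<sigma>: "e (\<sigma> a n) = inv a \<otimes> e n" if "a \<in> carrier G" for a n
    unfolding \<sigma>_def using that e by (intro e\<tau>) simp
  define \<alpha> where "\<alpha> a z = (\<lambda>n. z (\<sigma> a n))" for a and z :: "nat \<Rightarrow> real"
  have inj: "inj (\<sigma> a)" if a: "a \<in> carrier G" for a
  proof (rule injI)
    fix m n assume "\<sigma> a m = \<sigma> a n"
    then have "inv a \<otimes> e m = inv a \<otimes> e n" using e\<sigma>[OF a] by metis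
    then have "e m = e n" using a e by simp
    then show "m = n" using \<tau>e by metis
  qed
  show ?thesis
  proof (rule free_mp_action_transport[OF grp cnt standard_borel_bernoulli_space Mp(2)
        mod0_iso_trans[OF fg' mod0_iso_sym[OF fg]], of \<alpha>])
    fix a assume a: "a \<in> carrier G"
    have \<alpha>r: "\<alpha> a = (\<lambda>z. \<lambda>n\<in>UNIV. z (\<sigma> a n))" by (simp add: \<alpha>_def fun_eq_iff)
    show "\<alpha> a \<in> measurable bernoulli_space bernoulli_space"
      unfolding \<alpha>r by (intro measurable_restrict measurable_component_singleton) auto
    show "distr bernoulli_space bernoulli_space (\<alpha> a) = bernoulli_space"
      unfolding \<alpha>r using distr_PiM_reindex[of UNIV "\<lambda>_. unit_uniform" "\<sigma> a" UNIV] inj[OF a]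
        prob_space_unit_uniform by simp
  next
    fix z assume "z \<in> space bernoulli_space"
    show "\<alpha> \<one> z = z" using e by (simp add: \<alpha>_def \<sigma>_def \<tau>e)
  next
    fix a b z assume ab: "a \<in> carrier G" "b \<in> carrier G"
    have "\<sigma> (a \<otimes> b) n = \<sigma> b (\<sigma> a n)" for n
    proof -
      have "inv (a \<otimes> b) \<otimes> e n = inv b \<otimes> e (\<sigma> a n)"
        using ab e by (simp add: e\<sigma> inv_mult_group m_assoc)
      then show ?thesis by (simp add: \<sigma>_def)
    qed
    then show "\<alpha> (a \<otimes> b) z = \<alpha> a (\<alpha> b z)" by (simp add: \<alpha>_def)
  next
    show "AE z in bernoulli_space. \<forall>a\<in>carrier G. \<alpha> a z = z \<longrightarrow> a = \<one>"
    proof (subst AE_ball_countable[OF cnt], intro ballI)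
      fix a assume a: "a \<in> carrier G"
      show "AE z in bernoulli_space. \<alpha> a z = z \<longrightarrow> a = \<one>"
      proof (cases "a = \<one>")
        case False
        have "\<sigma> a 0 \<noteq> 0"
        proof
          assume "\<sigma> a 0 = 0"
          then have "inv a \<otimes> e 0 = e 0" using e\<sigma>[OF a, of 0] by simp
          then have "inv a = \<one>" using a e[of 0] by (metis inv_closed r_cancel_one)
          then show False using False a by (metis inv_inv inv_one)
        qed
        from AE_bernoulli_space_neq[OF this] show ?thesis
          by eventually_elim (metis \<alpha>_def)
      qed simp
    qed
  qed
qed

section \<open>The cost of the Thompson groups\<close>

theorem proposition3p4:
  fixes N :: nat and M :: "'a measure"
  assumes "N \<ge> 2" and "standard_atomless_prob_space M"
  shows "group_cost M (thompson_group N) = 1"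
proof -
  let ?G = "thompson_group N"
  have M: "prob_space M" "standard_borel M"
    using assms(2) by (auto simp: standard_atomless_prob_space_def)
  have grp: "group ?G" by (rule group_thompson[OF assms(1)])
  have cnt: "countable (carrier ?G)" using countable_thompson[OF assms(1)] by (simp add: carrier_thompson)
  have c: "thompson_bump N n \<in> carrier ?G" for n
    using thompson_bump_carrier[OF assms(1)] by (simp add: carrier_thompson)
  have inf: "infinite (carrier ?G)"
  proof
    assume "finite (carrier ?G)"
    moreover have "range (\<lambda>k::nat. thompson_bump N 0 [^]\<^bsub>?G\<^esub> k) \<subseteq> carrier ?G"
      using monoid.nat_pow_closed[OF group.is_monoid[OF grp] c] by blast
    ultimately show False using thompson_bump_infinite_order[OF assms(1)] finite_subset by blast
  qed
  have cost: "relation_cost M (orbit_relation ?G M \<phi>) = 1" if "free_mp_action ?G M \<phi>" for \<phi>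
  proof -
    interpret free_pmp_action ?G M \<phi> by (rule free_pmp_action.intro[OF that M])
    show ?thesis
    proof (rule antisym)
      show "relation_cost M (orbit_relation ?G M \<phi>) \<le> 1"
        using thompson_bump_conj[OF assms(1)]
        by (intro relation_cost_le_1[where c="thompson_bump N", OF cnt c thompson_bump_infinite_order[OF assms(1)]
              thompson_bump_commute[OF assms(1)]]) (simp add: carrier_thompson)
      show "1 \<le> relation_cost M (orbit_relation ?G M \<phi>)" by (rule relation_cost_ge_1[OF inf])
    qed
  qed
  \<comment> \<open>All free actions have the same cost 1, but an infimum over no action at all
    would be \<infinity>.\<close>
  obtain \<phi> where "free_mp_action ?G M \<phi>" using exists_free_mp_action[OF grp cnt inf assms(2)] by blast
  then have "{relation_cost M (orbit_relation ?G M \<phi>) |\<phi>. free_mp_action ?G M \<phi>} = {1}"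
    using cost by force
  then show ?thesis by (simp add: group_cost_def)
qed

end
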